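(* Let $k$ be a natural number. (i) Let $s$ and $m$ be non-negative integers with $2m\le k$ and $s\ge (k-m)^2+(k-m)$. Then for each $\varepsilon>0$ one has $$J_{s,k}(X)\ll X^{2s-\frac12 k(k+1)+\delta_{k,m}+\varepsilon},\qquad \delta_{k,m}=m^2.$$ (ii) Let $s$ and $m$ be non-negative integers with $2m\le k-1$ and $s\ge (k-m)^2-1$. Then for each $\varepsilon>0$ one has $$J_{s,k}(X)\ll X^{2s-\frac12 k(k+1)+\delta_{k,m}+\varepsilon},\qquad \delta_{k,m}=m^2+m+\frac{m}{k-m-1}.$$ The implicit constants may depend on $s$, $k$ and $\varepsilon$.
   Context: For natural numbers $k,s$ and real $X\ge 1$, $J_{s,k}(X)$ denotes the number of integral solutions $(x_1,\dots,x_s,y_1,\dots,y_s)$ of the system $\sum_{i=1}^s (x_i^j-y_i^j)=0$ $(1\le j\le k)$ with $1\le x_i,y_i\le X$ $(1\le i\le s)$.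
   Formalization: In (ii) s is taken to be at least 1, which excludes only k=1, m=0, s=0, where the claimed bound X^{-1+ε} fails since J=1; for k=1, m=0 the undefined term m/(k-m-1)=0/0 is read as 0. *)

theory Defs
  imports Complex_Main "HOL-Library.FuncSet"
begin

text \<open>
  Tuples are extensional functions on the index set \<open>{1..s}\<close>, so that distinct
  functions represent distinct tuples and the cardinality is the number of solutions.
  For \<open>s = 0\<close> the pair of empty tuples is the only solution, giving the value 1.
\<close>

definition vinogradov_solutions :: "nat \<Rightarrow> nat \<Rightarrow> real \<Rightarrow> ((nat \<Rightarrow> int) \<times> (nat \<Rightarrow> int)) set" where
  "vinogradov_solutions s k X =
     {(x, y). x \<in> {1..s} \<rightarrow>\<^sub>E {z. 1 \<le> z \<and> real_of_int z \<le> X} \<and>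
              y \<in> {1..s} \<rightarrow>\<^sub>E {z. 1 \<le> z \<and> real_of_int z \<le> X} \<and>
              (\<forall>j\<in>{1..k}. (\<Sum>i=1..s. x i ^ j - y i ^ j) = 0)}"

definition vinogradov_J :: "nat \<Rightarrow> nat \<Rightarrow> real \<Rightarrow> nat" where
  "vinogradov_J s k X = card (vinogradov_solutions s k X)"

end

theory Submission
  imports Defs "HOL-Computational_Algebra.Polynomial" "HOL-Number_Theory.Cong" "HOL-Analysis.Convex"
begin

text \<open>
  Both parts follow from the bound \<open>J\<^sub>s\<^sub>,\<^sub>k(X) \<lless> X\<^sup>\<epsilon> (X\<^sup>s + X\<^bsup>2s - k(k+1)/2\<^esup>)\<close>, since the hypotheses imply
  that the exponents in question are at least \<open>s\<close>.  This bound is proved by a \<open>p\<close>-adic version, for one large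
  fixed prime \<open>p\<close>, of the decoupling argument of Guo, Li, Yung and Zorin-Kranich.

  Let \<open>P = k(k+1)\<close> and compare the \<open>P\<close>-th moment of an exponential sum \<open>f\<close> of degree \<open>k\<close> with the moments of
  its pieces over residue classes modulo \<open>p\<^sup>n\<close>.  For two classes modulo \<open>p\<^sup>a\<close> and \<open>p\<^sup>b\<close> that are distinct modulo
  \<open>p\<close>, consider the mixed moments of \<open>|f\<^sub>1|\<^bsup>l(l+1)\<^esup> |f\<^sub>2|\<^bsup>P - l(l+1)\<^esup>\<close>.  The factor \<open>f\<^sub>2\<close> is locally constant
  in those phases that are constant on its class, and with respect to them \<open>f\<^sub>1\<close> is a sum of degree \<open>l\<close> to which
  decoupling in degree \<open>l < k\<close> applies; this refines \<open>p\<^sup>a\<close> to about \<open>p\<^bsup>(k-l+1)b/l\<^esup>\<close>.  Hoelder's inequality then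
  interpolates between \<open>k - l\<close> with the roles of the classes exchanged and \<open>l - 1\<close>.  Iterating the two steps
  makes the total saving over the trivial bound grow linearly if the best decoupling exponent \<open>\<eta>\<close> is positive,
  and this is a contradiction.
\<close>

section \<open>Averages over groups of phases\<close>

text \<open>Working p-adically makes local constancy exact: multiplying by a phase that is constant
  on a residue class leaves the modulus of the sum over that class unchanged, so subgroups and
  finite means replace weights and uncertainty principles. The obstacle is that the lower degree
  phases on a class do not form a moment curve, only a perturbation of one by multiples of p. The
  induction on k must therefore cover all such curves, with arbitrary coefficients. The
  contradiction is a matter of costs. To enter the bilinear iteration, one of two classes modulo p
  is cut crudely into p^u classes, which loses at most p^(u (crit k + 1)), while t rounds save p^(u
  gain). The gains summed over l grow by eta (k - 1)/k per round, so for t large some gain is at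
  least crit k + 2. As u is about n / k^(t+1), the exponent eta drops by a fixed amount. Pairs
  inside one class modulo p lose 2^(crit k) but descend one scale, worth p^(crit k / 2 - 1). This,
  and the need to invert k!, is why p is large. The length X enters only at the end: p^n is chosen
  just above X, so that classes modulo p^n are single points.\<close>

definition avg :: "'b set \<Rightarrow> ('b \<Rightarrow> 'a::field) \<Rightarrow> 'a" where
  "avg A F = (\<Sum>x\<in>A. F x) / of_nat (card A)"

lemma avg_cong: "(\<And>x. x \<in> A \<Longrightarrow> F x = G x) \<Longrightarrow> avg A F = avg A G"
  by (simp add: avg_def)

lemma avg_add: "avg A (\<lambda>x. F x + G x) = avg A F + avg A G"
  by (simp add: avg_def sum.distrib add_divide_distrib)

lemma avg_mult: "avg A (\<lambda>x. c * F x) = c * avg A F"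
  by (simp add: avg_def sum_distrib_left)

lemma avg_sum: "avg A (\<lambda>x. \<Sum>i\<in>I. F i x) = (\<Sum>i\<in>I. avg A (F i))"
  unfolding avg_def by (subst sum.swap) (simp add: sum_divide_distrib)

lemma avg_swap: "avg A (\<lambda>x. avg B (F x)) = avg B (\<lambda>y. avg A (\<lambda>x. F x y))"
proof -
  have "(\<Sum>x\<in>A. (\<Sum>y\<in>B. F x y)) = (\<Sum>y\<in>B. (\<Sum>x\<in>A. F x y))" by (rule sum.swap)
  then show ?thesis
    unfolding avg_def
    by (simp only: sum_divide_distrib[symmetric] divide_divide_eq_left mult.commute[of "of_nat (card A)"])
qed

lemma avg_const: "finite A \<Longrightarrow> A \<noteq> {} \<Longrightarrow> avg A (\<lambda>_. c :: 'a::field_char_0) = c"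
  by (simp add: avg_def)

lemma avg_mono: "(\<And>x. x \<in> A \<Longrightarrow> F x \<le> G x) \<Longrightarrow> avg A F \<le> (avg A G :: real)"
  by (simp add: avg_def divide_right_mono sum_mono)

lemma avg_nonneg: "(\<And>x. x \<in> A \<Longrightarrow> 0 \<le> F x) \<Longrightarrow> 0 \<le> (avg A F :: real)"
  by (simp add: avg_def sum_nonneg)

text \<open>A finite set of unimodular functions closed under products is automatically a group. It
  replaces the torus of frequencies; taking the functions themselves instead of their coefficients
  makes subgroups and substitutions plain set operations.\<close>

definition phase_group :: "(int \<Rightarrow> complex) set \<Rightarrow> bool" where
  "phase_group \<Phi> \<longleftrightarrow> finite \<Phi> \<and> (\<lambda>_. 1) \<in> \<Phi> \<and>
     (\<forall>\<chi>\<in>\<Phi>. \<forall>\<psi>\<in>\<Phi>. (\<lambda>x. \<chi> x * \<psi> x) \<in> \<Phi>) \<and> (\<forall>\<chi>\<in>\<Phi>. \<forall>x. cmod (\<chi> x) = 1)"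

lemma phase_group_nonempty: "phase_group \<Phi> \<Longrightarrow> \<Phi> \<noteq> {}"
  unfolding phase_group_def by blast

lemma phase_groupI:
  assumes "finite \<Phi>" "(\<lambda>_. 1) \<in> \<Phi>"
    "\<And>\<chi> \<psi>. \<chi> \<in> \<Phi> \<Longrightarrow> \<psi> \<in> \<Phi> \<Longrightarrow> (\<lambda>x. \<chi> x * \<psi> x) \<in> \<Phi>"
    "\<And>\<chi> x. \<chi> \<in> \<Phi> \<Longrightarrow> cmod (\<chi> x) = 1"
  shows "phase_group \<Phi>"
  unfolding phase_group_def by (intro conjI ballI allI assms)

lemma phase_group_mult: "phase_group \<Phi> \<Longrightarrow> \<chi> \<in> \<Phi> \<Longrightarrow> \<psi> \<in> \<Phi> \<Longrightarrow> (\<lambda>x. \<chi> x * \<psi> x) \<in> \<Phi>"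
  by (simp add: phase_group_def)

lemma phase_group_finite: "phase_group \<Phi> \<Longrightarrow> finite \<Phi>"
  by (simp add: phase_group_def)

lemma phase_group_one: "phase_group \<Phi> \<Longrightarrow> (\<lambda>_. 1) \<in> \<Phi>"
  by (simp add: phase_group_def)

lemma phase_group_norm: "phase_group \<Phi> \<Longrightarrow> \<chi> \<in> \<Phi> \<Longrightarrow> cmod (\<chi> x) = 1"
  by (simp add: phase_group_def)

lemma avg_translate:
  assumes "phase_group \<Phi>" "\<psi> \<in> \<Phi>"
  shows "avg \<Phi> (\<lambda>\<chi>. F (\<lambda>x. \<chi> x * \<psi> x)) = avg \<Phi> F"
proof -
  let ?t = "\<lambda>\<chi>::int \<Rightarrow> complex. \<lambda>x. \<chi> x * \<psi> x"
  have nz: "\<psi> x \<noteq> 0" for x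
    using phase_group_norm[OF assms, of x] by auto
  have "inj_on ?t \<Phi>"
    using nz by (simp add: inj_on_def fun_eq_iff)
  moreover have "?t ` \<Phi> \<subseteq> \<Phi>" 
    by (intro image_subsetI phase_group_mult assms)
  moreover have "finite \<Phi>" by (rule phase_group_finite[OF assms(1)])
  ultimately have "bij_betw ?t \<Phi> \<Phi>"
    by (simp add: bij_betw_def endo_inj_surj)
  then have "(\<Sum>\<chi>\<in>\<Phi>. F (?t \<chi>)) = (\<Sum>\<chi>\<in>\<Phi>. F \<chi>)"
    by (rule sum.reindex_bij_betw)
  then show ?thesis
    unfolding avg_def by simp
qed

lemma avg_subgroup:
  fixes F :: "(int \<Rightarrow> complex) \<Rightarrow> 'a::field_char_0"
  assumes "phase_group \<Phi>" "phase_group \<Psi>" "\<Psi> \<subseteq> \<Phi>"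
  shows "avg \<Phi> F = avg \<Phi> (\<lambda>\<chi>. avg \<Psi> (\<lambda>\<psi>. F (\<lambda>x. \<chi> x * \<psi> x)))"
proof -
  have "avg \<Phi> (\<lambda>\<chi>. avg \<Psi> (\<lambda>\<psi>. F (\<lambda>x. \<chi> x * \<psi> x))) = avg \<Psi> (\<lambda>\<psi>. avg \<Phi> (\<lambda>\<chi>. F (\<lambda>x. \<chi> x * \<psi> x)))"
    by (rule avg_swap)
  also have "\<dots> = avg \<Psi> (\<lambda>_. avg \<Phi> F)"
    using assms by (intro avg_cong avg_translate) auto
  also have "\<dots> = avg \<Phi> F"
    by (intro avg_const phase_group_nonempty phase_group_finite assms)
  finally show ?thesis ..
qed

definition pull :: "(int \<Rightarrow> complex) set \<Rightarrow> (int \<Rightarrow> int) \<Rightarrow> (int \<Rightarrow> complex) set" where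
  "pull \<Phi> g = (\<lambda>\<chi>. \<chi> \<circ> g) ` \<Phi>"

lemma pull_pull: "pull (pull \<Phi> g) h = pull \<Phi> (g \<circ> h)"
  by (auto simp: pull_def image_image comp_assoc)

lemma phase_group_pull: "phase_group \<Phi> \<Longrightarrow> phase_group (pull \<Phi> g)"
proof -
  assume \<Phi>: "phase_group \<Phi>"
  have "(\<lambda>x. (\<chi> \<circ> g) x * (\<psi> \<circ> g) x) \<in> pull \<Phi> g" if "\<chi> \<in> \<Phi>" "\<psi> \<in> \<Phi>" for \<chi> \<psi>
    unfolding pull_def using \<Phi> that
    by (intro image_eqI[of _ _ "\<lambda>x. \<chi> x * \<psi> x"] phase_group_mult) (auto simp: o_def)
  moreover have "(\<lambda>_. 1) \<in> pull \<Phi> g"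
    unfolding pull_def using \<Phi> by (intro image_eqI[of _ _ "\<lambda>_. 1"] phase_group_one) (auto simp: o_def)
  moreover have "finite (pull \<Phi> g)" using phase_group_finite[OF \<Phi>] by (simp add: pull_def)
  moreover have "\<forall>\<chi>\<in>pull \<Phi> g. \<forall>x. cmod (\<chi> x) = 1"
    using phase_group_norm[OF \<Phi>] by (simp add: pull_def)
  ultimately show ?thesis
    by (intro phase_groupI) (auto simp: pull_def)
qed

text \<open>The map \<open>\<chi> \<mapsto> \<chi> \<circ> g\<close> need not be injective, but it
  is a homomorphism, so its fibres have equal size. Averaging over both groups at once avoids
  counting the fibres.\<close>

lemma avg_pull:
  fixes F :: "(int \<Rightarrow> complex) \<Rightarrow> 'a::field_char_0"
  assumes \<Phi>: "phase_group \<Phi>"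
  shows "avg (pull \<Phi> g) F = avg \<Phi> (\<lambda>\<chi>. F (\<chi> \<circ> g))"
proof -
  let ?P = "pull \<Phi> g"
  have P: "phase_group ?P" using \<Phi> by (rule phase_group_pull)
  have "avg ?P F = avg \<Phi> (\<lambda>\<chi>. avg ?P F)"
    using phase_group_finite[OF \<Phi>] phase_group_nonempty[OF \<Phi>] by (simp add: avg_const)
  also have "\<dots> = avg \<Phi> (\<lambda>\<chi>. avg ?P (\<lambda>\<psi>. F (\<lambda>x. \<psi> x * (\<chi> \<circ> g) x)))"
    by (rule avg_cong, rule avg_translate[symmetric, OF P]) (unfold pull_def, rule imageI)
  also have "\<dots> = avg ?P (\<lambda>\<psi>. avg \<Phi> (\<lambda>\<chi>. F (\<lambda>x. \<psi> x * (\<chi> \<circ> g) x)))"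
    by (rule avg_swap)
  also have "\<dots> = avg ?P (\<lambda>\<psi>. avg \<Phi> (\<lambda>\<chi>. F (\<chi> \<circ> g)))"
  proof (rule avg_cong)
    fix \<psi> assume "\<psi> \<in> ?P"
    then obtain \<chi>' where c: "\<chi>' \<in> \<Phi>" "\<psi> = \<chi>' \<circ> g" by (auto simp: pull_def)
    have "avg \<Phi> (\<lambda>\<chi>. F (\<lambda>x. \<psi> x * (\<chi> \<circ> g) x)) = avg \<Phi> (\<lambda>\<chi>. (\<lambda>\<xi>. F (\<xi> \<circ> g)) (\<lambda>x. \<chi> x * \<chi>' x))"
      by (simp add: c o_def mult.commute)
    also have "\<dots> = avg \<Phi> (\<lambda>\<chi>. F (\<chi> \<circ> g))"
      by (rule avg_translate[OF \<Phi> c(1)])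
    finally show "avg \<Phi> (\<lambda>\<chi>. F (\<lambda>x. \<psi> x * (\<chi> \<circ> g) x)) = avg \<Phi> (\<lambda>\<chi>. F (\<chi> \<circ> g))" .
  qed
  also have "\<dots> = avg \<Phi> (\<lambda>\<chi>. F (\<chi> \<circ> g))"
    by (intro avg_const phase_group_nonempty phase_group_finite P)
  finally show ?thesis .
qed

text \<open>A phase in this subgroup multiplies every exponential sum supported in \<open>A\<close>
  by a single unimodular constant.\<close>

definition stab :: "(int \<Rightarrow> complex) set \<Rightarrow> int set \<Rightarrow> (int \<Rightarrow> complex) set" where
  "stab \<Phi> A = {\<chi>\<in>\<Phi>. \<forall>x\<in>A. \<forall>y\<in>A. \<chi> x = \<chi> y}"

lemma phase_group_stab: "phase_group \<Phi> \<Longrightarrow> phase_group (stab \<Phi> A)"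
proof -
  assume \<Phi>: "phase_group \<Phi>"
  have "(\<lambda>x. \<chi> x * \<psi> x) \<in> stab \<Phi> A" if c: "\<chi> \<in> stab \<Phi> A" "\<psi> \<in> stab \<Phi> A" for \<chi> \<psi>
  proof -
    have "(\<lambda>x. \<chi> x * \<psi> x) \<in> \<Phi>"
      using c by (intro phase_group_mult[OF \<Phi>]) (simp_all add: stab_def)
    moreover have "\<chi> x * \<psi> x = \<chi> y * \<psi> y" if "x \<in> A" "y \<in> A" for x y
    proof -
      have "\<chi> x = \<chi> y" using c(1) that unfolding stab_def by blast
      moreover have "\<psi> x = \<psi> y" using c(2) that unfolding stab_def by blast
      ultimately show ?thesis by simp
    qed
    ultimately show ?thesis unfolding stab_def by (intro CollectI conjI ballI)
  qed
  moreover have "finite (stab \<Phi> A)"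
    using phase_group_finite[OF \<Phi>] by (simp add: stab_def)
  moreover have "(\<lambda>_. 1) \<in> stab \<Phi> A"
    using phase_group_one[OF \<Phi>] by (simp add: stab_def)
  moreover have "cmod (\<chi> x) = 1" if "\<chi> \<in> stab \<Phi> A" for \<chi> x
    using phase_group_norm[OF \<Phi>] that by (simp add: stab_def)
  ultimately show ?thesis by (intro phase_groupI)
qed

lemma stab_subset: "stab \<Phi> A \<subseteq> \<Phi>"
  unfolding stab_def by blast

lemma stab_pull: "stab (pull \<Phi> g) A = pull (stab \<Phi> (g ` A)) g"
proof -
  have "(\<forall>x\<in>A. \<forall>y\<in>A. (\<chi> \<circ> g) x = (\<chi> \<circ> g) y) \<longleftrightarrow> (\<forall>x\<in>g ` A. \<forall>y\<in>g ` A. \<chi> x = \<chi> y)"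
    for \<chi> :: "int \<Rightarrow> complex"
    by (simp only: ball_simps o_apply)
  then show ?thesis unfolding stab_def pull_def by blast
qed

text \<open>Translation by \<open>\<psi>\<close> leaves the average unchanged and also multiplies it
  by \<open>h \<psi>\<close>, which differs from 1.\<close>

lemma avg_character:
  assumes \<Phi>: "phase_group \<Phi>"
    and mult: "\<And>\<chi> \<psi>. \<chi> \<in> \<Phi> \<Longrightarrow> \<psi> \<in> \<Phi> \<Longrightarrow> h (\<lambda>x. \<chi> x * \<psi> x) = h \<chi> * h \<psi>"
    and \<psi>: "\<psi> \<in> \<Phi>" "h \<psi> \<noteq> (1::complex)"
  shows "avg \<Phi> h = 0"
proof -
  have "avg \<Phi> h = avg \<Phi> (\<lambda>\<chi>. h (\<lambda>x. \<chi> x * \<psi> x))"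
    by (rule avg_translate[symmetric, OF \<Phi> \<psi>(1)])
  also have "\<dots> = avg \<Phi> (\<lambda>\<chi>. h \<psi> * h \<chi>)"
    using mult \<psi>(1) by (intro avg_cong) simp
  also have "\<dots> = h \<psi> * avg \<Phi> h" by (rule avg_mult)
  finally show ?thesis using \<psi>(2) by simp
qed

section \<open>Polynomial phases and their reduction modulo powers of a prime\<close>

definition ee :: "int \<Rightarrow> int \<Rightarrow> complex" where
  "ee q t = cis (2 * pi * real_of_int t / real_of_int q)"

lemma ee_add: "ee q (s + t) = ee q s * ee q t"
  by (simp add: ee_def cis_mult add_divide_distrib ring_distribs)

lemma ee_0 [simp]: "ee q 0 = 1"
  by (simp add: ee_def)

lemma norm_ee [simp]: "cmod (ee q t) = 1"
  by (simp add: ee_def)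

lemma ee_eq_1_iff: "q > 0 \<Longrightarrow> ee q t = 1 \<longleftrightarrow> q dvd t"
proof
  assume q: "q > 0" and "ee q t = 1"
  then have "cos (2 * pi * real_of_int t / real_of_int q) = 1"
    by (simp add: ee_def complex_eq_iff)
  then obtain n :: int where "2 * pi * real_of_int t / real_of_int q = real_of_int n * 2 * pi"
    using cos_one_2pi_int by blast
  then have "2 * pi * real_of_int t = 2 * pi * (real_of_int n * real_of_int q)"
    using q by (simp add: field_simps)
  then have "real_of_int t = real_of_int n * real_of_int q" by simp
  then have "t = n * q" by (metis of_int_eq_iff of_int_mult)
  then show "q dvd t" by simp
next
  assume q: "q > 0" and "q dvd t"
  then obtain n where n: "t = q * n" by blast
  have "2 * pi * real_of_int t / real_of_int q = 2 * pi * real_of_int n"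
    using q by (simp add: n)
  then show "ee q t = 1" by (simp add: ee_def cis_multiple_2pi)
qed

lemma ee_scale: "r \<noteq> 0 \<Longrightarrow> ee (r * q) (r * t) = ee q t"
  by (simp add: ee_def ac_simps)

text \<open>The constant factor makes the constant polynomials belong to every such module; it is harmless
  because only differences of phases matter.\<close>

definition phases :: "(int \<Rightarrow> complex) set \<Rightarrow> int \<Rightarrow> int poly set" where
  "phases \<Phi> q = {\<phi>. \<exists>\<chi>\<in>\<Phi>. \<exists>c. \<forall>x. \<chi> x = c * ee q (poly \<phi> x)}"

lemma phases_pull:
  assumes "\<phi> \<in> phases \<Phi> q" "\<And>z. g z = poly r z"
  shows "pcompose \<phi> r \<in> phases (pull \<Phi> g) q"
proof -
  obtain \<chi> c where \<chi>: "\<chi> \<in> \<Phi>" "\<And>x. \<chi> x = c * ee q (poly \<phi> x)"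
    using assms(1) unfolding phases_def by blast
  have "\<chi> \<circ> g \<in> pull \<Phi> g" using \<chi> by (simp add: pull_def)
  moreover have "\<forall>x. (\<chi> \<circ> g) x = c * ee q (poly (pcompose \<phi> r) x)"
    by (simp add: \<chi> assms(2) poly_pcompose)
  ultimately show ?thesis unfolding phases_def by blast
qed

text \<open>A factor common to polynomial and modulus cancels inside the exponential. Every drop of
  the level \<open>p ^ M\<close> below comes from this.\<close>

lemma phases_scale: 
  assumes "smult r \<phi> \<in> phases \<Phi> (r * q)" "r \<noteq> 0"
  shows "\<phi> \<in> phases \<Phi> q"
  using assms by (simp add: phases_def ee_scale)

lemma phases_stab:
  assumes "\<phi> \<in> phases \<Phi> q" "q > 0" "\<And>x y. x \<in> A \<Longrightarrow> y \<in> A \<Longrightarrow> q dvd poly \<phi> x - poly \<phi> y"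
  shows "\<phi> \<in> phases (stab \<Phi> A) q"
proof -
  obtain \<chi> c where \<chi>: "\<chi> \<in> \<Phi>" "\<And>x. \<chi> x = c * ee q (poly \<phi> x)"
    using assms(1) unfolding phases_def by blast
  have inv: "\<chi> x = \<chi> y" if "x \<in> A" "y \<in> A" for x y
  proof -
    have "ee q (poly \<phi> x) = ee q (poly \<phi> x - poly \<phi> y) * ee q (poly \<phi> y)"
      by (simp flip: ee_add)
    also have "ee q (poly \<phi> x - poly \<phi> y) = 1"
      using assms that by (simp add: ee_eq_1_iff)
    finally show ?thesis by (simp add: \<chi>)
  qed
  have "\<chi> \<in> stab \<Phi> A" unfolding stab_def using \<chi>(1) inv by (intro CollectI conjI ballI)
  then show ?thesis using \<chi>(2) unfolding phases_def by blast
qed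

section \<open>Submodules of integer polynomials and Nakayama's lemma\<close>

definition submod :: "int \<Rightarrow> int poly set \<Rightarrow> bool" where
  "submod q T \<longleftrightarrow> (\<forall>c. [:c:] \<in> T) \<and> (\<forall>f\<in>T. \<forall>g\<in>T. f + g \<in> T) \<and>
     (\<forall>c. \<forall>f\<in>T. smult c f \<in> T) \<and> (\<forall>f. smult q f \<in> T)"

lemma submod_phases:
  assumes \<Phi>: "phase_group \<Phi>" and q: "q > 0"
  shows "submod q (phases \<Phi> q)"
proof -
  let ?T = "phases \<Phi> q"
  have const: "[:c:] \<in> ?T" for c
  proof -
    have "\<forall>x. 1 = ee q (-c) * ee q (poly [:c:] x)" by (simp flip: ee_add)
    then show ?thesis
      unfolding phases_def using phase_group_one[OF \<Phi>]
      by (intro CollectI bexI[of _ "\<lambda>_. 1"] exI[of _ "ee q (-c)"])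
  qed
  have add: "f + g \<in> ?T" if fg: "f \<in> ?T" "g \<in> ?T" for f g
  proof -
    obtain \<chi> c where \<chi>: "\<chi> \<in> \<Phi>" "\<And>x. \<chi> x = c * ee q (poly f x)"
      using fg unfolding phases_def by blast
    obtain \<psi> d where \<psi>: "\<psi> \<in> \<Phi>" "\<And>x. \<psi> x = d * ee q (poly g x)"
      using fg unfolding phases_def by blast
    have "(\<lambda>x. \<chi> x * \<psi> x) \<in> \<Phi>" using \<chi> \<psi> by (intro phase_group_mult[OF \<Phi>])
    moreover have "\<chi> x * \<psi> x = (c * d) * ee q (poly (f + g) x)" for x
      by (simp add: \<chi> \<psi> ee_add)
    ultimately show ?thesis unfolding phases_def
      by (intro CollectI bexI[of _ "\<lambda>x. \<chi> x * \<psi> x"] exI[of _ "c * d"] allI)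
  qed
  have qmul: "smult q f \<in> ?T" for f
  proof -
    have "\<forall>x. 1 = 1 * ee q (poly (smult q f) x)" using q by (simp add: ee_eq_1_iff)
    then show ?thesis
      unfolding phases_def using phase_group_one[OF \<Phi>]
      by (intro CollectI bexI[of _ "\<lambda>_. 1"] exI[of _ 1])
  qed
  have nmul: "smult (int n) f \<in> ?T" if "f \<in> ?T" for n f
  proof (induction n)
    case 0
    then show ?case using const[of 0] by simp
  next
    case (Suc n)
    have "smult (int (Suc n)) f = f + smult (int n) f" by (simp add: smult_add_left)
    then show ?case using add[OF that Suc] by simp
  qed
  have "smult c f \<in> ?T" if "f \<in> ?T" for c f
  proof -
    \<comment> \<open>Repeated addition reaches only natural multiples; an arbitrary
      \<open>c\<close> is reduced modulo \<open>q\<close>, and \<open>qmul\<close> takes the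
      rest.\<close>
    have "c = int (nat (c mod q)) + q * (c div q)" using q by simp
    then have eq: "smult c f = smult (int (nat (c mod q))) f + smult q (smult (c div q) f)"
      by (metis smult_add_left smult_smult)
    show ?thesis by (subst eq) (rule add[OF nmul[OF that] qmul])
  qed
  then show ?thesis using const add qmul unfolding submod_def by blast
qed

lemma poly_split_low:
  fixes f :: "int poly"
  obtains c h where "f = (\<Sum>i<d. smult (c i) (monom 1 i)) + monom 1 d * h"
proof -
  have "\<exists>c h. f = (\<Sum>i<d. smult (c i) (monom 1 i)) + monom 1 d * h" for d
  proof (induction d)
    case 0
    then show ?case by (intro exI[of _ undefined] exI[of _ f]) simp
  next
    case (Suc d)
    then obtain c h where f: "f = (\<Sum>i<d. smult (c i) (monom 1 i)) + monom 1 d * h" by blast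
    obtain a h' where h: "h = pCons a h'" by (cases h)
    have "monom 1 d * h = smult a (monom 1 d) + monom 1 (Suc d) * h'"
      by (simp add: h mult_pCons_right monom_Suc)
    then have "f = (\<Sum>i<Suc d. smult ((c(d := a)) i) (monom 1 i)) + monom 1 (Suc d) * h'"
      by (simp add: f add.assoc)
    then show ?case by blast
  qed
  then show ?thesis using that by blast
qed

text \<open>This is T + q Z[x] + e x^d Z[x]. Three tails occur: none (e = 0), the tail p x^(k+1)
  needed for rescaling, and the tail x^(l+1) when degrees above l are not controlled at all.\<close>

definition mod_span :: "int poly set \<Rightarrow> int \<Rightarrow> int \<Rightarrow> nat \<Rightarrow> int poly set" where
  "mod_span T q e d = {f. \<exists>g\<in>T. \<exists>r h. f = g + smult q r + smult e (monom 1 d * h)}"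

lemma mod_span_add:
  assumes "submod Q T" "f \<in> mod_span T q e d" "g \<in> mod_span T q e d"
  shows "f + g \<in> mod_span T q e d"
proof -
  obtain f1 f2 f3 where f: "f1 \<in> T" "f = f1 + smult q f2 + smult e (monom 1 d * f3)"
    using assms unfolding mod_span_def by blast
  obtain g1 g2 g3 where g: "g1 \<in> T" "g = g1 + smult q g2 + smult e (monom 1 d * g3)"
    using assms unfolding mod_span_def by blast
  have "f + g = (f1 + g1) + smult q (f2 + g2) + smult e (monom 1 d * (f3 + g3))"
    by (simp only: f g smult_add_right distrib_left add.assoc add.left_commute add.commute)
  moreover have "f1 + g1 \<in> T" using f g assms unfolding submod_def by blast
  ultimately show ?thesis by (auto simp: mod_span_def)
qed

lemma mod_span_smult:
  assumes "submod Q T" "f \<in> mod_span T q e d"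
  shows "smult c f \<in> mod_span T q e d"
proof -
  obtain f1 f2 f3 where f: "f1 \<in> T" "f = f1 + smult q f2 + smult e (monom 1 d * f3)"
    using assms unfolding mod_span_def by blast
  have "smult c f = smult c f1 + smult q (smult c f2) + smult e (monom 1 d * smult c f3)"
    by (simp add: f smult_add_right mult.commute)
  moreover have "smult c f1 \<in> T" using f assms unfolding submod_def by blast
  ultimately show ?thesis unfolding mod_span_def by blast
qed

lemma mod_span_base:
  assumes "submod Q T"
  shows "f \<in> T \<Longrightarrow> f \<in> mod_span T q e d" "smult q f \<in> mod_span T q e d"
    "smult e (monom 1 d * f) \<in> mod_span T q e d"
proof -
  have "[:0:] \<in> T" using assms unfolding submod_def by blast
  then have z: "0 \<in> T" by simp
  have "f = f + smult q 0 + smult e (monom 1 d * 0)" by simp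
  then show "f \<in> mod_span T q e d" if "f \<in> T"
    unfolding mod_span_def using that by blast
  have "smult q f = 0 + smult q f + smult e (monom 1 d * 0)" by simp
  then show "smult q f \<in> mod_span T q e d"
    unfolding mod_span_def using z by blast
  have "smult e (monom 1 d * f) = 0 + smult q 0 + smult e (monom 1 d * f)" by simp
  then show "smult e (monom 1 d * f) \<in> mod_span T q e d"
    unfolding mod_span_def using z by blast
qed

lemma mod_span_sum:
  assumes "submod Q T" "\<And>i. i \<in> I \<Longrightarrow> f i \<in> mod_span T q e d"
  shows "(\<Sum>i\<in>I. f i) \<in> mod_span T q e d"
  using assms(2)
proof (induction I rule: infinite_finite_induct)
  case (insert x F)
  then show ?case using mod_span_add[OF assms(1)] by simp
qed (use mod_span_base(2)[OF assms(1), of q 0] in auto)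

text \<open>Nakayama's lemma: iterating the hypothesis replaces the error \<open>p * r\<close> by \<open>p ^ M * r\<close>, which lies in \<open>T\<close>.\<close>

lemma mod_span_nakayama:
  assumes T: "submod (p ^ M) T" and e: "e dvd p"
    and gen: "\<And>j. j < d \<Longrightarrow> monom 1 j \<in> mod_span T p e d"
    and j: "j < d"
  shows "\<exists>h. monom 1 j - smult e (monom 1 d * h) \<in> T"
proof -
  have lift: "smult (p ^ t) f \<in> mod_span T (p ^ Suc t) e d" if f0: "f \<in> mod_span T p e d" for f t
  proof -
    obtain f1 f2 f3 where f: "f1 \<in> T" "f = f1 + smult p f2 + smult e (monom 1 d * f3)"
      using f0 unfolding mod_span_def by blast
    have "smult (p ^ t) f = smult (p ^ t) f1 + smult (p ^ Suc t) f2
        + smult e (monom 1 d * smult (p ^ t) f3)"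
      by (simp add: f smult_add_right mult.commute)
    moreover have "smult (p ^ t) f1 \<in> T" using f T unfolding submod_def by blast
    ultimately show ?thesis unfolding mod_span_def by blast
  qed
  \<comment> \<open>The part of \<open>r\<close> below degree \<open>d\<close> can be expanded again
    and gains one more factor \<open>p\<close>; the part from degree \<open>d\<close> on joins the
    tail because \<open>e\<close> divides \<open>p\<close>.\<close>
  have low: "smult (p ^ Suc t) r \<in> mod_span T (p ^ Suc (Suc t)) e d" for r t
  proof -
    obtain c h where r: "r = (\<Sum>i<d. smult (c i) (monom 1 i)) + monom 1 d * h"
      by (rule poly_split_low)
    have 1: "(\<Sum>i<d. smult (c i) (monom 1 i)) \<in> mod_span T p e d"
      by (intro mod_span_sum[OF T] mod_span_smult[OF T] gen) auto
    obtain e' where e': "p = e * e'" using e by blast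
    have "smult (p ^ Suc t) (monom 1 d * h) = smult e (monom 1 d * smult (e' * p ^ t) h)"
      by (simp add: e' ac_simps)
    then have 2: "smult (p ^ Suc t) (monom 1 d * h) \<in> mod_span T (p ^ Suc (Suc t)) e d"
      using mod_span_base(3)[OF T] by metis
    show ?thesis
      unfolding r smult_add_right using mod_span_add[OF T lift[OF 1] 2] by simp
  qed
  have step: "monom 1 j \<in> mod_span T (p ^ Suc t) e d" for t
  proof (induction t)
    case 0
    then show ?case using gen[OF j] by simp
  next
    case (Suc t)
    then obtain g r h where g: "g \<in> T" "monom 1 j = g + smult (p ^ Suc t) r + smult e (monom 1 d * h)"
      unfolding mod_span_def by blast
    then show ?case
      using low[of t r] mod_span_add[OF T] mod_span_base(1,3)[OF T] by metis
  qed
  from step[of M] obtain g r h where g: "g \<in> T"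
    "monom 1 j = g + smult (p ^ Suc M) r + smult e (monom 1 d * h)"
    unfolding mod_span_def by blast
  have "smult (p ^ Suc M) r = smult (p ^ M) (smult p r)" by (simp add: mult.commute)
  then have "smult (p ^ Suc M) r \<in> T" using T by (metis submod_def)
  then have "g + smult (p ^ Suc M) r \<in> T" using g T by (metis submod_def)
  then show ?thesis using g(2) by (intro exI[of _ h]) simp
qed

text \<open>Allowing the error \<open>p * g\<close> makes this class of curves stable under affine rescaling to a residue class
  and under the passage to lower degree; the moment curve alone is not.\<close>

definition nondegenerate :: "int \<Rightarrow> nat \<Rightarrow> nat \<Rightarrow> (int \<Rightarrow> complex) set \<Rightarrow> bool" where
  "nondegenerate p k M \<Phi> \<longleftrightarrow> phase_group \<Phi> \<and> (\<forall>j\<in>{1..k}. \<exists>g. monom 1 j + smult p g \<in> phases \<Phi> (p ^ M))"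

lemma submodD:
  assumes "submod q T"
  shows "[:c:] \<in> T" "f \<in> T \<Longrightarrow> g \<in> T \<Longrightarrow> f + g \<in> T" "f \<in> T \<Longrightarrow> smult c f \<in> T" "smult q f \<in> T"
  using assms unfolding submod_def by blast+

lemma nondegenerate_mod_span:
  assumes "nondegenerate p k M \<Phi>" "p > 0" "j \<le> k"
  shows "monom 1 j \<in> mod_span (phases \<Phi> (p ^ M)) p e d"
proof -
  let ?T = "phases \<Phi> (p ^ M)"
  have T: "submod (p ^ M) ?T"
    using assms by (intro submod_phases) (simp_all add: nondegenerate_def)
  show ?thesis
  proof (cases "j = 0")
    case True
    have "monom 1 j \<in> ?T"
      using submodD(1)[OF T, of 1] True by (simp add: monom_0)
    then show ?thesis by (rule mod_span_base(1)[OF T])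
  next
    case False
    then have "j \<in> {1..k}" using assms by simp
    then obtain g where g: "monom 1 j + smult p g \<in> ?T"
      using assms(1) unfolding nondegenerate_def by blast
    have "monom 1 j = (monom 1 j + smult p g) + smult p (- g)" by simp
    then show ?thesis
      using mod_span_add[OF T mod_span_base(1)[OF T g] mod_span_base(2)[OF T, of p "-g"]] by metis
  qed
qed

lemma mod_span_low_degree:
  assumes T: "submod Q T" and "\<And>j. j \<le> k \<Longrightarrow> monom 1 j \<in> mod_span T q e d" and "degree f \<le> k"
  shows "f \<in> mod_span T q e d"
proof -
  have "f = (\<Sum>i\<le>degree f. smult (coeff f i) (monom 1 i))"
    by (simp add: poly_as_sum_of_monoms smult_monom)
  also have "\<dots> \<in> mod_span T q e d"
    using assms by (intro mod_span_sum[OF T] mod_span_smult[OF T]) auto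
  finally show ?thesis .
qed

lemma mod_span_pull:
  assumes "f \<in> mod_span (phases \<Phi> Q) q e0 d0" "\<And>z. g z = poly r z" "e0 = 0" "phase_group \<Phi>" "Q > 0"
  shows "pcompose f r \<in> mod_span (phases (pull \<Phi> g) Q) q e d"
proof -
  obtain f1 f2 f3 where f: "f1 \<in> phases \<Phi> Q" "f = f1 + smult q f2 + smult e0 (monom 1 d0 * f3)"
    using assms(1) unfolding mod_span_def by blast
  have T: "submod Q (phases (pull \<Phi> g) Q)"
    using assms by (intro submod_phases phase_group_pull)
  have "pcompose f r = pcompose f1 r + smult q (pcompose f2 r)"
    by (simp add: f assms(3) pcompose_add pcompose_smult)
  then show ?thesis
    using mod_span_add[OF T mod_span_base(1)[OF T phases_pull[OF f(1) assms(2)]] mod_span_base(2)[OF T, of q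
        "pcompose f2 r"]]
    by simp
qed

section \<open>Affine substitutions\<close>

lemma pcompose_power: "pcompose (f ^ n) r = pcompose f r ^ n" for f :: "'a::comm_semiring_1 poly"
  by (induction n) (simp_all add: pcompose_1 pcompose_mult)

text \<open>The polynomial (x - u)^j has degree at most k, so modulo p it is among the phases; the
  substitution x = u + z turns it into z^j.\<close>

lemma nondegenerate_translate:
  assumes nondegenerate: "nondegenerate p k M \<Phi>" and p: "p > 0"
  shows "nondegenerate p k M (pull \<Phi> (\<lambda>z. u + z))"
proof -
  let ?T = "phases \<Phi> (p ^ M)"
  have \<Phi>: "phase_group \<Phi>" using nondegenerate by (simp add: nondegenerate_def)
  have T: "submod (p ^ M) ?T"
    using p by (intro submod_phases[OF \<Phi>]) simp
  have "\<exists>g. monom 1 j + smult p g \<in> phases (pull \<Phi> (\<lambda>z. u + z)) (p ^ M)" if j: "j \<in> {1..k}" for j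
  proof -
    let ?f = "[:-u, 1:] ^ j"
    have "degree ?f \<le> k" using degree_power_le[of "[:-u, 1:]" j] j by simp
    then have "?f \<in> mod_span ?T p 0 0"
      by (intro mod_span_low_degree[OF T nondegenerate_mod_span[OF nondegenerate p]])
    then obtain g r where g: "g \<in> ?T" "?f = g + smult p r"
      unfolding mod_span_def by auto
    have "pcompose g [:u, 1:] \<in> phases (pull \<Phi> (\<lambda>z. u + z)) (p ^ M)"
      by (rule phases_pull[OF g(1)]) simp
    moreover have "g = ?f - smult p r" using g(2) by simp
    then have "pcompose g [:u, 1:] = pcompose ?f [:u, 1:] - smult p (pcompose r [:u, 1:])"
      by (simp add: pcompose_diff pcompose_smult)
    moreover have "pcompose ?f [:u, 1:] = monom 1 j"
      by (simp add: pcompose_power pcompose_pCons monom_altdef)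
    ultimately have "monom 1 j + smult p (- pcompose r [:u, 1:]) \<in> phases (pull \<Phi> (\<lambda>z. u + z)) (p ^ M)"
      by simp
    then show ?thesis by blast
  qed
  then show ?thesis unfolding nondegenerate_def using phase_group_pull[OF \<Phi>] by blast
qed

lemma pcompose_monom_scale: "pcompose (monom 1 j) [:0, c:] = smult (c ^ j) (monom 1 j)"
  for c :: "'a::comm_semiring_1"
proof -
  have "pcompose (monom 1 j) [:0, c:] = [:0, c:] ^ j"
    by (simp add: monom_altdef pcompose_power pcompose_pCons)
  also have "[:0, c:] = smult c [:0, 1:]" by simp
  also have "\<dots> ^ j = smult (c ^ j) ([:0, 1:] ^ j)" by (rule smult_power)
  finally show ?thesis by (simp add: monom_altdef)
qed

lemma pderiv_setsum: "pderiv (\<Sum>i\<in>A. f i) = (\<Sum>i\<in>A. pderiv (f i))"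
  by (induction A rule: infinite_finite_induct) (simp_all add: pderiv_add)

text \<open>Under x = p^a z the degree j phase shrinks by p^(aj), and an error p g with terms of
  degree below j could overwhelm it. Nakayama's lemma first moves the whole error to degrees above
  k, where it shrinks more than the main term.\<close>

lemma nondegenerate_scale:
  assumes nondegenerate: "nondegenerate p k M \<Phi>" and p: "p > 0" and kM: "k * a \<le> M"
  shows "nondegenerate p k (M - k * a) (pull \<Phi> (\<lambda>z. p ^ a * z))"
proof -
  let ?T = "phases \<Phi> (p ^ M)" and ?P = "pull \<Phi> (\<lambda>z. p ^ a * z)"
  have \<Phi>: "phase_group \<Phi>" using nondegenerate by (simp add: nondegenerate_def)
  have T: "submod (p ^ M) ?T" using p by (intro submod_phases[OF \<Phi>]) simp
  have T': "submod (p ^ M) (phases ?P (p ^ M))"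
    using p by (intro submod_phases phase_group_pull[OF \<Phi>]) simp
  have "\<exists>g. monom 1 j + smult p g \<in> phases ?P (p ^ (M - k * a))" if j: "j \<in> {1..k}" for j
  proof -
    have "\<exists>h. monom 1 j - smult p (monom 1 (Suc k) * h) \<in> ?T"
      using j by (intro mod_span_nakayama[OF T] nondegenerate_mod_span[OF nondegenerate p]) auto
    then obtain h where h: "monom 1 j - smult p (monom 1 (Suc k) * h) \<in> ?T" by blast
    let ?r = "[:0, p ^ a:]"
    define H where "H = monom 1 (Suc k) * pcompose h ?r"
    have "pcompose (monom 1 j - smult p (monom 1 (Suc k) * h)) ?r \<in> phases ?P (p ^ M)"
      by (rule phases_pull[OF h]) simp
    also have "pcompose (monom 1 j - smult p (monom 1 (Suc k) * h)) ?r
        = smult (p ^ (a * j)) (monom 1 j) - smult p (smult (p ^ (a * Suc k)) H)"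
      by (simp add: pcompose_diff pcompose_smult pcompose_mult pcompose_monom_scale H_def power_mult[symmetric]
          del: mult_Suc_right power_Suc)
    \<comment> \<open>The extra factor brings all degrees j to the common scale p^(ka), so that one
      modulus serves all of them.\<close>
    finally have "smult (p ^ (a * (k - j))) (smult (p ^ (a * j)) (monom 1 j) - smult p (smult (p ^ (a * Suc k)) H))
        \<in> phases ?P (p ^ M)"
      by (rule submodD(3)[OF T'])
    also have "smult (p ^ (a * (k - j))) (smult (p ^ (a * j)) (monom 1 j) - smult p (smult (p ^ (a * Suc k)) H))
        = smult (p ^ (k * a)) (monom 1 j + smult p (smult (- (p ^ (a * (Suc k - j)))) H))"
    proof -
      have 1: "a * (k - j) + a * j = k * a" "a * (k - j) + a * Suc k = k * a + a * (Suc k - j)"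
        using j by (simp_all flip: distrib_left) (simp_all add: algebra_simps Suc_diff_le diff_mult_distrib2)
      have "p ^ (a * (k - j)) * p ^ (a * j) = p ^ (k * a)"
        unfolding power_add[symmetric] 1 ..
      moreover have "p ^ (a * (k - j)) * p ^ (a * Suc k) = p ^ (k * a) * p ^ (a * (Suc k - j))"
        unfolding power_add[symmetric] 1 ..
      ultimately show ?thesis
        by (simp add: smult_diff_right smult_add_right mult.left_commute[of _ p] del: mult_Suc_right power_Suc)
    qed
    also have "p ^ M = p ^ (k * a) * p ^ (M - k * a)"
      using kM by (simp flip: power_add)
    finally have "monom 1 j + smult p (smult (- (p ^ (a * (Suc k - j)))) H) \<in> phases ?P (p ^ (M - k * a))"
      by (rule phases_scale) (use p in simp)
    then show ?thesis by blast
  qed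
  then show ?thesis unfolding nondegenerate_def using phase_group_pull[OF \<Phi>] by blast
qed

lemma nondegenerate_rescale:
  assumes nondegenerate: "nondegenerate p k M \<Phi>" and p: "p > 0" and kM: "k * a \<le> M"
  shows "nondegenerate p k (M - k * a) (pull \<Phi> (\<lambda>z. u + p ^ a * z))"
proof -
  have "pull \<Phi> (\<lambda>z. u + p ^ a * z) = pull (pull \<Phi> (\<lambda>z. u + z)) (\<lambda>z. p ^ a * z)"
    by (simp add: pull_pull o_def)
  then show ?thesis using nondegenerate_scale[OF nondegenerate_translate[OF nondegenerate p] p kM] by simp
qed

section \<open>Passage to lower degree on a distinct residue class\<close>

lemma antideriv:
  fixes q :: "int poly"
  assumes "degree q \<le> n" "m + n < k"
  obtains c where "pderiv (\<Sum>t\<le>n. smult (c t) (monom 1 (m + 1 + t))) = smult (fact k) (monom 1 m * q)"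
proof -
  define c where "c t = (fact k div int (m + 1 + t)) * coeff q t" for t
  have c: "int (m + 1 + t) * c t = fact k * coeff q t" if "t \<le> n" for t
  proof -
    \<comment> \<open>The denominators of the antiderivative are at most k, so k! clears them
      all.\<close>
    have "m + 1 + t dvd fact k" using assms that by (intro dvd_fact) auto
    then have "int (m + 1 + t) dvd int (fact k)" by (simp only: int_dvd_int_iff)
    then have "int (m + 1 + t) dvd fact k" by (simp only: of_nat_fact)
    then have "int (m + 1 + t) * (fact k div int (m + 1 + t)) = fact k" by (rule dvd_mult_div_cancel)
    then show ?thesis unfolding c_def by (simp only: mult.assoc[symmetric])
  qed
  have "pderiv (\<Sum>t\<le>n. smult (c t) (monom 1 (m + 1 + t)))
      = (\<Sum>t\<le>n. pderiv (smult (c t) (monom 1 (m + 1 + t))))"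
    by (rule pderiv_setsum)
  also have "\<dots> = (\<Sum>t\<le>n. smult (fact k) (monom 1 m * monom (coeff q t) t))"
  proof (rule sum.cong[OF refl])
    fix t assume "t \<in> {..n}"
    then show "pderiv (smult (c t) (monom 1 (m + 1 + t))) = smult (fact k) (monom 1 m * monom (coeff q t) t)"
      using c[of t] by (simp add: pderiv_smult pderiv_monom smult_monom mult_monom mult.commute)
  qed
  also have "\<dots> = smult (fact k) (monom 1 m * (\<Sum>t\<le>n. monom (coeff q t) t))"
    unfolding sum_distrib_left by (induction n) (simp_all add: smult_add_right)
  also have "(\<Sum>t\<le>n. monom (coeff q t) t) = q"
    using assms by (intro poly_as_sum_of_monoms')
  finally show ?thesis by (rule that)
qed

text \<open>In the coordinate \<open>w = y - u\<close>, the antiderivative of \<open>y ^ m * w ^ (i - 1)\<close> lies in the span of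
  \<open>y ^ (m + 1), \<dots>, y ^ (m + i)\<close> (after multiplication by \<open>k!\<close>) and equals a constant plus a \<open>p\<close>-adic unit
  times \<open>w ^ i\<close> plus higher powers of \<open>w\<close>.  The system is therefore triangular.\<close>

lemma lower_degree_mod_span:
  fixes p u :: int
  assumes p: "prime p" "int k < p" and u: "\<not> p dvd u" and ml: "m + l = k" and M: "phase_group \<Phi>"
    and gen: "\<And>j. j \<in> {Suc m..k} \<Longrightarrow> monom 1 j \<in> mod_span (phases \<Phi> (p ^ M)) p 0 0"
    and i: "1 \<le> i" "i \<le> l"
  shows "monom 1 i \<in> mod_span (phases (pull \<Phi> (\<lambda>z. u + z)) (p ^ M)) p 1 (Suc l)"
  using i
proof (induction "l - i" arbitrary: i rule: less_induct)
  case (less i)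
  have p0: "p > 0" using p(1) by (simp add: prime_gt_0_int)
  let ?T = "phases \<Phi> (p ^ M)" and ?T' = "phases (pull \<Phi> (\<lambda>z. u + z)) (p ^ M)"
  have T: "submod (p ^ M) ?T" using p0 by (intro submod_phases[OF M]) simp
  have T': "submod (p ^ M) ?T'" using p0 by (intro submod_phases phase_group_pull[OF M]) simp
  obtain n where n: "i = Suc n" using less.prems by (cases i) auto
  \<comment> \<open>The induction runs downwards in \<open>i\<close>: powers from i + 1 to l are
    already available, and those above l belong to the tail.\<close>
  have high: "monom 1 (Suc i) * K \<in> mod_span ?T' p 1 (Suc l)" for K
  proof -
    obtain c h where K: "K = (\<Sum>t<l - i. smult (c t) (monom 1 t)) + monom 1 (l - i) * h"
      by (rule poly_split_low)
    have "monom 1 (Suc i) * (\<Sum>t<l - i. smult (c t) (monom 1 t)) = (\<Sum>t<l - i. smult (c t) (monom 1 (Suc i + t)))"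
      by (simp add: sum_distrib_left mult_monom)
    moreover have "monom 1 (Suc i) * (monom 1 (l - i) * h) = smult 1 (monom 1 (Suc l) * h)"
      using less.prems by (simp add: mult_monom mult.assoc[symmetric])
    ultimately have eq: "monom 1 (Suc i) * K = (\<Sum>t<l - i. smult (c t) (monom 1 (Suc i + t))) + smult 1 (monom 1
        (Suc l) * h)"
      unfolding K distrib_left by (rule arg_cong2)
    have "monom 1 (Suc i + t) \<in> mod_span ?T' p 1 (Suc l)" if "t < l - i" for t
      using less.prems that by (intro less.hyps) auto
    then have "(\<Sum>t<l - i. smult (c t) (monom 1 (Suc i + t))) \<in> mod_span ?T' p 1 (Suc l)"
      by (intro mod_span_sum[OF T'] mod_span_smult[OF T']) simp
    then show ?thesis unfolding eq by (rule mod_span_add[OF T' _ mod_span_base(3)[OF T']])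
  qed
  have "degree ([:-u, 1:] ^ n) \<le> n" using degree_power_le[of "[:-u, 1:]" n] by simp
  then obtain c where c: "pderiv (\<Sum>t\<le>n. smult (c t) (monom 1 (m + 1 + t))) = smult (fact k) (monom 1 m * [:-u,
      1:] ^ n)"
    by (rule antideriv[of _ n m k]) (use less.prems n ml in auto)
  define F where "F = (\<Sum>t\<le>n. smult (c t) (monom 1 (m + 1 + t)))"
  define G where "G = pcompose F [:u, 1:]"
  have "F \<in> mod_span ?T p 0 0"
    unfolding F_def using less.prems n ml by (intro mod_span_sum[OF T] mod_span_smult[OF T] gen) auto
  then have G: "G \<in> mod_span ?T' p 1 (Suc l)"
    unfolding G_def using M p0 by (intro mod_span_pull[where ?e0.0 = 0 and ?d0.0 = 0]) auto
  have dG: "pderiv G = smult (fact k) (monom 1 n * [:u, 1:] ^ m)"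
    unfolding G_def pderiv_pcompose F_def c
    by (simp add: pcompose_smult pcompose_mult pcompose_power monom_altdef pcompose_pCons pderiv_pCons mult.commute)
  \<comment> \<open>Comparison of coefficients in the derivative: G has no terms of degrees 1 to n,
    and i = n + 1 times its coefficient of degree i is k! u^m.\<close>
  have coeffG: "int (Suc t) * coeff G (Suc t) = (if t < n then 0 else fact k * coeff ([:u, 1:] ^ m) (t - n))" for t
    using arg_cong[OF dG, of "\<lambda>f. coeff f t"] by (simp add: coeff_pderiv coeff_monom_mult)
  define R where "R = G - [:coeff G 0:]"
  have "coeff R t = 0" if "t < i" for t
  proof (cases t)
    case (Suc t')
    then have "int (Suc t') * coeff G (Suc t') = 0" using coeffG[of t'] that n by simp
    then show ?thesis using Suc by (simp add: R_def)
  qed (simp add: R_def)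
  then have "monom 1 i dvd R" by (simp add: monom_1_dvd_iff')
  then obtain K where K: "R = monom 1 i * K" by blast
  obtain w K' where K': "K = pCons w K'" by (cases K)
  have "coeff R i = coeff K 0" by (simp add: K coeff_monom_mult)
  then have "coeff R i = w" by (simp add: K')
  then have w: "w = coeff G i" using n by (simp add: R_def)
  have "int i * w = fact k * u ^ m"
    using coeffG[of n] by (simp add: w n coeff_0_power)
  \<comment> \<open>Since p > k and p does not divide u, the number k! u^m is prime to p; hence so
    is its divisor w, which can be inverted modulo p.\<close>
  have "coprime (fact k) p"
  proof -
    have "\<not> nat p dvd fact k"
      using p by (subst prime_dvd_fact_iff) (auto simp: nat_le_iff)
    then have "\<not> p dvd fact k"
      using p0 by (metis int_dvd_int_iff int_nat_eq less_imp_le of_nat_fact)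
    then show ?thesis using p(1) by (metis coprime_commute prime_imp_coprime)
  qed
  moreover have "coprime (u ^ m) p"
    using p(1) u by (metis coprime_commute coprime_power_left_iff prime_imp_coprime)
  ultimately have "coprime (int i * w) p"
    unfolding \<open>int i * w = fact k * u ^ m\<close> by simp
  then have "coprime w p" by simp
  then obtain v where "[w * v = 1] (mod p)" using cong_solve_coprime_int by blast
  then obtain s where s: "v * w = 1 + p * s"
    by (metis cong_iff_lin mult.commute cong_sym)
  have "monom 1 i * K = smult w (monom 1 i) + monom 1 (Suc i) * K'"
    by (simp add: K' mult_pCons_right monom_Suc)
  then have "smult w (monom 1 i) = R + smult (-1) (monom 1 (Suc i) * K')"
    using K by simp
  also have "R = G + [:- coeff G 0:]" by (simp add: R_def)
  finally have "smult w (monom 1 i) = (G + [:- coeff G 0:]) + smult (-1) (monom 1 (Suc i) * K')" .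
  moreover have "(G + [:- coeff G 0:]) + smult (-1) (monom 1 (Suc i) * K') \<in> mod_span ?T' p 1 (Suc l)"
    by (intro mod_span_add[OF T'] G mod_span_base(1)[OF T'] submodD(1)[OF T'] mod_span_smult[OF T'] high)
  ultimately have "smult v (smult w (monom 1 i)) \<in> mod_span ?T' p 1 (Suc l)"
    by (metis mod_span_smult[OF T'])
  then have "smult v (smult w (monom 1 i)) + smult p (smult (-s) (monom 1 i)) \<in> mod_span ?T' p 1 (Suc l)"
    by (rule mod_span_add[OF T' _ mod_span_base(2)[OF T']])
  moreover have "smult v (smult w (monom 1 i)) + smult p (smult (-s) (monom 1 i)) = smult (v * w - p * s) (monom 1 i)"
    by (simp add: smult_diff_left)
  ultimately show ?case using s by simp
qed

text \<open>If \<open>y\<close> runs through the multiples of \<open>p ^ b\<close>, then \<open>y ^ j\<close> with \<open>j > m\<close> vanishes modulo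
  \<open>p ^ ((m + 1) * b)\<close>.  The phases of degrees \<open>m + 1, \<dots>, k\<close> at this level are thus constant there, and on a
  residue class of units they form a curve of degree \<open>l = k - m\<close>.\<close>

lemma nondegenerate_lower0:
  fixes p u :: int
  assumes nondegenerate: "nondegenerate p k M \<Phi>" and p: "prime p" "int k < p" and u: "\<not> p dvd u" and ml: "m + l = k"
    and a: "1 \<le> a" and la: "l * a \<le> Suc m * b" and bM: "Suc m * b \<le> M"
  shows "nondegenerate p l (Suc m * b - l * a) (pull (stab \<Phi> {x. p ^ b dvd x}) (\<lambda>z. u + p ^ a * z))"
proof -
  define N where "N = Suc m * b"
  let ?\<Psi> = "stab \<Phi> {x. p ^ b dvd x}"
  let ?P1 = "pull ?\<Psi> (\<lambda>z. u + z)" and ?P2 = "pull ?\<Psi> (\<lambda>z. u + p ^ a * z)"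
  have p0: "p > 0" using p(1) by (simp add: prime_gt_0_int)
  have \<Phi>: "phase_group \<Phi>" using nondegenerate by (simp add: nondegenerate_def)
  note \<Psi> = phase_group_stab[OF \<Phi>, of "{x. p ^ b dvd x}"]
  note P1 = phase_group_pull[OF \<Psi>, of "\<lambda>z. u + z"]
  note P2 = phase_group_pull[OF \<Psi>, of "\<lambda>z. u + p ^ a * z"]
  have T: "submod (p ^ M) (phases \<Phi> (p ^ M))" using p0 by (intro submod_phases[OF \<Phi>]) simp
  have T\<Psi>: "submod (p ^ N) (phases ?\<Psi> (p ^ N))" using p0 by (intro submod_phases[OF \<Psi>]) simp
  have T1: "submod (p ^ N) (phases ?P1 (p ^ N))" using p0 by (intro submod_phases[OF P1]) simp
  have T2: "submod (p ^ N) (phases ?P2 (p ^ N))" using p0 by (intro submod_phases[OF P2]) simp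
  have P12: "?P2 = pull ?P1 (\<lambda>z. p ^ a * z)" by (simp add: pull_pull o_def)
  have NM: "N \<le> M" using bM by (simp add: N_def)
  have gen: "monom 1 j \<in> mod_span (phases ?\<Psi> (p ^ N)) p 0 0" if j: "j \<in> {Suc m..k}" for j
  proof -
    have "\<exists>h. monom 1 j - smult p (monom 1 (Suc k) * h) \<in> phases \<Phi> (p ^ M)"
      using j by (intro mod_span_nakayama[OF T] nondegenerate_mod_span[OF nondegenerate p0]) auto
    then obtain h where h: "monom 1 j - smult p (monom 1 (Suc k) * h) \<in> phases \<Phi> (p ^ M)" by blast
    define f where "f = monom 1 j - smult p (monom 1 (Suc k) * h)"
    \<comment> \<open>The phase f at level p^N is p^(M-N) f at level p^M. All powers in f exceed m,
      so on multiples of p^b they are divisible by p^N; the multiple is thus constant there modulo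
      p^M and its phase lies in the stabiliser.\<close>
    have "smult (p ^ (M - N)) f \<in> phases \<Phi> (p ^ M)"
      unfolding f_def by (rule submodD(3)[OF T h])
    then have "smult (p ^ (M - N)) f \<in> phases ?\<Psi> (p ^ M)"
    proof (rule phases_stab)
      fix x y assume xy: "x \<in> {x. p ^ b dvd x}" "y \<in> {x. p ^ b dvd x}"
      have dvd: "p ^ M dvd poly (smult (p ^ (M - N)) f) x" if "p ^ b dvd x" for x
      proof -
        have b: "p ^ N dvd x ^ j'" if j': "Suc m \<le> j'" for j'
        proof -
          have "p ^ N = (p ^ b) ^ Suc m" by (simp only: N_def power_mult[symmetric] mult.commute)
          also have "\<dots> dvd x ^ Suc m" using \<open>p ^ b dvd x\<close> by (rule dvd_power_same)
          also have "\<dots> dvd x ^ j'" using j' by (rule le_imp_power_dvd)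
          finally show ?thesis .
        qed
        have "poly f x = x ^ j - p * (x ^ Suc k * poly h x)"
          by (simp add: f_def poly_monom)
        moreover have "p ^ N dvd x ^ j" "p ^ N dvd x ^ Suc k"
          using j by (intro b; simp)+
        ultimately have "p ^ N dvd poly f x" by simp
        then have "p ^ (M - N) * p ^ N dvd p ^ (M - N) * poly f x" by (rule mult_dvd_mono[OF dvd_refl])
        then show ?thesis using NM by (simp flip: power_add)
      qed
      show "p ^ M dvd poly (smult (p ^ (M - N)) f) x - poly (smult (p ^ (M - N)) f) y"
        using xy by (intro dvd_diff dvd) auto
    qed (use p0 in simp)
    also have "p ^ M = p ^ (M - N) * p ^ N" using NM by (simp flip: power_add)
    finally have "f \<in> phases ?\<Psi> (p ^ N)"
      by (rule phases_scale) (use p0 in simp)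
    then have "f + smult p (monom 1 (Suc k) * h) \<in> mod_span (phases ?\<Psi> (p ^ N)) p 0 0"
      by (intro mod_span_add[OF T\<Psi>] mod_span_base[OF T\<Psi>])
    then show ?thesis by (simp add: f_def)
  qed
  have low: "monom 1 i \<in> mod_span (phases ?P1 (p ^ N)) p 1 (Suc l)" if "i < Suc l" for i
  proof (cases "i = 0")
    case True
    have "monom 1 i \<in> phases ?P1 (p ^ N)"
      using submodD(1)[OF T1, of 1] True by (simp add: monom_0)
    then show ?thesis by (rule mod_span_base(1)[OF T1])
  next
    case False
    then show ?thesis using that by (intro lower_degree_mod_span[OF p u ml \<Psi> gen]) auto
  qed
  have "\<exists>g. monom 1 i + smult p g \<in> phases ?P2 (p ^ (N - l * a))" if i: "i \<in> {1..l}" for i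
  proof -
    \<comment> \<open>The tail carries no factor p here (e = 1). The substitution z -> p^a z
      supplies it: relative to degree i <= l the tail shrinks by p^(a(l+1-i)), which is divisible by
      p because a >= 1.\<close>
    have "\<exists>h. monom 1 i - smult 1 (monom 1 (Suc l) * h) \<in> phases ?P1 (p ^ N)"
      using i by (intro mod_span_nakayama[OF T1] low) auto
    then obtain h where h: "monom 1 i - monom 1 (Suc l) * h \<in> phases ?P1 (p ^ N)" by auto
    let ?r = "[:0, p ^ a:]"
    define H where "H = monom 1 (Suc l) * pcompose h ?r"
    have "pcompose (monom 1 i - monom 1 (Suc l) * h) ?r \<in> phases ?P2 (p ^ N)"
      unfolding P12 by (rule phases_pull[OF h]) simp
    also have "pcompose (monom 1 i - monom 1 (Suc l) * h) ?r
        = smult (p ^ (a * i)) (monom 1 i) - smult (p ^ (a * Suc l)) H"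
      by (simp add: pcompose_diff pcompose_mult pcompose_monom_scale H_def power_mult[symmetric]
          del: mult_Suc_right power_Suc)
    finally have "smult (p ^ (a * (l - i))) (smult (p ^ (a * i)) (monom 1 i) - smult (p ^ (a * Suc l)) H)
        \<in> phases ?P2 (p ^ N)"
      by (rule submodD(3)[OF T2])
    also have "smult (p ^ (a * (l - i))) (smult (p ^ (a * i)) (monom 1 i) - smult (p ^ (a * Suc l)) H)
        = smult (p ^ (l * a)) (monom 1 i + smult p (smult (- (p ^ (a * (Suc l - i) - 1))) H))"
    proof -
      have 1: "a * (l - i) + a * i = l * a" 
        using i by (simp flip: distrib_left)
      have 2: "a * (l - i) + a * Suc l = l * a + Suc (a * (Suc l - i) - 1)"
      proof -
        have "0 < a * (Suc l - i)" using i a by simp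
        then have "Suc (a * (Suc l - i) - 1) = a * (Suc l - i)" by simp
        moreover have "a * (l - i) = a * l - a * i" "a * (Suc l - i) = a * l + a - a * i"
          by (simp_all add: diff_mult_distrib2)
        moreover have "a * i \<le> a * l" using i by simp
        ultimately show ?thesis by (simp add: mult.commute[of l])
      qed
      have "p ^ (a * (l - i)) * p ^ (a * i) = p ^ (l * a)"
        unfolding power_add[symmetric] 1 ..
      moreover have "p ^ (a * (l - i)) * p ^ (a * Suc l) = p ^ (l * a) * (p * p ^ (a * (Suc l - i) - 1))"
        unfolding power_add[symmetric] 2 by (simp only: power_add power_Suc)
      ultimately show ?thesis
        by (simp add: smult_diff_right smult_add_right mult.assoc del: mult_Suc_right power_Suc)
    qed
    also have "p ^ N = p ^ (l * a) * p ^ (N - l * a)"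
      using la by (simp add: N_def flip: power_add)
    finally have "monom 1 i + smult p (smult (- (p ^ (a * (Suc l - i) - 1))) H) \<in> phases ?P2 (p ^ (N - l * a))"
      by (rule phases_scale) (use p0 in simp)
    then show ?thesis by blast
  qed
  then show ?thesis unfolding nondegenerate_def N_def[symmetric] using P2 by blast
qed

text \<open>Recentring at \<open>\<eta>\<close> turns its class into the multiples of p^b, while
  \<open>\<xi> - \<eta>\<close> is prime to p.\<close>

lemma nondegenerate_lower:
  fixes p \<xi> \<eta> :: int
  assumes nondegenerate: "nondegenerate p k M \<Phi>" and p: "prime p" "int k < p" and "\<not> [\<xi> = \<eta>] (mod p)" and ml: "m
      + l = k"
    and a: "1 \<le> a" and la: "l * a \<le> Suc m * b" and bM: "Suc m * b \<le> M"
  shows "nondegenerate p l (Suc m * b - l * a) (pull (stab \<Phi> {x. [x = \<eta>] (mod p ^ b)}) (\<lambda>z. \<xi> + p ^ a * z))"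
proof -
  have p0: "p > 0" using p(1) by (simp add: prime_gt_0_int)
  have u: "\<not> p dvd (\<xi> - \<eta>)" using assms(4) by (simp add: cong_iff_dvd_diff)
  have "nondegenerate p l (Suc m * b - l * a) (pull (stab (pull \<Phi> (\<lambda>z. \<eta> + z)) {x. p ^ b dvd x}) (\<lambda>z. (\<xi> - \<eta>) +
      p ^ a * z))"
    by (rule nondegenerate_lower0[OF nondegenerate_translate[OF nondegenerate p0] p u ml a la bM])
  moreover have "(\<lambda>z. \<eta> + z) ` {x. p ^ b dvd x} = {x. [x = \<eta>] (mod p ^ b)}"
  proof (intro set_eqI iffI)
    fix x assume "x \<in> {x. [x = \<eta>] (mod p ^ b)}"
    then have "x - \<eta> \<in> {x. p ^ b dvd x}" by (simp add: cong_iff_dvd_diff)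
    then show "x \<in> (\<lambda>z. \<eta> + z) ` {x. p ^ b dvd x}" by (rule rev_image_eqI) simp
  qed (auto simp: cong_iff_dvd_diff)
  ultimately show ?thesis by (simp add: stab_pull pull_pull o_def)
qed

section \<open>Decoupling inequalities\<close>

text \<open>As an image of \<open>S\<close> the family contains only nonempty classes, so every part
  offers a representative for a congruence.\<close>

definition residue_parts :: "int \<Rightarrow> int set \<Rightarrow> int set set" where
  "residue_parts q S = (\<lambda>x. {y\<in>S. [y = x] (mod q)}) ` S"

lemma finite_residue_parts: "finite S \<Longrightarrow> finite (residue_parts q S)"
  by (simp add: residue_parts_def)

lemma Union_residue_parts: "\<Union>(residue_parts q S) = S"
  by (auto simp: residue_parts_def)

lemma residue_parts_subset: "A \<in> residue_parts q S \<Longrightarrow> A \<subseteq> S"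
  by (auto simp: residue_parts_def)

lemma residue_parts_nonempty: "A \<in> residue_parts q S \<Longrightarrow> A \<noteq> {}"
  by (auto simp: residue_parts_def)

lemma residue_parts_cong: "A \<in> residue_parts q S \<Longrightarrow> x \<in> A \<Longrightarrow> y \<in> A \<Longrightarrow> [x = y] (mod q)"
  unfolding residue_parts_def by (auto intro: cong_trans cong_sym)

lemma residue_parts_eqI:
  assumes "A \<in> residue_parts q S" "x \<in> A"
  shows "A = {y\<in>S. [y = x] (mod q)}"
  using assms unfolding residue_parts_def by (auto intro: cong_trans cong_sym)

lemma residue_parts_disjoint: "A \<in> residue_parts q S \<Longrightarrow> B \<in> residue_parts q S \<Longrightarrow> A \<noteq> B \<Longrightarrow> A \<inter> B = {}"
  using residue_parts_eqI by blast

lemma sum_residue_parts: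
  assumes "finite S"
  shows "(\<Sum>x\<in>S. f x) = (\<Sum>A\<in>residue_parts q S. \<Sum>x\<in>A. f x)"
proof -
  have "(\<Sum>x\<in>\<Union>(residue_parts q S). f x) = (sum \<circ> sum) f (residue_parts q S)"
    using assms residue_parts_subset[of _ q S] residue_parts_disjoint[of _ q S]
    by (intro sum.Union_disjoint) (blast intro: finite_subset)+
  then show ?thesis by (simp add: Union_residue_parts)
qed

lemma card_residue_parts:
  assumes "q > 0" "finite S"
  shows "real (card (residue_parts q S)) \<le> real_of_int q"
proof -
  have "residue_parts q S = (\<lambda>r. {y\<in>S. [y = r] (mod q)}) ` ((\<lambda>x. x mod q) ` S)"
    by (simp add: residue_parts_def image_image cong_def)
  also have "card \<dots> \<le> card ((\<lambda>x. x mod q) ` S)"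
    using assms by (intro card_image_le) simp
  also have "\<dots> \<le> card {0..<q}"
    using assms by (intro card_mono) auto
  finally show ?thesis using assms by simp
qed

lemma residue_parts_residue_parts:
  assumes "A \<in> residue_parts q S" "q dvd q'"
  shows "residue_parts q' A = {B \<in> residue_parts q' S. B \<subseteq> A}"
proof -
  have eq: "{y\<in>A. [y = z] (mod q')} = {y\<in>S. [y = z] (mod q')}" if "z \<in> A" for z
    using residue_parts_eqI[OF assms(1) that] cong_dvd_modulus[OF _ assms(2)] by blast
  show ?thesis
  proof (intro set_eqI iffI)
    fix B assume "B \<in> residue_parts q' A"
    then obtain z where z: "z \<in> A" "B = {y\<in>A. [y = z] (mod q')}" by (auto simp: residue_parts_def)
    have "B = {y\<in>S. [y = z] (mod q')}" using eq[OF z(1)] z(2) by simp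
    then have "B \<in> residue_parts q' S" using z(1) residue_parts_subset[OF assms(1)] unfolding residue_parts_def
        by blast
    then show "B \<in> {B \<in> residue_parts q' S. B \<subseteq> A}" using z by blast
  next
    fix B assume B: "B \<in> {B \<in> residue_parts q' S. B \<subseteq> A}"
    then obtain z where z: "z \<in> B" using residue_parts_nonempty[of B q' S] by blast
    then have "B = {y\<in>S. [y = z] (mod q')}" using B residue_parts_eqI by blast
    also have "\<dots> = {y\<in>A. [y = z] (mod q')}" using eq[of z] z B by blast
    finally show "B \<in> residue_parts q' A" using z B unfolding residue_parts_def by blast
  qed
qed

lemma sum_residue_parts_refine:
  assumes S: "finite S" and q: "q dvd q'"
  shows "(\<Sum>A\<in>residue_parts q S. \<Sum>B\<in>residue_parts q' A. h B) = (\<Sum>B\<in>residue_parts q' S. h B)"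
proof -
  have "residue_parts q' S = (\<Union>A\<in>residue_parts q S. residue_parts q' A)"
  proof (intro set_eqI iffI)
    fix B assume B: "B \<in> residue_parts q' S"
    then obtain z where z: "z \<in> B" "z \<in> S" using residue_parts_nonempty[of B q' S] residue_parts_subset[of B q'
        S] by blast
    define A where "A = {y\<in>S. [y = z] (mod q)}"
    have A: "A \<in> residue_parts q S" using z by (auto simp: A_def residue_parts_def)
    have "B \<subseteq> A" using residue_parts_eqI[OF B z(1)] cong_dvd_modulus[OF _ q] unfolding A_def by blast
    then show "B \<in> (\<Union>A\<in>residue_parts q S. residue_parts q' A)" using A B residue_parts_residue_parts[OF A q] by blast
  next
    fix B assume "B \<in> (\<Union>A\<in>residue_parts q S. residue_parts q' A)"
    then show "B \<in> residue_parts q' S" using residue_parts_residue_parts[OF _ q] by blast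
  qed
  moreover have "residue_parts q' A \<inter> residue_parts q' B = {}" if "A \<in> residue_parts q S" "B \<in> residue_parts q
      S" "A \<noteq> B" for A B
    using residue_parts_disjoint[OF that] residue_parts_nonempty residue_parts_subset by blast
  moreover have "finite (residue_parts q' A)" if "A \<in> residue_parts q S" for A
    using finite_subset[OF residue_parts_subset[OF that] S] by (rule finite_residue_parts)
  ultimately show ?thesis
    using finite_residue_parts[OF S] by (simp add: sum.UNION_disjoint)
qed

lemma residue_parts_image:
  assumes "r \<noteq> 0"
  shows "residue_parts (r * q) ((\<lambda>z. u + r * z) ` S) = (\<lambda>A. (\<lambda>z. u + r * z) ` A) ` residue_parts q S"
proof -
  have "[u + r * y = u + r * x] (mod r * q) \<longleftrightarrow> [y = x] (mod q)" for x y
    using assms by (simp add: cong_iff_dvd_diff flip: right_diff_distrib)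
  then have "{y \<in> (\<lambda>z. u + r * z) ` S. [y = u + r * x] (mod r * q)} = (\<lambda>z. u + r * z) ` {y\<in>S. [y = x] (mod q)}" for x
    by auto
  then show ?thesis by (simp add: residue_parts_def image_image)
qed

section \<open>Moments, energies and decoupling constants\<close>

definition exp_sum :: "(int \<Rightarrow> complex) \<Rightarrow> int set \<Rightarrow> (int \<Rightarrow> complex) \<Rightarrow> complex" where
  "exp_sum a S \<chi> = (\<Sum>x\<in>S. a x * \<chi> x)"

definition moment :: "(int \<Rightarrow> complex) set \<Rightarrow> (int \<Rightarrow> complex) \<Rightarrow> nat \<Rightarrow> int set \<Rightarrow> real" where
  "moment \<Phi> a P S = avg \<Phi> (\<lambda>\<chi>. cmod (exp_sum a S \<chi>) ^ P)"

definition energy :: "int \<Rightarrow> nat \<Rightarrow> (int \<Rightarrow> complex) set \<Rightarrow> (int \<Rightarrow> complex) \<Rightarrow> nat \<Rightarrow> int set \<Rightarrow> real" where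
  "energy p n \<Phi> a P S = (\<Sum>A\<in>residue_parts (p ^ n) S. moment \<Phi> a P A)"

lemma moment_nonneg: "0 \<le> moment \<Phi> a P S"
  unfolding moment_def by (rule avg_nonneg) simp

lemma energy_nonneg: "0 \<le> energy p n \<Phi> a P S"
  unfolding energy_def by (intro sum_nonneg moment_nonneg)

lemma exp_sum_residue_parts: "finite S \<Longrightarrow> exp_sum a S \<chi> = (\<Sum>A\<in>residue_parts q S. exp_sum a A \<chi>)"
  unfolding exp_sum_def by (rule sum_residue_parts)

lemma energy_residue_parts: "finite S \<Longrightarrow> m \<le> n \<Longrightarrow> (\<Sum>A\<in>residue_parts (p ^ m) S. energy p n \<Phi> a P A) = energy p n \<Phi> a P S"
  unfolding energy_def by (intro sum_residue_parts_refine le_imp_power_dvd)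

text \<open>The critical moment 2s with s = k(k+1)/2, at which the two terms X^s and X^(2s -
  k(k+1)/2) are equal.\<close>

definition crit :: "nat \<Rightarrow> nat" where "crit k = k * (k + 1)"

lemma crit_strict_mono: "l < k \<Longrightarrow> crit l < crit k"
  unfolding crit_def by (intro mult_strict_mono) auto

lemma crit_mono: "l \<le> k \<Longrightarrow> crit l \<le> crit k"
  unfolding crit_def by (intro mult_le_mono) auto

lemma crit_0 [simp]: "crit 0 = 0"
  by (simp add: crit_def)

lemma crit_ge_2: "k \<ge> 1 \<Longrightarrow> crit k \<ge> 2"
  using crit_mono[of 1 k] by (simp add: crit_def)

text \<open>With N = p^n pieces and P = crit k, this is the factor N^(P/2 - 1) by which Hoelder's
  inequality passes from the P/2-th power of the sum of |f_A|^2 to the sum of |f_A|^P.\<close>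

definition scale_factor :: "int \<Rightarrow> nat \<Rightarrow> nat \<Rightarrow> real" where
  "scale_factor p k n = real_of_int p powr (real n * (real (crit k) / 2 - 1))"

text \<open>The factor \<open>scale_factor p k n\<close> is normalised so that square root cancellation corresponds to
  \<open>C\<close> being at most an arbitrarily small power of \<open>p ^ n\<close>.\<close>

definition decouples :: "int \<Rightarrow> nat \<Rightarrow> nat \<Rightarrow> real \<Rightarrow> bool" where
  "decouples p k n C \<longleftrightarrow> (\<forall>\<Phi> M a S. nondegenerate p k M \<Phi> \<longrightarrow> k * n \<le> M \<longrightarrow> finite S \<longrightarrow>
     moment \<Phi> a (crit k) S \<le> C * scale_factor p k n * energy p n \<Phi> a (crit k) S)"

lemma decouplesD: "decouples p k n C \<Longrightarrow> nondegenerate p k M \<Phi> \<Longrightarrow> k * n \<le> M \<Longrightarrow> finite S \<Longrightarrow>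
     moment \<Phi> a (crit k) S \<le> C * scale_factor p k n * energy p n \<Phi> a (crit k) S"
  unfolding decouples_def by blast

lemma scale_factor_pos: "p > 0 \<Longrightarrow> scale_factor p k n > 0"
  by (simp add: scale_factor_def)

lemma scale_factor_add: "p > 0 \<Longrightarrow> scale_factor p k (m + n) = scale_factor p k m * scale_factor p k n"
  by (simp only: scale_factor_def of_nat_add distrib_right powr_add)

lemma decouples_mono:
  assumes "decouples p k n C" "C \<le> D" "p > 0"
  shows "decouples p k n D"
  unfolding decouples_def
proof (intro allI impI)
  fix \<Phi> M a and S :: "int set" assume "nondegenerate p k M \<Phi>" "k * n \<le> M" "finite S"
  then have "moment \<Phi> a (crit k) S \<le> C * scale_factor p k n * energy p n \<Phi> a (crit k) S"
    using assms(1) by (rule decouplesD[rotated])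
  also have "\<dots> \<le> D * scale_factor p k n * energy p n \<Phi> a (crit k) S"
    using assms scale_factor_pos[of p k n] energy_nonneg by (intro mult_right_mono) auto
  finally show "moment \<Phi> a (crit k) S \<le> D * scale_factor p k n * energy p n \<Phi> a (crit k) S" .
qed

lemma moment_pull:
  assumes \<Psi>: "phase_group \<Psi>" and inj: "inj \<iota>"
  shows "moment (pull \<Psi> \<iota>) (a \<circ> \<iota>) P A = moment \<Psi> a P (\<iota> ` A)"
proof -
  have "exp_sum (a \<circ> \<iota>) A (\<chi> \<circ> \<iota>) = exp_sum a (\<iota> ` A) \<chi>" for \<chi>
    unfolding exp_sum_def using inj by (subst sum.reindex) (auto simp: inj_on_def)
  then show ?thesis unfolding moment_def by (simp add: avg_pull[OF \<Psi>])
qed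

lemma class_image:
  fixes p u :: int
  assumes "p > 0" "finite S" "\<forall>x\<in>S. [x = u] (mod p ^ a)"
  obtains S0 where "finite S0" "S = (\<lambda>z. u + p ^ a * z) ` S0"
proof -
  let ?\<iota> = "\<lambda>z. u + p ^ a * z"
  define S0 where "S0 = {z. ?\<iota> z \<in> S}"
  have S0: "S = ?\<iota> ` S0"
  proof (intro set_eqI iffI)
    fix x assume x: "x \<in> S"
    then have "[x = u] (mod p ^ a)" using assms(3) by blast
    then have "p ^ a dvd x - u" by (simp add: cong_iff_dvd_diff)
    then obtain z where "x - u = p ^ a * z" by (rule dvdE)
    then have "x = ?\<iota> z" by simp
    then show "x \<in> ?\<iota> ` S0" using x by (auto simp: S0_def)
  qed (auto simp: S0_def)
  have "inj_on ?\<iota> S0" using assms(1) by (auto simp: inj_on_def)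
  then have "finite S0" using assms(2) S0 by (metis finite_imageD)
  then show ?thesis using S0 by (rule that)
qed

lemma card_residue_parts_class:
  assumes "p > 0" "finite S" "\<forall>x\<in>S. [x = u] (mod p ^ a)"
  shows "real (card (residue_parts (p ^ (a + n)) S)) \<le> real_of_int p ^ n"
proof -
  obtain S0 where S0: "finite S0" "S = (\<lambda>z. u + p ^ a * z) ` S0"
    by (rule class_image[OF assms])
  have "card (residue_parts (p ^ (a + n)) S) \<le> card (residue_parts (p ^ n) S0)"
    unfolding S0(2) power_add using assms(1) finite_residue_parts[OF S0(1)]
    by (subst residue_parts_image) (auto intro: card_image_le)
  also have "real \<dots> \<le> real_of_int (p ^ n)"
    using assms(1) S0(1) by (intro card_residue_parts) auto
  finally show ?thesis by simp
qed

text \<open>In the coordinate z with x = u + p^a z, parts modulo p^n become parts of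
  \<open>S\<close> modulo p^(a+n). Only the pulled back group is assumed nondegenerate, because in
  the bilinear step \<Psi> is a stabiliser, of which nothing more is known.\<close>

lemma decouples_rescaled:
  assumes decouples: "decouples p l n C" and p: "p > 0" and \<Psi>: "phase_group \<Psi>"
    and nondegenerate: "nondegenerate p l M (pull \<Psi> (\<lambda>z. u + p ^ a * z))" and M: "l * n \<le> M"
    and S: "finite S" "\<forall>x\<in>S. [x = u] (mod p ^ a)"
  shows "moment \<Psi> w (crit l) S \<le> C * scale_factor p l n * energy p (a + n) \<Psi> w (crit l) S"
proof -
  let ?\<iota> = "\<lambda>z. u + p ^ a * z"
  have inj: "inj ?\<iota>" using p by (auto simp: inj_on_def)
  obtain S0 where fin: "finite S0" and S0: "S = ?\<iota> ` S0"
    by (rule class_image[OF p S])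
  have "moment \<Psi> w (crit l) S = moment (pull \<Psi> ?\<iota>) (w \<circ> ?\<iota>) (crit l) S0"
    unfolding S0 by (rule moment_pull[OF \<Psi> inj, symmetric])
  also have "\<dots> \<le> C * scale_factor p l n * energy p n (pull \<Psi> ?\<iota>) (w \<circ> ?\<iota>) (crit l) S0"
    by (rule decouplesD[OF decouples nondegenerate M fin])
  also have "energy p n (pull \<Psi> ?\<iota>) (w \<circ> ?\<iota>) (crit l) S0 = (\<Sum>A\<in>residue_parts (p ^ n) S0. moment \<Psi> w (crit l) (?\<iota>
      ` A))"
    unfolding energy_def moment_pull[OF \<Psi> inj] ..
  also have "\<dots> = (\<Sum>B\<in>(\<lambda>A. ?\<iota> ` A) ` residue_parts (p ^ n) S0. moment \<Psi> w (crit l) B)"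
    using inj by (subst sum.reindex) (auto simp: inj_on_def inj_image_eq_iff)
  also have "(\<lambda>A. ?\<iota> ` A) ` residue_parts (p ^ n) S0 = residue_parts (p ^ (a + n)) S"
    unfolding S0 power_add using p by (intro residue_parts_image[symmetric]) simp
  finally show ?thesis by (simp add: energy_def)
qed

lemma diff_dvd_poly_diff: "x - y dvd poly g x - poly g y" for x y :: "'a::comm_ring_1"
proof (induction g)
  case (pCons c g)
  have "poly (pCons c g) x - poly (pCons c g) y = x * (poly g x - poly g y) + (x - y) * poly g y"
    by (simp add: algebra_simps)
  then show ?case using pCons.IH by simp
qed simp

lemma cnj_ee: "cnj (ee q t) = ee q (- t)"
  by (simp add: ee_def cis_cnj)

text \<open>Orthogonality: the single phase x + p g(x) separates distinct classes modulo p^n, so all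
  cross terms of the second moment vanish. Since crit 1 = 2, the scale factor is 1.\<close>

lemma decouples_1:
  assumes p: "p > 0"
  shows "decouples p 1 n 1"
  unfolding decouples_def
proof (intro allI impI)
  fix \<Phi> M a and S :: "int set" assume nondegenerate: "nondegenerate p 1 M \<Phi>" and M: "1 * n \<le> M" and S: "finite S"
  have \<Phi>: "phase_group \<Phi>" using nondegenerate by (simp add: nondegenerate_def)
  define K where "K x y = avg \<Phi> (\<lambda>\<chi>. \<chi> x * cnj (\<chi> y))" for x y
  have K0: "K x y = 0" if xy: "\<not> [x = y] (mod p ^ n)" for x y
  proof -
    obtain g where "monom 1 1 + smult p g \<in> phases \<Phi> (p ^ M)"
      using nondegenerate by (auto simp: nondegenerate_def)
    then obtain \<psi> c where \<psi>: "\<psi> \<in> \<Phi>" "\<And>x. \<psi> x = c * ee (p ^ M) (poly (monom 1 1 + smult p g) x)"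
      unfolding phases_def by blast
    let ?f = "poly (monom 1 1 + smult p g)"
    have c: "cmod c = 1" using phase_group_norm[OF \<Phi> \<psi>(1), of 0] by (simp add: \<psi>(2) norm_mult)
    have "x - y dvd poly g x - poly g y" by (rule diff_dvd_poly_diff)
    then obtain t where t: "poly g x - poly g y = (x - y) * t" by blast
    have "?f x - ?f y = (x - y) + p * (poly g x - poly g y)"
      by (simp add: poly_monom algebra_simps)
    \<comment> \<open>The factor 1 + p t is prime to p, so the perturbation p g does not change
      which powers of p divide the difference.\<close>
    then have f: "?f x - ?f y = (x - y) * (1 + p * t)"
      unfolding t by (simp add: algebra_simps)
    have "\<psi> x * cnj (\<psi> y) = (c * cnj c) * (ee (p ^ M) (?f x) * cnj (ee (p ^ M) (?f y)))"
      by (simp add: \<psi>(2) ac_simps)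
    also have "c * cnj c = 1" using c by (simp add: complex_norm_square[symmetric])
    also have "cnj (ee (p ^ M) (?f y)) = ee (p ^ M) (- ?f y)"
      by (rule cnj_ee)
    finally have "\<psi> x * cnj (\<psi> y) = ee (p ^ M) (?f x + - ?f y)"
      by (simp only: ee_add mult_1_left)
    then have h: "\<psi> x * cnj (\<psi> y) = ee (p ^ M) (?f x - ?f y)"
      by (simp only: add_uminus_conv_diff)
    have "\<not> p ^ M dvd ?f x - ?f y"
    proof
      assume "p ^ M dvd ?f x - ?f y"
      then have "p ^ n dvd (x - y) * (1 + p * t)"
        using M by (simp only: f) (metis dvd_trans le_imp_power_dvd mult_1)
      moreover have "coprime (p ^ n) (1 + p * t)"
      proof -
        have "coprime p (1 + p * t)" by (rule coprimeI) (metis dvd_add_left_iff dvd_mult2)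
        then show ?thesis by simp
      qed
      ultimately have "p ^ n dvd x - y" by (simp add: coprime_dvd_mult_left_iff)
      then show False using xy by (simp add: cong_iff_dvd_diff)
    qed
    then have "\<psi> x * cnj (\<psi> y) \<noteq> 1" unfolding h using p by (subst ee_eq_1_iff) auto
    then show ?thesis
      unfolding K_def by (intro avg_character[OF \<Phi> _ \<psi>(1)]) (auto simp: ac_simps)
  qed
  have moment: "complex_of_real (moment \<Phi> a 2 A) = (\<Sum>x\<in>A. \<Sum>y\<in>A. a x * cnj (a y) * K x y)" for A
  proof -
    have "complex_of_real (moment \<Phi> a 2 A) = avg \<Phi> (\<lambda>\<chi>. complex_of_real (cmod (exp_sum a A \<chi>) ^ 2))"
      by (simp add: moment_def avg_def)
    also have "\<dots> = avg \<Phi> (\<lambda>\<chi>. \<Sum>x\<in>A. \<Sum>y\<in>A. a x * cnj (a y) * (\<chi> x * cnj (\<chi> y)))"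
      unfolding complex_norm_square exp_sum_def
      by (simp add: sum_product ac_simps)
    finally show ?thesis by (simp add: avg_sum avg_mult K_def)
  qed
  have "complex_of_real (moment \<Phi> a 2 S) = (\<Sum>A\<in>residue_parts (p ^ n) S. \<Sum>x\<in>A. \<Sum>y\<in>S. a x * cnj (a y) * K x y)"
    unfolding moment by (rule sum_residue_parts[OF S])
  also have "\<dots> = (\<Sum>A\<in>residue_parts (p ^ n) S. \<Sum>x\<in>A. \<Sum>y\<in>A. a x * cnj (a y) * K x y)"
  proof (rule sum.cong[OF refl], rule sum.cong[OF refl])
    fix A x assume A: "A \<in> residue_parts (p ^ n) S" and x: "x \<in> A"
    show "(\<Sum>y\<in>S. a x * cnj (a y) * K x y) = (\<Sum>y\<in>A. a x * cnj (a y) * K x y)"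
    proof (rule sum.mono_neutral_right[OF S residue_parts_subset[OF A]], rule ballI)
      fix y assume y: "y \<in> S - A"
      have "\<not> [x = y] (mod p ^ n)" using residue_parts_eqI[OF A x] y by (auto dest: cong_sym)
      then show "a x * cnj (a y) * K x y = 0" by (simp add: K0)
    qed
  qed
  also have "\<dots> = complex_of_real (energy p n \<Phi> a 2 S)"
    unfolding energy_def of_real_sum moment ..
  finally have "moment \<Phi> a 2 S = energy p n \<Phi> a 2 S" by (simp only: of_real_eq_iff)
  then show "moment \<Phi> a (crit 1) S \<le> 1 * scale_factor p 1 n * energy p n \<Phi> a (crit 1) S"
    using p by (simp add: scale_factor_def crit_def numeral_2_eq_2)
qed

lemma norm_sum_power_le:
  assumes I: "finite I" "real (card I) \<le> N" and P: "P > 0"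
  shows "norm (\<Sum>i\<in>I. f i) ^ P \<le> N ^ P * (\<Sum>i\<in>I. norm (f i) ^ P)"
proof (cases "I = {}")
  case True
  then show ?thesis using P by (simp add: zero_power)
next
  case False
  define m where "m = Max ((\<lambda>i. norm (f i)) ` I)"
  have le: "norm (f i) \<le> m" if "i \<in> I" for i
    unfolding m_def using I that by (intro Max_ge) auto
  have "m \<in> (\<lambda>i. norm (f i)) ` I" unfolding m_def using I False by (intro Max_in) auto
  then obtain i0 where i0: "i0 \<in> I" "m = norm (f i0)" by blast
  have m0: "m \<ge> 0" using i0 by simp
  have "norm (\<Sum>i\<in>I. f i) \<le> (\<Sum>i\<in>I. norm (f i))" by (rule norm_sum)
  also have "\<dots> \<le> real (card I) * m" using sum_bounded_above[of I "\<lambda>i. norm (f i)" m] le by simp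
  also have "\<dots> \<le> N * m" using I m0 by (intro mult_right_mono)
  finally have "norm (\<Sum>i\<in>I. f i) ^ P \<le> (N * m) ^ P" by (intro power_mono) auto
  also have "\<dots> = N ^ P * norm (f i0) ^ P" by (simp add: power_mult_distrib i0)
  also have "norm (f i0) ^ P \<le> (\<Sum>i\<in>I. norm (f i) ^ P)"
    using i0 I by (intro member_le_sum) auto
  finally show ?thesis using I(2) by (simp add: mult_left_mono)
qed

text \<open>A crude exponent that shows some exponent to be admissible and later disposes of the
  finitely many small n.\<close>

lemma decouples_trivial:
  assumes p: "p > 0" and k: "k \<ge> 1"
  shows "decouples p k n (real_of_int p powr (real (crit k) * real n))"
  unfolding decouples_def
proof (intro allI impI)
  fix \<Phi> M a and S :: "int set" assume S: "finite S"
  let ?N = "real_of_int (p ^ n)"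
  have "moment \<Phi> a (crit k) S \<le> avg \<Phi> (\<lambda>\<chi>. ?N ^ crit k * (\<Sum>A\<in>residue_parts (p ^ n) S. cmod (exp_sum a A \<chi>) ^ crit k))"
    unfolding moment_def
  proof (rule avg_mono)
    fix \<chi>
    show "cmod (exp_sum a S \<chi>) ^ crit k \<le> ?N ^ crit k * (\<Sum>A\<in>residue_parts (p ^ n) S. cmod (exp_sum a A \<chi>) ^ crit k)"
      unfolding exp_sum_residue_parts[OF S, of a \<chi> "p ^ n"]
      using p crit_ge_2[OF k] by (intro norm_sum_power_le finite_residue_parts S card_residue_parts) auto
  qed
  also have "\<dots> = ?N ^ crit k * energy p n \<Phi> a (crit k) S"
    by (simp only: avg_mult avg_sum energy_def moment_def)
  also have "?N ^ crit k = real_of_int p powr (real (crit k) * real n)"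
    using p by (simp add: powr_realpow[symmetric] powr_powr mult.commute)
  also have "real_of_int p powr (real (crit k) * real n) * energy p n \<Phi> a (crit k) S
      \<le> real_of_int p powr (real (crit k) * real n) * scale_factor p k n * energy p n \<Phi> a (crit k) S"
  proof -
    have "1 \<le> scale_factor p k n"
    proof -
      have "2 \<le> real (crit k)"
        using crit_ge_2[OF k] by simp
      then show ?thesis unfolding scale_factor_def using p by (intro ge_one_powr_ge_zero) auto
    qed
    then have "real_of_int p powr (real (crit k) * real n) * 1 \<le> real_of_int p powr (real (crit k) * real n) *
        scale_factor p k n"
      by (intro mult_left_mono) auto
    then show ?thesis using energy_nonneg by (intro mult_right_mono) auto
  qed
  finally show "moment \<Phi> a (crit k) S \<le> real_of_int p powr (real (crit k) * real n) * scale_factor p k n *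
      energy p n \<Phi> a (crit k) S" .
qed

text \<open>Young's inequality for F/A and G/B bounds H pointwise by a linear combination of F and
  G, which is then averaged. Positive upper bounds A and B in place of the averages make the
  division safe.\<close>

lemma avg_holder:
  fixes F G H :: "'b \<Rightarrow> real"
  assumes \<Phi>: "finite \<Phi>" and s: "0 \<le> s" "s \<le> 1" and A: "A > 0" and B: "B > 0"
    and F: "\<And>x. x \<in> \<Phi> \<Longrightarrow> 0 \<le> F x" "avg \<Phi> F \<le> A" and G: "\<And>x. x \<in> \<Phi> \<Longrightarrow> 0 \<le> G x" "avg \<Phi> G \<le> B"
    and H: "\<And>x. x \<in> \<Phi> \<Longrightarrow> H x \<le> F x powr s * G x powr (1 - s)"
  shows "avg \<Phi> H \<le> A powr s * B powr (1 - s)"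
proof -
  let ?E = "A powr s * B powr (1 - s)"
  have "H x \<le> (?E * s / A) * F x + (?E * (1 - s) / B) * G x" if x: "x \<in> \<Phi>" for x
  proof (cases "F x = 0 \<or> G x = 0")
    case True
    then have "H x \<le> 0" using H[OF x] by auto
    also have "0 \<le> (?E * s / A) * F x + (?E * (1 - s) / B) * G x"
      using F(1)[OF x] G(1)[OF x] s A B by (intro add_nonneg_nonneg mult_nonneg_nonneg) auto
    finally show ?thesis .
  next
    case False
    then have pos: "F x > 0" "G x > 0" using F(1)[OF x] G(1)[OF x] by auto
    have "(F x / A) powr s * (G x / B) powr (1 - s) \<le> s * (F x / A) + (1 - s) * (G x / B)"
      using pos A B s by (intro Youngs_inequality_0) auto
    then have "?E * ((F x / A) powr s * (G x / B) powr (1 - s)) \<le> ?E * (s * (F x / A) + (1 - s) * (G x / B))"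
      by (intro mult_left_mono) auto
    moreover have "?E * ((F x / A) powr s * (G x / B) powr (1 - s)) = F x powr s * G x powr (1 - s)"
      using pos A B by (simp add: powr_divide)
    ultimately show ?thesis using H[OF x] by (simp add: algebra_simps)
  qed
  then have "avg \<Phi> H \<le> avg \<Phi> (\<lambda>x. (?E * s / A) * F x + (?E * (1 - s) / B) * G x)"
    by (rule avg_mono)
  also have "\<dots> = (?E * s / A) * avg \<Phi> F + (?E * (1 - s) / B) * avg \<Phi> G"
    by (simp only: avg_add avg_mult)
  also have "\<dots> \<le> (?E * s / A) * A + (?E * (1 - s) / B) * B"
    using F G s A B by (intro add_mono mult_left_mono) auto
  also have "\<dots> = ?E" using A B by (simp add: field_simps)
  finally show ?thesis .
qed

section \<open>Bilinear estimates\<close>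

text \<open>The bounds \<open>U\<close> and \<open>V\<close> are kept positive so that \<open>0 powr 0 = 0\<close> does not interfere when \<open>l = 0\<close>.\<close>

definition bilinear_bound :: "int \<Rightarrow> nat \<Rightarrow> nat \<Rightarrow> nat \<Rightarrow> nat \<Rightarrow> nat \<Rightarrow> real \<Rightarrow> bool" where
  "bilinear_bound p k l a b n B \<longleftrightarrow> (\<forall>\<Phi> M w S S' \<xi> \<eta> (U::real) (V::real). nondegenerate p k M \<Phi> \<longrightarrow> k * n \<le> M \<longrightarrow>
      finite S \<longrightarrow> finite S' \<longrightarrow>
     (\<forall>x\<in>S. [x = \<xi>] (mod p ^ a)) \<longrightarrow> (\<forall>x\<in>S'. [x = \<eta>] (mod p ^ b)) \<longrightarrow> \<not> [\<xi> = \<eta>] (mod p) \<longrightarrow>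
     0 < U \<longrightarrow> 0 < V \<longrightarrow> scale_factor p k (n - a) * energy p n \<Phi> w (crit k) S \<le> U \<longrightarrow> scale_factor p k (n - b) *
         energy p n \<Phi> w (crit k) S' \<le> V \<longrightarrow>
     avg \<Phi> (\<lambda>\<chi>. cmod (exp_sum w S \<chi>) ^ crit l * cmod (exp_sum w S' \<chi>) ^ (crit k - crit l))
       \<le> B * U powr (real (crit l) / real (crit k)) * V powr (1 - real (crit l) / real (crit k)))"

lemma bilinear_boundD:
  assumes "bilinear_bound p k l a b n B" "nondegenerate p k M \<Phi>" "k * n \<le> M" "finite S" "finite S'"
    "\<forall>x\<in>S. [x = \<xi>] (mod p ^ a)" "\<forall>x\<in>S'. [x = \<eta>] (mod p ^ b)" "\<not> [\<xi> = \<eta>] (mod p)"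
    "0 < U" "0 < V" "scale_factor p k (n - a) * energy p n \<Phi> w (crit k) S \<le> U" "scale_factor p k (n - b) *
        energy p n \<Phi> w (crit k) S' \<le> V"
  shows "avg \<Phi> (\<lambda>\<chi>. cmod (exp_sum w S \<chi>) ^ crit l * cmod (exp_sum w S' \<chi>) ^ (crit k - crit l))
       \<le> B * U powr (real (crit l) / real (crit k)) * V powr (1 - real (crit l) / real (crit k))"
  using assms unfolding bilinear_bound_def by blast

lemma bilinear_boundI:
  assumes "\<And>\<Phi> M w S S' \<xi> \<eta> U V. nondegenerate p k M \<Phi> \<Longrightarrow> k * n \<le> M \<Longrightarrow> finite S \<Longrightarrow> finite S' \<Longrightarrow>
     \<forall>x\<in>S. [x = \<xi>] (mod p ^ a) \<Longrightarrow> \<forall>x\<in>S'. [x = \<eta>] (mod p ^ b) \<Longrightarrow> \<not> [\<xi> = \<eta>] (mod p) \<Longrightarrow>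
     0 < U \<Longrightarrow> 0 < V \<Longrightarrow> scale_factor p k (n - a) * energy p n \<Phi> w (crit k) S \<le> U \<Longrightarrow> scale_factor p k (n - b) *
         energy p n \<Phi> w (crit k) S' \<le> V \<Longrightarrow>
     avg \<Phi> (\<lambda>\<chi>. cmod (exp_sum w S \<chi>) ^ crit l * cmod (exp_sum w S' \<chi>) ^ (crit k - crit l))
       \<le> B * U powr (real (crit l) / real (crit k)) * V powr (1 - real (crit l) / real (crit k))"
  shows "bilinear_bound p k l a b n B"
  using assms unfolding bilinear_bound_def by blast

text \<open>Rescaling a class modulo p^b costs kb of the level, and what remains is enough for the n
  - b scales still to be decoupled.\<close>

lemma decouples_class:
  assumes decouples: "decouples p k (n - b) C" and p: "p > 0" and nondegenerate: "nondegenerate p k M \<Phi>" and M: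
      "k * n \<le> M" and b: "b \<le> n"
    and S: "finite S" "\<forall>x\<in>S. [x = u] (mod p ^ b)"
  shows "moment \<Phi> w (crit k) S \<le> C * scale_factor p k (n - b) * energy p n \<Phi> w (crit k) S"
proof -
  have kb: "k * b \<le> M" using b M by (meson le_trans mult_le_mono2)
  have "k * (n - b) \<le> M - k * b" using M by (simp add: diff_mult_distrib2 diff_le_mono)
  from decouples_rescaled[OF decouples p _ nondegenerate_rescale[OF nondegenerate p kb] this S]
  show ?thesis using nondegenerate b by (simp add: nondegenerate_def)
qed

text \<open>\<open>U\<close> and \<open>V\<close> stand for the size of the two critical moments
  under square root cancellation. For l = 0 only the second sum is present, and it needs just n - b
  scales: a constant p^(\<eta>(n-b)) instead of p^(\<eta>n). All savings originate here.\<close>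

lemma bilinear_bound_0:
  assumes decouples: "decouples p k (n - b) C" and p: "p > 0" and b: "b \<le> n" and C: "C \<ge> 0"
  shows "bilinear_bound p k 0 a b n C"
proof (rule bilinear_boundI)
  fix \<Phi> M w S S' \<xi> \<eta> and U V :: real
  assume "nondegenerate p k M \<Phi>" "k * n \<le> M" "finite S'" "\<forall>x\<in>S'. [x = \<eta>] (mod p ^ b)"
    and UV: "0 < U" "0 < V" "scale_factor p k (n - b) * energy p n \<Phi> w (crit k) S' \<le> V"
  then have "moment \<Phi> w (crit k) S' \<le> C * scale_factor p k (n - b) * energy p n \<Phi> w (crit k) S'"
    using decouples_class[OF decouples p _ _ b] by blast
  also have "\<dots> \<le> C * V" using UV C by (simp add: mult.assoc mult_left_mono)
  finally show "avg \<Phi> (\<lambda>\<chi>. cmod (exp_sum w S \<chi>) ^ crit 0 * cmod (exp_sum w S' \<chi>) ^ (crit k - crit 0))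
       \<le> C * U powr (real (crit 0) / real (crit k)) * V powr (1 - real (crit 0) / real (crit k))"
    using UV by (simp add: moment_def)
qed

text \<open>Equality holds for positive x and y; if one of them is 0, the left side vanishes because
  c and d are positive.\<close>

lemma power_interpolate:
  fixes x y :: real
  assumes x: "0 \<le> x" and y: "0 \<le> y" and c: "c > 0" "real c = s * real a1 + (1 - s) * real a2"
    and d: "d > 0" "real d = s * real b1 + (1 - s) * real b2"
  shows "x ^ c * y ^ d \<le> (x ^ a1 * y ^ b1) powr s * (x ^ a2 * y ^ b2) powr (1 - s)"
proof (cases "x = 0 \<or> y = 0")
  case True
  then have "x ^ c * y ^ d = 0" using c d by (auto simp: zero_power)
  then show ?thesis by (rule order_trans[OF eq_refl]) simp
next
  case False
  then have pos: "x > 0" "y > 0" using x y by auto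
  have "(x ^ a1 * y ^ b1) powr s * (x ^ a2 * y ^ b2) powr (1 - s)
      = x powr (s * real a1 + (1 - s) * real a2) * y powr (s * real b1 + (1 - s) * real b2)"
    using pos by (simp add: powr_mult powr_realpow[symmetric] powr_powr powr_add mult.commute mult.left_commute)
  also have "\<dots> = x ^ c * y ^ d"
    unfolding c(2)[symmetric] d(2)[symmetric] using pos by (simp add: powr_realpow)
  finally show ?thesis by simp
qed

text \<open>Hoelder's inequality between the two critical moments. This starts the iteration for l
  >= 1, with no saving.\<close>

lemma bilinear_bound_trivial:
  assumes decouples: "decouples p k (n - a) D" "decouples p k (n - b) D" and p: "p > 0" and ab: "a \<le> n" "b \<le> n"
      and D: "D > 0"
    and l: "1 \<le> l" "l < k"
  shows "bilinear_bound p k l a b n D"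
proof (rule bilinear_boundI)
  fix \<Phi> M w S S' \<xi> \<eta> and U V :: real
  assume nondegenerate: "nondegenerate p k M \<Phi>" and M: "k * n \<le> M"
    and S: "finite S" "\<forall>x\<in>S. [x = \<xi>] (mod p ^ a)" and S': "finite S'" "\<forall>x\<in>S'. [x = \<eta>] (mod p ^ b)"
    and UV: "0 < U" "0 < V" "scale_factor p k (n - a) * energy p n \<Phi> w (crit k) S \<le> U" "scale_factor p k (n - b)
        * energy p n \<Phi> w (crit k) S' \<le> V"
  let ?\<theta> = "real (crit l) / real (crit k)"
  have lk: "crit l < crit k" using l(2) by (rule crit_strict_mono)
  have l0: "crit l > 0" using crit_ge_2[OF l(1)] by simp
  have m1: "moment \<Phi> w (crit k) S \<le> D * U"
    by (rule order_trans[OF decouples_class[OF decouples(1) p nondegenerate M ab(1) S]])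
      (use mult_left_mono[OF UV(3) less_imp_le[OF D]] in \<open>simp only: mult.assoc\<close>)
  have m2: "moment \<Phi> w (crit k) S' \<le> D * V"
    by (rule order_trans[OF decouples_class[OF decouples(2) p nondegenerate M ab(2) S']])
      (use mult_left_mono[OF UV(4) less_imp_le[OF D]] in \<open>simp only: mult.assoc\<close>)
  have "avg \<Phi> (\<lambda>\<chi>. cmod (exp_sum w S \<chi>) ^ crit l * cmod (exp_sum w S' \<chi>) ^ (crit k - crit l))
      \<le> (D * U) powr ?\<theta> * (D * V) powr (1 - ?\<theta>)"
  proof (rule avg_holder[where F = "\<lambda>\<chi>. cmod (exp_sum w S \<chi>) ^ crit k" and G = "\<lambda>\<chi>. cmod (exp_sum w S' \<chi>) ^ crit k"])
    show "finite \<Phi>" using nondegenerate by (simp add: nondegenerate_def phase_group_finite)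
    show "0 \<le> ?\<theta>" "?\<theta> \<le> 1" using lk by (simp_all add: divide_le_eq_1)
    show "avg \<Phi> (\<lambda>\<chi>. cmod (exp_sum w S \<chi>) ^ crit k) \<le> D * U" "avg \<Phi> (\<lambda>\<chi>. cmod (exp_sum w S' \<chi>) ^ crit k) \<le> D * V"
      using m1 m2 by (simp_all only: moment_def)
    fix \<chi>
    have "cmod (exp_sum w S \<chi>) ^ crit l * cmod (exp_sum w S' \<chi>) ^ (crit k - crit l)
      \<le> (cmod (exp_sum w S \<chi>) ^ crit k * cmod (exp_sum w S' \<chi>) ^ 0) powr ?\<theta> *
        (cmod (exp_sum w S \<chi>) ^ 0 * cmod (exp_sum w S' \<chi>) ^ crit k) powr (1 - ?\<theta>)"
    proof (rule power_interpolate)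
      have P: "real (crit k) \<noteq> 0" using lk by (metis of_nat_eq_0_iff not_less_zero)
      show "real (crit l) = ?\<theta> * real (crit k) + (1 - ?\<theta>) * real 0" using P by simp
      have "real (crit k - crit l) = real (crit k) - real (crit l)" using lk by (intro of_nat_diff) simp
      then show "real (crit k - crit l) = ?\<theta> * real 0 + (1 - ?\<theta>) * real (crit k)" using P by (simp add:
          left_diff_distrib)
    qed (use lk l0 in simp_all)
    then show "cmod (exp_sum w S \<chi>) ^ crit l * cmod (exp_sum w S' \<chi>) ^ (crit k - crit l)
      \<le> (cmod (exp_sum w S \<chi>) ^ crit k) powr ?\<theta> * (cmod (exp_sum w S' \<chi>) ^ crit k) powr (1 - ?\<theta>)" by simp
  qed (use D UV in simp_all)
  also have "\<dots> = D powr (?\<theta> + (1 - ?\<theta>)) * U powr ?\<theta> * V powr (1 - ?\<theta>)"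
    using D UV by (simp only: powr_mult powr_add mult.assoc mult.left_commute)
  also have "\<dots> = D * U powr ?\<theta> * V powr (1 - ?\<theta>)"
    using D by simp
  finally show "avg \<Phi> (\<lambda>\<chi>. cmod (exp_sum w S \<chi>) ^ crit l * cmod (exp_sum w S' \<chi>) ^ (crit k - crit l))
      \<le> D * U powr ?\<theta> * V powr (1 - ?\<theta>)" .
qed

text \<open>The exponent pair of degree l is a convex combination of the reversed pair of degree k -
  l and the pair of degree l - 1. This forces the weight s.\<close>

lemma holder_exponents:
  fixes k l :: nat
  assumes l: "1 \<le> l" "l < k"
  defines "s \<equiv> 1 / real (k - l + 1)"
  shows "real (crit l) = s * real (crit k - crit (k - l)) + (1 - s) * real (crit (l - 1))" (is ?A)
    and "real (crit k - crit l) = s * real (crit (k - l)) + (1 - s) * real (crit k - crit (l - 1))" (is ?B)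
proof -
  define x where "x = real (k - l)"
  define y where "y = real (l - 1)"
  have k: "real k = x + y + 1" and l': "real l = y + 1" using l by (simp_all add: x_def y_def of_nat_diff)
  have "x \<ge> 0" by (simp add: x_def)
  then have sx: "s * (x + 1) = 1" by (simp add: s_def x_def)
  then have s1: "1 - s = x * s" by (simp add: algebra_simps)
  have le: "crit (k - l) \<le> crit k" "crit (l - 1) \<le> crit k" "crit l \<le> crit k"
    using l by (intro crit_mono; simp)+
  have P: "real (crit k) = (x + y + 1) * (x + y + 2)" "real (crit l) = (y + 1) * (y + 2)"
    "real (crit (k - l)) = x * (x + 1)" "real (crit (l - 1)) = y * (y + 1)"
    unfolding crit_def of_nat_mult of_nat_add of_nat_1 k l' x_def[symmetric] y_def[symmetric] by simp_all
  have "s * ((x + y + 1) * (x + y + 2) - x * (x + 1)) + x * s * (y * (y + 1)) = (s * (x + 1)) * ((y + 1) * (y + 2))"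
    by (simp add: algebra_simps)
  then show ?A
    unfolding of_nat_diff[OF le(1)] P s1 by (simp add: sx)
  have eq: "s * (x * (x + 1)) + x * s * ((x + y + 1) * (x + y + 2) - y * (y + 1)) = (s * (x + 1)) * (x * (x + 2
      * y + 3))"
    by (simp add: algebra_simps)
  then show ?B
    unfolding of_nat_diff[OF le(2)] of_nat_diff[OF le(3)] P s1 eq sx by (simp add: algebra_simps)
qed

lemma bilinear_bound_holder:
  assumes b1: "bilinear_bound p k (k - l) b a n B1" and b2: "bilinear_bound p k (l - 1) a b n B2" and B: "B1 >
      0" "B2 > 0"
    and l: "1 \<le> l" "l < k"
  defines "s \<equiv> 1 / real (k - l + 1)"
  shows "bilinear_bound p k l a b n (B1 powr s * B2 powr (1 - s))"
proof (rule bilinear_boundI)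
  fix \<Phi> M w S S' \<xi> \<eta> and U V :: real
  assume nondegenerate: "nondegenerate p k M \<Phi>" and M: "k * n \<le> M"
    and S: "finite S" "finite S'" "\<forall>x\<in>S. [x = \<xi>] (mod p ^ a)" "\<forall>x\<in>S'. [x = \<eta>] (mod p ^ b)" "\<not> [\<xi> = \<eta>] (mod p)"
    and UV: "0 < U" "0 < V" "scale_factor p k (n - a) * energy p n \<Phi> w (crit k) S \<le> U" "scale_factor p k (n - b)
        * energy p n \<Phi> w (crit k) S' \<le> V"
  let ?\<theta> = "\<lambda>l. real (crit l) / real (crit k)"
  have nc: "\<not> [\<eta> = \<xi>] (mod p)" using S(5) cong_sym by blast
  have lk: "crit l < crit k" "crit (k - l) \<le> crit k" "crit (l - 1) \<le> crit k"
    using crit_strict_mono[OF l(2)] l by (auto intro!: crit_mono)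
  have l0: "crit l > 0" using crit_ge_2[OF l(1)] by simp
  have P: "real (crit k) \<noteq> 0" using lk(1) by (metis of_nat_eq_0_iff not_less_zero)
  note e = holder_exponents[OF l, folded s_def]
  have th: "(1 - ?\<theta> (k - l)) * s + ?\<theta> (l - 1) * (1 - s) = ?\<theta> l"
  proof -
    have "(1 - ?\<theta> (k - l)) * s + ?\<theta> (l - 1) * (1 - s)
        = (s * (real (crit k) - real (crit (k - l))) + (1 - s) * real (crit (l - 1))) / real (crit k)"
      using P by (simp add: diff_divide_distrib add_divide_distrib left_diff_distrib right_diff_distrib mult.commute)
    also have "\<dots> = ?\<theta> l" using e(1) of_nat_diff[OF lk(2), where 'a = real] by simp
    finally show ?thesis .
  qed
  let ?A = "B1 * V powr ?\<theta> (k - l) * U powr (1 - ?\<theta> (k - l))"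
  let ?B = "B2 * U powr ?\<theta> (l - 1) * V powr (1 - ?\<theta> (l - 1))"
  have "avg \<Phi> (\<lambda>\<chi>. cmod (exp_sum w S \<chi>) ^ crit l * cmod (exp_sum w S' \<chi>) ^ (crit k - crit l))
      \<le> ?A powr s * ?B powr (1 - s)"
  proof (rule avg_holder[where F = "\<lambda>\<chi>. cmod (exp_sum w S' \<chi>) ^ crit (k - l) * cmod (exp_sum w S \<chi>) ^ (crit k -
      crit (k - l))"
        and G = "\<lambda>\<chi>. cmod (exp_sum w S \<chi>) ^ crit (l - 1) * cmod (exp_sum w S' \<chi>) ^ (crit k - crit (l - 1))"])
    show "finite \<Phi>" using nondegenerate by (simp add: nondegenerate_def phase_group_finite)
    show "0 \<le> s" "s \<le> 1" by (simp_all add: s_def)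
    show "avg \<Phi> (\<lambda>\<chi>. cmod (exp_sum w S' \<chi>) ^ crit (k - l) * cmod (exp_sum w S \<chi>) ^ (crit k - crit (k - l))) \<le> ?A"
      by (rule bilinear_boundD[OF b1 nondegenerate M S(2,1,4,3) nc UV(2,1,4,3)])
    show "avg \<Phi> (\<lambda>\<chi>. cmod (exp_sum w S \<chi>) ^ crit (l - 1) * cmod (exp_sum w S' \<chi>) ^ (crit k - crit (l - 1))) \<le> ?B"
      by (rule bilinear_boundD[OF b2 nondegenerate M S UV])
    fix \<chi>
    have "cmod (exp_sum w S \<chi>) ^ crit l * cmod (exp_sum w S' \<chi>) ^ (crit k - crit l)
      \<le> (cmod (exp_sum w S \<chi>) ^ (crit k - crit (k - l)) * cmod (exp_sum w S' \<chi>) ^ crit (k - l)) powr s *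
        (cmod (exp_sum w S \<chi>) ^ crit (l - 1) * cmod (exp_sum w S' \<chi>) ^ (crit k - crit (l - 1))) powr (1 - s)"
      by (rule power_interpolate[OF norm_ge_zero norm_ge_zero l0 e(1) _ e(2)]) (use lk in simp)
    then show "cmod (exp_sum w S \<chi>) ^ crit l * cmod (exp_sum w S' \<chi>) ^ (crit k - crit l)
      \<le> (cmod (exp_sum w S' \<chi>) ^ crit (k - l) * cmod (exp_sum w S \<chi>) ^ (crit k - crit (k - l))) powr s *
        (cmod (exp_sum w S \<chi>) ^ crit (l - 1) * cmod (exp_sum w S' \<chi>) ^ (crit k - crit (l - 1))) powr (1 - s)"
      by (simp only: mult.commute)
  qed (use B UV in simp_all)
  also have "\<dots> = B1 powr s * B2 powr (1 - s) * U powr ((1 - ?\<theta> (k - l)) * s + ?\<theta> (l - 1) * (1 - s)) *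
      V powr (?\<theta> (k - l) * s + (1 - ?\<theta> (l - 1)) * (1 - s))"
    using B UV by (simp only: powr_mult powr_powr powr_add mult_nonneg_nonneg less_imp_le powr_ge_zero ac_simps)
  also note th
  also have "?\<theta> (k - l) * s + (1 - ?\<theta> (l - 1)) * (1 - s) = 1 - ((1 - ?\<theta> (k - l)) * s + ?\<theta> (l - 1) * (1 - s))"
    by (simp add: algebra_simps)
  also note th
  finally show "avg \<Phi> (\<lambda>\<chi>. cmod (exp_sum w S \<chi>) ^ crit l * cmod (exp_sum w S' \<chi>) ^ (crit k - crit l))
      \<le> B1 powr s * B2 powr (1 - s) * U powr ?\<theta> l * V powr (1 - ?\<theta> l)" .
qed

text \<open>The coset representative \<open>\<chi>\<close> is absorbed into the coefficients, which
  is why decoupling is stated for arbitrary coefficients.\<close>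

lemma avg_stab:
  assumes \<Phi>: "phase_group \<Phi>" and S': "\<forall>x\<in>S'. x \<in> E" and \<eta>: "\<eta> \<in> E"
  shows "avg \<Phi> (\<lambda>\<chi>. cmod (exp_sum w A \<chi>) ^ P * cmod (exp_sum w S' \<chi>) ^ Q)
    = avg \<Phi> (\<lambda>\<chi>. cmod (exp_sum w S' \<chi>) ^ Q * moment (stab \<Phi> E) (\<lambda>x. w x * \<chi> x) P A)"
proof -
  let ?\<Psi> = "stab \<Phi> E"
  note \<Psi> = phase_group_stab[OF \<Phi>, of E]
  have "avg \<Phi> (\<lambda>\<chi>. cmod (exp_sum w A \<chi>) ^ P * cmod (exp_sum w S' \<chi>) ^ Q)
    = avg \<Phi> (\<lambda>\<chi>. avg ?\<Psi> (\<lambda>\<psi>. cmod (exp_sum w A (\<lambda>x. \<chi> x * \<psi> x)) ^ P * cmod (exp_sum w S' (\<lambda>x. \<chi> x * \<psi> x)) ^ Q))"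
    by (rule avg_subgroup[OF \<Phi> \<Psi> stab_subset])
  also have "\<dots> = avg \<Phi> (\<lambda>\<chi>. cmod (exp_sum w S' \<chi>) ^ Q * moment ?\<Psi> (\<lambda>x. w x * \<chi> x) P A)"
  proof (rule avg_cong)
    fix \<chi>
    have "cmod (exp_sum w A (\<lambda>x. \<chi> x * \<psi> x)) ^ P * cmod (exp_sum w S' (\<lambda>x. \<chi> x * \<psi> x)) ^ Q
        = cmod (exp_sum w S' \<chi>) ^ Q * cmod (exp_sum (\<lambda>x. w x * \<chi> x) A \<psi>) ^ P" if \<psi>: "\<psi> \<in> ?\<Psi>" for \<psi>
    proof -
      have "\<psi> x = \<psi> \<eta>" if "x \<in> S'" for x
        using \<psi> S' that \<eta> unfolding stab_def by blast
      then have "exp_sum w S' (\<lambda>x. \<chi> x * \<psi> x) = (\<Sum>x\<in>S'. \<psi> \<eta> * (w x * \<chi> x))"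
        unfolding exp_sum_def by (intro sum.cong) (simp_all add: ac_simps)
      then have "exp_sum w S' (\<lambda>x. \<chi> x * \<psi> x) = \<psi> \<eta> * exp_sum w S' \<chi>"
        by (simp add: exp_sum_def sum_distrib_left)
      moreover have "cmod (\<psi> \<eta>) = 1" by (rule phase_group_norm[OF \<Psi> \<psi>])
      ultimately have "cmod (exp_sum w S' (\<lambda>x. \<chi> x * \<psi> x)) = cmod (exp_sum w S' \<chi>)" by (simp add: norm_mult)
      moreover have "exp_sum w A (\<lambda>x. \<chi> x * \<psi> x) = exp_sum (\<lambda>x. w x * \<chi> x) A \<psi>"
        by (simp add: exp_sum_def mult.assoc)
      ultimately show ?thesis by (simp only: mult.commute)
    qed
    then have "avg ?\<Psi> (\<lambda>\<psi>. cmod (exp_sum w A (\<lambda>x. \<chi> x * \<psi> x)) ^ P * cmod (exp_sum w S' (\<lambda>x. \<chi> x * \<psi> x)) ^ Q)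
        = avg ?\<Psi> (\<lambda>\<psi>. cmod (exp_sum w S' \<chi>) ^ Q * cmod (exp_sum (\<lambda>x. w x * \<chi> x) A \<psi>) ^ P)"
      by (rule avg_cong)
    then show "avg ?\<Psi> (\<lambda>\<psi>. cmod (exp_sum w A (\<lambda>x. \<chi> x * \<psi> x)) ^ P * cmod (exp_sum w S' (\<lambda>x. \<chi> x * \<psi> x)) ^ Q)
        = cmod (exp_sum w S' \<chi>) ^ Q * moment ?\<Psi> (\<lambda>x. w x * \<chi> x) P A"
      by (simp only: avg_mult moment_def)
  qed
  finally show ?thesis .
qed

text \<open>The average over \<open>\<Phi>\<close> is first taken over cosets of the subgroup of phases that are constant on the class
  of \<open>S'\<close>.  On each coset the factor of \<open>S'\<close> has constant modulus, and the factor of \<open>S\<close> is an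
  exponential sum of degree \<open>l\<close>.\<close>

lemma bilinear_bound_decouple:
  assumes p: "prime p" "int k < p" and l: "1 \<le> l" "l < k" and a: "1 \<le> a"
    and decouples: "decouples p l n0 C" and C: "C \<ge> 0" and B: "B \<ge> 0" and bilinear_bound: "bilinear_bound p k l
        (a + n0) b n B"
    and le: "l * (a + n0) \<le> (k - l + 1) * b" "a + n0 \<le> n" "(k - l + 1) * b \<le> k * n"
  shows "bilinear_bound p k l a b n (2 * C * B)"
proof (rule bilinear_boundI)
  fix \<Phi> M w S S' \<xi> \<eta> and U V :: real
  assume nondegenerate: "nondegenerate p k M \<Phi>" and M: "k * n \<le> M"
    and S: "finite S" "\<forall>x\<in>S. [x = \<xi>] (mod p ^ a)" and S': "finite S'" "\<forall>x\<in>S'. [x = \<eta>] (mod p ^ b)"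
    and nc: "\<not> [\<xi> = \<eta>] (mod p)"
    and UV: "0 < U" "0 < V" "scale_factor p k (n - a) * energy p n \<Phi> w (crit k) S \<le> U" "scale_factor p k (n - b)
        * energy p n \<Phi> w (crit k) S' \<le> V"
  let ?P = "crit l" and ?Q = "crit k - crit l" and ?\<theta> = "real (crit l) / real (crit k)"
  let ?E = "{x. [x = \<eta>] (mod p ^ b)}"
  let ?\<Psi> = "stab \<Phi> ?E"
  let ?Pa = "residue_parts (p ^ (a + n0)) S"
  let ?N = "real_of_int p ^ n0"
  have p0: "p > 0" using p(1) by (simp add: prime_gt_0_int)
  have \<Phi>: "phase_group \<Phi>" using nondegenerate by (simp add: nondegenerate_def)
  have S'E: "\<forall>x\<in>S'. x \<in> ?E" using S'(2) by blast
  have \<eta>E: "\<eta> \<in> ?E" by simp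
  note stab = avg_stab[OF \<Phi> S'E \<eta>E, of w _ ?P ?Q]
  have lk: "crit l < crit k" using l(2) by (rule crit_strict_mono)
  have P: "real (crit k) > 0" using lk by (metis of_nat_0_less_iff not_less_zero neq0_conv)
  have goodl: "nondegenerate p l (Suc (k - l) * b - l * a) (pull ?\<Psi> (\<lambda>z. \<xi> + p ^ a * z))"
  proof (rule nondegenerate_lower[OF nondegenerate p nc _ a])
    have "l * a \<le> l * (a + n0)" by simp
    also have "\<dots> \<le> Suc (k - l) * b" using le(1) by simp
    finally show "l * a \<le> Suc (k - l) * b" .
    show "Suc (k - l) * b \<le> M" using le(3) M by simp
  qed (use l in simp)
  have Ml: "l * n0 \<le> Suc (k - l) * b - l * a" using le(1) by (simp add: distrib_left)
  have "avg \<Phi> (\<lambda>\<chi>. cmod (exp_sum w S \<chi>) ^ ?P * cmod (exp_sum w S' \<chi>) ^ ?Q)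
      = avg \<Phi> (\<lambda>\<chi>. cmod (exp_sum w S' \<chi>) ^ ?Q * moment ?\<Psi> (\<lambda>x. w x * \<chi> x) ?P S)"
    by (rule stab)
  also have "\<dots> \<le> avg \<Phi> (\<lambda>\<chi>. C * scale_factor p l n0 * (\<Sum>A\<in>?Pa. cmod (exp_sum w S' \<chi>) ^ ?Q * moment ?\<Psi> (\<lambda>x. w x *
      \<chi> x) ?P A))"
  proof (rule avg_mono)
    fix \<chi>
    have "moment ?\<Psi> (\<lambda>x. w x * \<chi> x) ?P S \<le> C * scale_factor p l n0 * energy p (a + n0) ?\<Psi> (\<lambda>x. w x * \<chi> x) ?P S"
      by (rule decouples_rescaled[OF decouples p0 phase_group_stab[OF \<Phi>] goodl Ml S])
    then have "cmod (exp_sum w S' \<chi>) ^ ?Q * moment ?\<Psi> (\<lambda>x. w x * \<chi> x) ?P S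
      \<le> cmod (exp_sum w S' \<chi>) ^ ?Q * (C * scale_factor p l n0 * energy p (a + n0) ?\<Psi> (\<lambda>x. w x * \<chi> x) ?P S)"
      by (rule mult_left_mono) simp
    then show "cmod (exp_sum w S' \<chi>) ^ ?Q * moment ?\<Psi> (\<lambda>x. w x * \<chi> x) ?P S
      \<le> C * scale_factor p l n0 * (\<Sum>A\<in>?Pa. cmod (exp_sum w S' \<chi>) ^ ?Q * moment ?\<Psi> (\<lambda>x. w x * \<chi> x) ?P A)"
      by (simp only: energy_def sum_distrib_left mult.left_commute mult.assoc)
  qed
  also have "\<dots> = C * scale_factor p l n0 * (\<Sum>A\<in>?Pa. avg \<Phi> (\<lambda>\<chi>. cmod (exp_sum w A \<chi>) ^ ?P * cmod (exp_sum w S' \<chi>)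
      ^ ?Q))"
    by (simp only: avg_mult avg_sum stab)
  also have "\<dots> \<le> C * scale_factor p l n0 * (2 * B * (U powr ?\<theta> / scale_factor p l n0) * V powr (1 - ?\<theta>))"
  proof (rule mult_left_mono)
    \<comment> \<open>The even share of U among N parts. Adding it to each part's bound keeps the
      bound positive and at most doubles the total, whence the factor 2. For u >= \<alpha> and
      exponent at most 1, u^\<theta> <= \<alpha>^\<theta> (u/\<alpha>), which takes the place of
      concavity when the parts are summed.\<close>
    define \<alpha> where "\<alpha> = U / (scale_factor p k n0 * ?N)"
    have pos: "scale_factor p k n0 > 0" "?N > 0" "scale_factor p l n0 > 0" "scale_factor p k (n - (a + n0)) > 0"
        using p0 scale_factor_pos by simp_all
    have \<alpha>: "\<alpha> > 0" using UV pos by (simp add: \<alpha>_def)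
    define u where "u A = scale_factor p k (n - (a + n0)) * energy p n \<Phi> w (crit k) A + \<alpha>" for A
    have u: "u A \<ge> \<alpha>" for A
      using pos energy_nonneg[of p n \<Phi> w "crit k" A] by (simp add: u_def)
    have each: "avg \<Phi> (\<lambda>\<chi>. cmod (exp_sum w A \<chi>) ^ ?P * cmod (exp_sum w S' \<chi>) ^ ?Q)
        \<le> B * (\<alpha> powr ?\<theta> * (u A / \<alpha>)) * V powr (1 - ?\<theta>)" if A: "A \<in> ?Pa" for A
    proof -
      obtain x where x: "x \<in> A" using residue_parts_nonempty[OF A] by blast
      have "[x = \<xi>] (mod p ^ a)" using x S(2) residue_parts_subset[OF A] by blast
      then have "[x = \<xi>] (mod p)" using a by (metis cong_dvd_modulus dvd_power zero_less_one less_le_trans)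
      then have nx: "\<not> [x = \<eta>] (mod p)" using nc cong_trans cong_sym by blast
      have "avg \<Phi> (\<lambda>\<chi>. cmod (exp_sum w A \<chi>) ^ ?P * cmod (exp_sum w S' \<chi>) ^ ?Q) \<le> B * u A powr ?\<theta> * V powr (1 - ?\<theta>)"
      proof (rule bilinear_boundD[OF bilinear_bound nondegenerate M _ S'(1) _ S'(2) nx _ UV(2) _ UV(4)])
        show "finite A" using residue_parts_subset[OF A] S(1) by (rule finite_subset)
        show "\<forall>y\<in>A. [y = x] (mod p ^ (a + n0))" using residue_parts_cong[OF A _ x] by blast
        show "0 < u A" using u[of A] \<alpha> by simp
        show "scale_factor p k (n - (a + n0)) * energy p n \<Phi> w (crit k) A \<le> u A" using \<alpha> by (simp add: u_def)
      qed
      also have "u A powr ?\<theta> = \<alpha> powr ?\<theta> * (u A / \<alpha>) powr ?\<theta>"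
        using u[of A] \<alpha> by (simp add: powr_divide)
      also have "B * (\<alpha> powr ?\<theta> * (u A / \<alpha>) powr ?\<theta>) * V powr (1 - ?\<theta>)
          \<le> B * (\<alpha> powr ?\<theta> * (u A / \<alpha>)) * V powr (1 - ?\<theta>)"
      proof -
        have "1 \<le> u A / \<alpha>" using u[of A] \<alpha> by simp
        moreover have "?\<theta> \<le> 1" using lk P by (simp add: divide_le_eq_1)
        ultimately have "(u A / \<alpha>) powr ?\<theta> \<le> (u A / \<alpha>) powr 1" by (intro powr_mono) 
        then have "(u A / \<alpha>) powr ?\<theta> \<le> u A / \<alpha>" using \<open>1 \<le> u A / \<alpha>\<close> by simp
        then show ?thesis using B by (intro mult_right_mono mult_left_mono) auto
      qed
      finally show ?thesis .
    qed
    have sum_u: "(\<Sum>A\<in>?Pa. u A) \<le> 2 * ?N * \<alpha>"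
    proof -
      have "(\<Sum>A\<in>?Pa. u A) = scale_factor p k (n - (a + n0)) * (\<Sum>A\<in>?Pa. energy p n \<Phi> w (crit k) A) + real (card
          ?Pa) * \<alpha>"
        by (simp add: u_def sum.distrib sum_distrib_left)
      also have "(\<Sum>A\<in>?Pa. energy p n \<Phi> w (crit k) A) = energy p n \<Phi> w (crit k) S"
        by (rule energy_residue_parts[OF S(1) le(2)])
      also have "scale_factor p k (n - (a + n0)) * energy p n \<Phi> w (crit k) S \<le> ?N * \<alpha>"
      proof -
        have "n - a = n0 + (n - (a + n0))" using le(2) by simp
        then have "scale_factor p k (n - a) = scale_factor p k n0 * scale_factor p k (n - (a + n0))" using
            scale_factor_add[OF p0] by metis
        then have "scale_factor p k n0 * (scale_factor p k (n - (a + n0)) * energy p n \<Phi> w (crit k) S) \<le> U"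
          using UV(3) by (simp only: mult.assoc)
        then have "scale_factor p k (n - (a + n0)) * energy p n \<Phi> w (crit k) S \<le> U / scale_factor p k n0"
          using pos by (simp only: pos_le_divide_eq mult.commute)
        also have "U / scale_factor p k n0 = ?N * \<alpha>" using pos p0 by (simp add: \<alpha>_def)
        finally show ?thesis .
      qed
      also have "real (card ?Pa) * \<alpha> \<le> ?N * \<alpha>"
        using card_residue_parts_class[OF p0 S, of n0] \<alpha> by (intro mult_right_mono) auto
      finally show ?thesis by (simp add: ac_simps)
    qed
    have "(\<Sum>A\<in>?Pa. avg \<Phi> (\<lambda>\<chi>. cmod (exp_sum w A \<chi>) ^ ?P * cmod (exp_sum w S' \<chi>) ^ ?Q))
        \<le> (\<Sum>A\<in>?Pa. B * (\<alpha> powr ?\<theta> * (u A / \<alpha>)) * V powr (1 - ?\<theta>))"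
      by (intro sum_mono each)
    also have "\<dots> = (B * \<alpha> powr ?\<theta> * V powr (1 - ?\<theta>) / \<alpha>) * (\<Sum>A\<in>?Pa. u A)"
      unfolding sum_distrib_left by (intro sum.cong refl) (simp add: ac_simps)
    also have "\<dots> \<le> (B * \<alpha> powr ?\<theta> * V powr (1 - ?\<theta>) / \<alpha>) * (2 * ?N * \<alpha>)"
      using B \<alpha> by (intro mult_left_mono sum_u) auto
    also have "\<dots> = 2 * B * (\<alpha> powr ?\<theta> * ?N) * V powr (1 - ?\<theta>)"
      using \<alpha> by simp
    \<comment> \<open>Since \<theta> = crit l / crit k, the power p^(n0 crit k / 2) becomes p^(n0
      crit l / 2). The scale factor lost in degree l is thus regained exactly, and only C is
      paid.\<close>
    also have "\<alpha> powr ?\<theta> * ?N = U powr ?\<theta> / scale_factor p l n0"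
    proof -
      let ?r = "real_of_int p"
      have r: "?r > 0" using p0 by simp
      have "scale_factor p k n0 * ?N = ?r powr (real n0 * (real (crit k) / 2))"
        using r by (simp add: scale_factor_def powr_realpow[symmetric] powr_add[symmetric] right_diff_distrib)
      then have "\<alpha> powr ?\<theta> = U powr ?\<theta> / ?r powr (real n0 * (real (crit k) / 2) * ?\<theta>)"
        using UV by (simp add: \<alpha>_def powr_divide powr_powr)
      also have "real n0 * (real (crit k) / 2) * ?\<theta> = real n0 * (real (crit l) / 2)"
        using P by (simp)
      also have "?r powr (real n0 * (real (crit l) / 2)) = scale_factor p l n0 * ?N"
        using r by (simp add: scale_factor_def powr_realpow[symmetric] powr_add[symmetric] right_diff_distrib)
      finally show ?thesis using pos p0 by simp
    qed
    finally show "(\<Sum>A\<in>?Pa. avg \<Phi> (\<lambda>\<chi>. cmod (exp_sum w A \<chi>) ^ ?P * cmod (exp_sum w S' \<chi>) ^ ?Q))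
        \<le> 2 * B * (U powr ?\<theta> / scale_factor p l n0) * V powr (1 - ?\<theta>)" .
  qed (use C scale_factor_pos[OF p0, of l n0] in simp)
  also have "\<dots> = 2 * C * B * U powr ?\<theta> * V powr (1 - ?\<theta>)"
    using scale_factor_pos[OF p0, of l n0] by simp
  finally show "avg \<Phi> (\<lambda>\<chi>. cmod (exp_sum w S \<chi>) ^ ?P * cmod (exp_sum w S' \<chi>) ^ ?Q) \<le> 2 * C * B * U powr ?\<theta> * V
      powr (1 - ?\<theta>)" .
qed

section \<open>Iteration\<close>

lemma bilinear_bound_mono:
  assumes "bilinear_bound p k l a b n B" "B \<le> B'"
  shows "bilinear_bound p k l a b n B'"
proof (rule bilinear_boundI)
  fix \<Phi> M w S S' \<xi> \<eta> and U V :: real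
  assume a: "nondegenerate p k M \<Phi>" "k * n \<le> M" "finite S" "finite S'" "\<forall>x\<in>S. [x = \<xi>] (mod p ^ a)" "\<forall>x\<in>S'. [x =
      \<eta>] (mod p ^ b)"
    "\<not> [\<xi> = \<eta>] (mod p)" "0 < U" "0 < V" "scale_factor p k (n - a) * energy p n \<Phi> w (crit k) S \<le> U" "scale_factor
        p k (n - b) * energy p n \<Phi> w (crit k) S' \<le> V"
  have "B * U powr (real (crit l) / real (crit k)) * V powr (1 - real (crit l) / real (crit k))
      \<le> B' * U powr (real (crit l) / real (crit k)) * V powr (1 - real (crit l) / real (crit k))"
    using assms(2) by (intro mult_right_mono) auto
  with bilinear_boundD[OF assms(1) a] show "avg \<Phi> (\<lambda>\<chi>. cmod (exp_sum w S \<chi>) ^ crit l * cmod (exp_sum w S' \<chi>) ^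
      (crit k - crit l))
       \<le> B' * U powr (real (crit l) / real (crit k)) * V powr (1 - real (crit l) / real (crit k))"
    by (rule order_trans)
qed

definition decoupling_exp :: "int \<Rightarrow> nat \<Rightarrow> real \<Rightarrow> bool" where
  "decoupling_exp p k \<eta> \<longleftrightarrow> (\<exists>K>0. \<forall>n. decouples p k n (K * real_of_int p powr (\<eta> * real n)))"

text \<open>\<open>gain k \<eta> t l\<close> is the saving per unit of \<open>b\<close> over the exponent \<open>\<eta>\<close> after \<open>t\<close> rounds of lower degree
  decoupling followed by Hoelder's inequality.\<close>

fun gain :: "nat \<Rightarrow> real \<Rightarrow> nat \<Rightarrow> nat \<Rightarrow> real" where
  "gain k \<eta> 0 l = (if l = 0 then \<eta> else 0)"
| "gain k \<eta> (Suc t) l = (if l = 0 then \<eta> else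
     gain k \<eta> t (k - l) / real l + real (k - l) / real (k - l + 1) * gain k \<eta> t (l - 1))"

fun start_scale :: "nat \<Rightarrow> nat \<Rightarrow> nat" where
  "start_scale k 0 = k"
| "start_scale k (Suc t) = k * start_scale k t + k"

lemma start_scale_ge: "k \<le> start_scale k t"
  by (cases t) auto

lemma start_scale_mono: "1 \<le> k \<Longrightarrow> start_scale k t \<le> start_scale k (Suc t)"
  by (simp add: trans_le_add1)

lemma gain_0: "gain k \<eta> t 0 = \<eta>"
  by (cases t) auto

lemma gain_nonneg: "0 \<le> \<eta> \<Longrightarrow> 0 \<le> gain k \<eta> t l"
  by (induction t arbitrary: l) auto

text \<open>The recursion preserves the sum over \<open>l\<close> except that each round adds \<open>\<eta> * (k - 1) / k\<close>, the
  contribution of \<open>l = 0\<close>.\<close>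

lemma sum_gain:
  assumes k: "k \<ge> 2"
  shows "(\<Sum>l=1..k-1. gain k \<eta> t l) = real t * \<eta> * (real k - 1) / real k"
proof (induction t)
  case (Suc t)
  let ?g = "gain k \<eta> t"
  have "(\<Sum>l=1..k-1. gain k \<eta> (Suc t) l)
      = (\<Sum>l=1..k-1. ?g (k - l) / real l) + (\<Sum>l=1..k-1. real (k - l) / real (k - l + 1) * ?g (l - 1))"
    by (subst sum.distrib[symmetric], rule sum.cong) auto
  also have "(\<Sum>l=1..k-1. ?g (k - l) / real l) = (\<Sum>j=1..k-1. ?g j / real (k - j))"
    by (rule sum.reindex_bij_witness[of _ "\<lambda>j. k - j" "\<lambda>j. k - j"]) auto
  also have "(\<Sum>l=1..k-1. real (k - l) / real (k - l + 1) * ?g (l - 1)) = (\<Sum>j=0..k-2. real (k - j - 1) / real (k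
      - j) * ?g j)"
    by (rule sum.reindex_bij_witness[of _ "\<lambda>j. Suc j" "\<lambda>j. j - 1"]) (use k in \<open>auto simp: Suc_diff_le\<close>)
  also have "\<dots> = (\<Sum>j=0..k-1. real (k - j - 1) / real (k - j) * ?g j)"
    using k by (intro sum.mono_neutral_left) auto
  also have "\<dots> = real (k - 1) / real k * \<eta> + (\<Sum>j=1..k-1. real (k - j - 1) / real (k - j) * ?g j)"
    using k by (subst sum.atLeast_Suc_atMost) (auto simp: gain_0)
  also have "(\<Sum>j=1..k-1. ?g j / real (k - j)) + (real (k - 1) / real k * \<eta> + (\<Sum>j=1..k-1. real (k - j - 1) / real
      (k - j) * ?g j))
      = real (k - 1) / real k * \<eta> + (\<Sum>j=1..k-1. ?g j / real (k - j) + real (k - j - 1) / real (k - j) * ?g j)"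
    by (simp add: sum.distrib)
  also have "(\<Sum>j=1..k-1. ?g j / real (k - j) + real (k - j - 1) / real (k - j) * ?g j) = (\<Sum>j=1..k-1. ?g j)"
  proof (rule sum.cong[OF refl])
    fix j assume "j \<in> {1..k-1}"
    have gen: "x / d + (d - 1) / d * x = x" if "d \<noteq> 0" for d x :: real
      using that by (simp add: field_simps)
    from \<open>j \<in> {1..k-1}\<close> have j: "real (k - j) \<noteq> 0" "real (k - j - 1) = real (k - j) - 1" by auto
    show "?g j / real (k - j) + real (k - j - 1) / real (k - j) * ?g j = ?g j"
      unfolding j(2) using gen[OF j(1)] .
  qed
  also have "\<dots> = real t * \<eta> * (real k - 1) / real k" by (rule Suc.IH)
  also have "real (k - 1) / real k * \<eta> + real t * \<eta> * (real k - 1) / real k = real (Suc t) * \<eta> * (real k - 1) /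
      real k"
    using k by (simp add: of_nat_diff field_simps)
  finally show ?case .
qed simp

lemma ex_large_gain:
  assumes k: "k \<ge> 2" and \<eta>: "\<eta> \<ge> 0"
  obtains l where "1 \<le> l" "l < k" "real t * \<eta> / real k \<le> gain k \<eta> t l"
proof -
  have "\<exists>l\<in>{1..k-1}. real t * \<eta> / real k \<le> gain k \<eta> t l"
  proof (rule ccontr)
    assume "\<not> ?thesis"
    then have "(\<Sum>l=1..k-1. gain k \<eta> t l) < (\<Sum>l=1..k-1. real t * \<eta> / real k)"
      using k by (intro sum_strict_mono) (auto simp: not_le)
    also have "\<dots> = real t * \<eta> * (real k - 1) / real k"
      using k by (simp add: of_nat_diff)
    finally show False using sum_gain[OF k, of \<eta> t] by simp
  qed
  then show ?thesis using that k by fastforce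
qed

text \<open>The admissibility condition survives the exchange of roles: (l+1)(m+1) = lm + k + 1, and
  the slack (k+1) b absorbs the loss from rounding a' down once b >= k.\<close>

lemma ratio_step:
  fixes k l m b a' :: nat
  assumes ml: "m + l = k" and l: "l \<ge> 1" and b: "k \<le> b" and a': "a' = (Suc m * b) div l"
  shows "m * b \<le> Suc l * a'"
proof -
  have "Suc m * b < l * a' + l"
    unfolding a' using dividend_less_times_div[of l "Suc m * b"] l by simp
  then have "Suc m * b + 1 \<le> l * a' + l" by simp
  then have "Suc l * (Suc m * b + 1) \<le> Suc l * (l * a' + l)" by (rule mult_le_mono2)
  moreover have "Suc l * (Suc m * b + 1) = l * (m * b) + (Suc k) * b + Suc l"
    by (simp add: ml[symmetric] algebra_simps)
  moreover have "Suc l * l \<le> Suc k * b"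
    using ml b by (intro mult_le_mono) auto
  ultimately have "l * (m * b) \<le> l * (Suc l * a')" by (simp add: algebra_simps)
  then show ?thesis using l by simp
qed

text \<open>The condition on l a leaves room to refine a, \<open>start_scale\<close> absorbs
  rounding, and k^(t+1) b <= n keeps the scales, which grow by at most a factor k per round, below
  n. Each round pays \<epsilon> n for decoupling in degree l.\<close>

lemma bilinear_bound_iterate:
  assumes p: "prime p" "int k < p" and k: "k \<ge> 2" and \<eta>: "\<eta> \<ge> 0" "decoupling_exp p k \<eta>"
    and \<epsilon>: "\<epsilon> \<ge> 0" "\<And>l. 1 \<le> l \<Longrightarrow> l < k \<Longrightarrow> decoupling_exp p l \<epsilon>" and l: "l < k"
  shows "\<exists>K>0. \<forall>a b n. 1 \<le> a \<longrightarrow> start_scale k t \<le> b \<longrightarrow> l * a \<le> (k - l + 1) * b \<longrightarrow> k ^ Suc t * b \<le> n \<longrightarrow>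
    bilinear_bound p k l a b n (K * real_of_int p powr ((\<eta> + real t * \<epsilon>) * real n - gain k \<eta> t l * real b))"
  using l
proof (induction t arbitrary: l)
  case 0
  let ?r = "real_of_int p"
  have p0: "p > 0" and r: "?r > 1" using p(1) by (simp_all add: prime_gt_0_int prime_gt_1_int)
  obtain K where K: "K > 0" "\<And>n. decouples p k n (K * ?r powr (\<eta> * real n))"
    using \<eta>(2) unfolding decoupling_exp_def by blast
  have "bilinear_bound p k l a b n (K * ?r powr ((\<eta> + real 0 * \<epsilon>) * real n - gain k \<eta> 0 l * real b))"
    if a: "1 \<le> a" "l * a \<le> (k - l + 1) * b" "k ^ Suc 0 * b \<le> n" for a b n
  proof -
    have kb: "b \<le> k * b" using k by simp
    have bn: "b \<le> n" by (rule le_trans[OF kb]) (use a(3) in simp)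
    show ?thesis
    proof (cases "l = 0")
      case True
      have "bilinear_bound p k 0 a b n (K * ?r powr (\<eta> * real (n - b)))"
        using K by (intro bilinear_bound_0 p0 bn) auto
      then show ?thesis using bn by (simp add: True of_nat_diff right_diff_distrib)
    next
      case False
      have "a \<le> l * a" using False by simp
      also have "\<dots> \<le> (k - l + 1) * b" by (rule a(2))
      also have "\<dots> \<le> k * b" using False 0 by (intro mult_le_mono1) simp
      also have "\<dots> \<le> n" using a(3) by simp
      finally have an: "a \<le> n" .
      have mono: "decouples p k (n - c) (K * ?r powr (\<eta> * real n))" for c
        by (rule decouples_mono[OF K(2) _ p0]) (use r K \<eta> in \<open>auto intro!: mult_left_mono powr_mono\<close>)
      have "bilinear_bound p k l a b n (K * ?r powr (\<eta> * real n))"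
        using False 0 K p0 by (intro bilinear_bound_trivial mono an bn) auto
      then show ?thesis using False by simp
    qed
  qed
  then show ?case using K(1) by blast
next
  case (Suc t)
  let ?r = "real_of_int p"
  have p0: "p > 0" and r: "?r > 1" using p(1) by (simp_all add: prime_gt_0_int prime_gt_1_int)
  show ?case
  proof (cases "l = 0")
    case True
    obtain K where K: "K > 0" "\<And>n. decouples p k n (K * ?r powr (\<eta> * real n))"
      using \<eta>(2) unfolding decoupling_exp_def by blast
    have "bilinear_bound p k l a b n (K * ?r powr ((\<eta> + real (Suc t) * \<epsilon>) * real n - gain k \<eta> (Suc t) l * real b))"
      if a: "k ^ Suc (Suc t) * b \<le> n" for a b n
    proof -
      have "1 * b \<le> k ^ Suc (Suc t) * b" using k by (intro mult_le_mono) auto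
      also note a
      finally have bn: "b \<le> n" by simp
      have "bilinear_bound p k 0 a b n (K * ?r powr (\<eta> * real (n - b)))"
        using K by (intro bilinear_bound_0 p0 bn) auto
      moreover have "\<eta> * real (n - b) \<le> (\<eta> + real (Suc t) * \<epsilon>) * real n - \<eta> * real b"
        using bn \<epsilon>(1) by (simp add: of_nat_diff algebra_simps)
      then have "K * ?r powr (\<eta> * real (n - b)) \<le> K * ?r powr ((\<eta> + real (Suc t) * \<epsilon>) * real n - gain k \<eta> (Suc
          t) l * real b)"
        using r K(1) True by (simp only: gain_0 True) (intro mult_left_mono powr_mono, auto)
      ultimately show ?thesis unfolding True by (rule bilinear_bound_mono)
    qed
    then show ?thesis using K(1) by blast
  next
    case False
    then have l: "1 \<le> l" "l < k" using Suc.prems by auto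
    define m where "m = k - l"
    have ml: "m + l = k" "m < k" "l - 1 < k" using l by (auto simp: m_def)
    let ?g = "gain k \<eta> t"
    let ?e = "\<lambda>n. (\<eta> + real t * \<epsilon>) * real n"
    obtain K1 where K1: "K1 > 0" "\<And>a b n. 1 \<le> a \<Longrightarrow> start_scale k t \<le> b \<Longrightarrow> m * a \<le> (k - m + 1) * b \<Longrightarrow> k ^ Suc t * b \<le> n \<Longrightarrow>
        bilinear_bound p k m a b n (K1 * ?r powr (?e n - ?g m * real b))"
      using Suc.IH[OF ml(2)] by blast
    obtain K2 where K2: "K2 > 0" "\<And>a b n. 1 \<le> a \<Longrightarrow> start_scale k t \<le> b \<Longrightarrow> (l - 1) * a \<le> (k - (l - 1) + 1) * b \<Longrightarrow> k
        ^ Suc t * b \<le> n \<Longrightarrow>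
        bilinear_bound p k (l - 1) a b n (K2 * ?r powr (?e n - ?g (l - 1) * real b))"
      using Suc.IH[OF ml(3)] by blast
    obtain K3 where K3: "K3 > 0" "\<And>n. decouples p l n (K3 * ?r powr (\<epsilon> * real n))"
      using \<epsilon>(2)[OF l] unfolding decoupling_exp_def by blast
    define s where "s = 1 / real (k - l + 1)"
    have s: "0 < s" "s \<le> 1" by (auto simp: s_def)
    define K where "K = 2 * K3 * (K1 powr s * K2 powr (1 - s) * ?r powr ?g m)"
    have "K > 0" using K1 K2 K3 r by (simp add: K_def)
    moreover have "bilinear_bound p k l a b n (K * ?r powr ((\<eta> + real (Suc t) * \<epsilon>) * real n - gain k \<eta> (Suc t) l
        * real b))"
      if a: "1 \<le> a" and b: "start_scale k (Suc t) \<le> b" and la: "l * a \<le> (k - l + 1) * b" and n: "k ^ Suc (Suc t)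
          * b \<le> n" for a b n
    proof -
      \<comment> \<open>The largest scale that lower degree decoupling permits. With s = 1/(m+1), a
        saving per unit of a' counts with weight about 1/l per unit of b, as in
        \<open>gain\<close>.\<close>
      define a' where "a' = (Suc m * b) div l"
      have la': "l * a' \<le> Suc m * b" by (simp only: a'_def times_div_less_eq_dividend)
      have la'2: "Suc m * b < l * a' + l"
        unfolding a'_def using dividend_less_times_div[of l "Suc m * b"] l by simp
      have aa': "a \<le> a'" 
        unfolding a'_def using la l by (simp add: m_def less_eq_div_iff_mult_less_eq mult.commute)
      have kb: "k \<le> b" using b start_scale_ge[of k "Suc t"] by simp
      have b1: "1 \<le> b" using kb k by simp
      have "a' \<le> l * a'" using l by simp
      also have "\<dots> \<le> Suc m * b" by (rule la')
      also have "\<dots> \<le> k * b" using ml l by (intro mult_le_mono1) simp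
      finally have a'kb: "a' \<le> k * b" .
      have "k ^ Suc t * a' \<le> k ^ Suc t * (k * b)" using a'kb by (rule mult_le_mono2)
      also have "\<dots> = k ^ Suc (Suc t) * b" by (simp add: ac_simps)
      also note n
      finally have n1: "k ^ Suc t * a' \<le> n" .
      have "1 * a' \<le> k ^ Suc t * a'" using k by (intro mult_le_mono) auto
      also note n1
      finally have a'n: "a' \<le> n" by simp
      have "k ^ Suc t * b \<le> k ^ Suc (Suc t) * b" using k by (intro mult_le_mono power_increasing) auto
      also note n
      finally have n2: "k ^ Suc t * b \<le> n" .
      have "1 * b \<le> k ^ Suc t * b" using k by (intro mult_le_mono) auto
      also note n2
      finally have bn: "b \<le> n" by simp
      have "l * start_scale k t \<le> k * start_scale k t" using l by (intro mult_le_mono) auto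
      also have "\<dots> \<le> b" using b by simp
      also have "\<dots> \<le> Suc m * b" by simp
      finally have thr1: "start_scale k t \<le> a'"
        unfolding a'_def using l by (simp add: less_eq_div_iff_mult_less_eq mult.commute)
      have thr2: "start_scale k t \<le> b" using b start_scale_mono[of k t] k by simp
      have m1: "m * b \<le> (k - m + 1) * a'"
        using ratio_step[OF ml(1) l(1) kb a'_def] ml by auto
      have "(l - 1) * a' \<le> l * a'" by simp
      also have "\<dots> \<le> (k - (l - 1) + 1) * b"
        using la' l by (rule_tac order_trans[OF la']) (auto simp: m_def intro!: mult_le_mono)
      finally have m2: "(l - 1) * a' \<le> (k - (l - 1) + 1) * b" .
      have "bilinear_bound p k (k - l) b a' n (K1 * ?r powr (?e n - ?g m * real a'))"
        using K1(2)[OF b1 thr1 m1 n1] by (simp add: m_def)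
      moreover have "bilinear_bound p k (l - 1) a' b n (K2 * ?r powr (?e n - ?g (l - 1) * real b))"
        using a aa' by (intro K2(2) thr2 m2 n2) auto
      ultimately have B: "bilinear_bound p k l a' b n ((K1 * ?r powr (?e n - ?g m * real a')) powr s * (K2 * ?r
          powr (?e n - ?g (l - 1) * real b)) powr (1 - s))"
        unfolding s_def using K1 K2 r by (intro bilinear_bound_holder l) auto
      let ?B = "(K1 powr s * K2 powr (1 - s) * ?r powr ?g m) * ?r powr (?e n - gain k \<eta> (Suc t) l * real b)"
      have "(K1 * ?r powr (?e n - ?g m * real a')) powr s * (K2 * ?r powr (?e n - ?g (l - 1) * real b)) powr (1 - s)
        = K1 powr s * K2 powr (1 - s) * ?r powr ((?e n - ?g m * real a') * s + (?e n - ?g (l - 1) * real b) * (1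
            - s))"
        using K1 K2 r by (simp only: powr_mult powr_powr powr_add less_imp_le powr_ge_zero ac_simps)
      also have "\<dots> \<le> K1 powr s * K2 powr (1 - s) * ?r powr (?g m + (?e n - gain k \<eta> (Suc t) l * real b))"
      proof (intro mult_left_mono powr_mono)
        \<comment> \<open>Rounding a' down costs at most \<open>?g m\<close> in the exponent; this
          is the factor \<open>?r powr ?g m\<close> in \<open>K\<close>.\<close>
        have "real (Suc m * b) \<le> real (l * a' + l)" using la'2 by (intro of_nat_mono) simp
        then have "real (Suc m) * real b \<le> real l * (real a' + 1)" by (simp add: algebra_simps)
        then have "real b / real l \<le> s * (real a' + 1)"
          using l by (simp add: s_def m_def[symmetric] field_simps)
        then have "?g m * (real b / real l) \<le> ?g m * (s * (real a' + 1))"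
          using gain_nonneg[OF \<eta>(1)] by (rule mult_left_mono)
        moreover have "?g m * s \<le> ?g m * 1" using s gain_nonneg[OF \<eta>(1)] by (intro mult_left_mono) auto
        ultimately have gm: "?g m * real b / real l \<le> ?g m * real a' * s + ?g m" by (simp add: algebra_simps)
        have s1: "1 - s = real (k - l) / real (k - l + 1)" by (simp add: s_def field_simps)
        have "gain k \<eta> (Suc t) l * real b = ?g m * real b / real l + ?g (l - 1) * real b * (1 - s)"
          unfolding s1 using l by (simp add: m_def algebra_simps)
        then show "(?e n - ?g m * real a') * s + (?e n - ?g (l - 1) * real b) * (1 - s)
            \<le> ?g m + (?e n - gain k \<eta> (Suc t) l * real b)"
          using gm by (simp add: algebra_simps)
      qed (use r in auto)
      also have "\<dots> = ?B" by (simp add: powr_add)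
      finally have B': "bilinear_bound p k l a' b n ?B" using B by (rule bilinear_bound_mono[rotated])
      have aa: "a + (a' - a) = a'" using aa' by simp
      have D: "decouples p l (a' - a) (K3 * ?r powr (\<epsilon> * real n))"
        by (rule decouples_mono[OF K3(2) _ p0]) (use r K3 \<epsilon> a'n in \<open>auto intro!: mult_left_mono powr_mono\<close>)
      have "bilinear_bound p k l a b n (2 * (K3 * ?r powr (\<epsilon> * real n)) * ?B)"
      proof (rule bilinear_bound_decouple[OF p l a D, unfolded aa])
        show "bilinear_bound p k l a' b n ?B" by (rule B')
        show "l * a' \<le> (k - l + 1) * b" using la' by (simp add: m_def)
        show "a' \<le> n" by (rule a'n)
        have "k - l + 1 \<le> k" using l by simp
        then show "(k - l + 1) * b \<le> k * n" using bn by (rule mult_le_mono)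
      qed (use K1 K2 K3 in simp_all)
      also have "2 * (K3 * ?r powr (\<epsilon> * real n)) * ?B
          = K * (?r powr (\<epsilon> * real n) * ?r powr (?e n - gain k \<eta> (Suc t) l * real b))"
        by (simp add: K_def)
      also have "?r powr (\<epsilon> * real n) * ?r powr (?e n - gain k \<eta> (Suc t) l * real b)
          = ?r powr ((\<eta> + real (Suc t) * \<epsilon>) * real n - gain k \<eta> (Suc t) l * real b)"
        by (simp add: powr_add[symmetric] algebra_simps)
      finally show ?thesis .
    qed
    ultimately show ?thesis by blast
  qed
qed

text \<open>Let i0 be the index of the largest term. If the sum exceeds 2 |z_i0|, the other terms
  make up more than half of it, so one of them, among at most N, is at least 1/(2N) of the sum. The
  same then holds for z_i0, and the pair is bounded with any powers c and d.\<close>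

lemma broad_narrow:
  fixes z :: "'b \<Rightarrow> 'a::real_normed_vector"
  assumes I: "finite I" "real (card I) \<le> N" and P: "c + d = P" "P > 0"
  shows "norm (\<Sum>i\<in>I. z i) ^ P
    \<le> 2 ^ P * (\<Sum>i\<in>I. norm (z i) ^ P) + (2 * N) ^ P * (\<Sum>i\<in>I. \<Sum>j\<in>I - {i}. norm (z i) ^ c * norm (z j) ^ d)"
    (is "_ \<le> 2 ^ P * ?A + (2 * N) ^ P * ?B")
proof (cases "I = {}")
  case True
  then show ?thesis using P by (simp add: zero_power)
next
  case False
  let ?Z = "norm (\<Sum>i\<in>I. z i)"
  have A0: "?A \<ge> 0" and B0: "?B \<ge> 0" by (intro sum_nonneg mult_nonneg_nonneg; simp)+
  have N0: "N \<ge> 0" using I(2) by (meson of_nat_0_le_iff order_trans)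
  define m where "m = Max ((\<lambda>i. norm (z i)) ` I)"
  have le: "norm (z i) \<le> m" if "i \<in> I" for i
    unfolding m_def using I that by (intro Max_ge) auto
  have "m \<in> (\<lambda>i. norm (z i)) ` I" unfolding m_def using I False by (intro Max_in) auto
  then obtain i0 where i0: "i0 \<in> I" "m = norm (z i0)" by blast
  show ?thesis
  proof (cases "?Z \<le> 2 * m")
    case True
    then have "?Z ^ P \<le> (2 * m) ^ P" by (intro power_mono) auto
    also have "\<dots> = 2 ^ P * norm (z i0) ^ P" by (simp add: power_mult_distrib i0)
    also have "\<dots> \<le> 2 ^ P * ?A"
      using i0(1) I(1) by (intro mult_left_mono member_le_sum) auto
    finally show ?thesis using B0 N0 by (simp add: add_increasing2)
  next
    case False
    have "\<exists>j\<in>I - {i0}. ?Z \<le> 2 * N * norm (z j)"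
    proof (rule ccontr)
      assume neg: "\<not> ?thesis"
      have split: "(\<Sum>i\<in>I. z i) = z i0 + (\<Sum>j\<in>I - {i0}. z j)" using I(1) i0(1) by (rule sum.remove)
      have "?Z \<le> m + norm (\<Sum>j\<in>I - {i0}. z j)"
        unfolding split i0(2) by (rule norm_triangle_ineq)
      then have half: "?Z < 2 * norm (\<Sum>j\<in>I - {i0}. z j)" using False by simp
      have "I - {i0} \<noteq> {}"
      proof
        assume "I - {i0} = {}"
        then show False using half norm_ge_zero[of "\<Sum>i\<in>I. z i"] by (simp only: sum.empty norm_zero)
      qed
      then have "N > 0" using I by (metis Diff_empty Diff_eq_empty_iff card_gt_0_iff i0(1) insert_absorb
          of_nat_0_less_iff order_less_le_trans empty_iff)
      have "norm (\<Sum>j\<in>I - {i0}. z j) \<le> (\<Sum>j\<in>I - {i0}. norm (z j))" by (rule norm_sum)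
      also have "\<dots> \<le> (\<Sum>j\<in>I - {i0}. ?Z / (2 * N))"
      proof (rule sum_mono)
        fix j assume "j \<in> I - {i0}"
        then have "2 * N * norm (z j) < ?Z" using neg by (auto simp: not_le)
        then show "norm (z j) \<le> ?Z / (2 * N)" using \<open>N > 0\<close> by (simp add: field_simps)
      qed
      also have "\<dots> = real (card (I - {i0})) * (?Z / (2 * N))" by simp
      also have "\<dots> \<le> N * (?Z / (2 * N))"
      proof (rule mult_right_mono)
        have "card (I - {i0}) \<le> card I" using I(1) by (intro card_mono) auto
        then show "real (card (I - {i0})) \<le> N" using I(2) by linarith
      qed (use \<open>N > 0\<close> in simp)
      also have "\<dots> = ?Z / 2" using \<open>N > 0\<close> by simp
      finally show False using half by simp
    qed
    then obtain j where j: "j \<in> I - {i0}" "?Z \<le> 2 * N * norm (z j)" by blast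
    have "?Z \<le> 2 * N * norm (z i0)"
      using j(2) mult_left_mono[OF le[of j], of "2 * N"] j(1) N0 by (simp add: i0(2)) 
    then have "?Z ^ c * ?Z ^ d \<le> (2 * N * norm (z i0)) ^ c * (2 * N * norm (z j)) ^ d"
      using j(2) N0 by (intro mult_mono power_mono) auto
    then have "?Z ^ P \<le> (2 * N) ^ P * (norm (z i0) ^ c * norm (z j) ^ d)"
      by (simp add: P(1)[symmetric] power_add power_mult_distrib ac_simps)
    also have "norm (z i0) ^ c * norm (z j) ^ d \<le> (\<Sum>j\<in>I - {i0}. norm (z i0) ^ c * norm (z j) ^ d)"
      using j(1) I(1) by (intro member_le_sum[of j "I - {i0}" "\<lambda>j. norm (z i0) ^ c * norm (z j) ^ d"]) auto
    also have "\<dots> \<le> ?B"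
      using i0(1) I(1) by (intro member_le_sum[of i0 I "\<lambda>i. \<Sum>j\<in>I - {i}. norm (z i) ^ c * norm (z j) ^ d"]) (auto
          intro!: sum_nonneg)
    finally show ?thesis using A0 N0 by (simp add: mult_left_mono add_increasing)
  qed
qed

lemma energy_part_le: "A \<in> residue_parts (p ^ m) S \<Longrightarrow> finite S \<Longrightarrow> m \<le> n \<Longrightarrow> energy p n \<Phi> w P A \<le> energy p n \<Phi> w P S"
  using member_le_sum[of A "residue_parts (p ^ m) S" "energy p n \<Phi> w P"] energy_residue_parts[of S m n p \<Phi> w P]
      energy_nonneg finite_residue_parts
  by simp

lemma le_if_all_eps:
  fixes x y c :: real
  assumes "c \<ge> 0" "\<And>\<delta>. \<delta> > 0 \<Longrightarrow> x \<le> y + c * \<delta>"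
  shows "x \<le> y"
proof (rule field_le_epsilon)
  fix e :: real assume e: "e > 0"
  have "x \<le> y + c * (e / (c + 1))" using assms(2)[of "e / (c + 1)"] assms(1) e by simp
  also have "c * (e / (c + 1)) \<le> e" using assms(1) e by (simp add: field_simps)
  finally show "x \<le> y + e" by simp
qed

text \<open>Single classes modulo p are rescaled and decoupled over n - 1 scales. For pairs of
  classes the first is used as it is (a = 1), but the iteration needs a large b, so the second is
  cut into classes modulo p^u without any cancellation.\<close>

lemma decouples_step:
  assumes p: "p > 1" and k: "k \<ge> 1" and l: "1 \<le> l" "l < k" and u: "u \<le> n" and n: "1 \<le> n" and B: "B \<ge> 0"
    and bilinear_bound: "bilinear_bound p k l 1 u n B" and decouples: "decouples p k (n - 1) D"
  defines "r \<equiv> real_of_int p"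
  shows "decouples p k n (2 ^ crit k * D / scale_factor p k 1 + (2 * r) ^ crit k * r ^ 2 * r powr (real u *
      (real (crit k) + 1)) * B)"
  unfolding decouples_def
proof (intro allI impI)
  fix \<Phi> M a and S :: "int set" assume nondegenerate: "nondegenerate p k M \<Phi>" and M: "k * n \<le> M" and S: "finite S"
  let ?P = "crit k" and ?c = "crit l"
  let ?d = "?P - ?c"
  let ?I = "residue_parts (p ^ 1) S"
  define E where "E = energy p n \<Phi> a ?P S"
  have p0: "p > 0" and r: "r > 1" using p by (simp_all add: r_def)
  have cd: "?c + ?d = ?P" "?d > 0" "?P > 0" using crit_strict_mono[OF l(2)] by auto
  have nfs: "scale_factor p k n = scale_factor p k 1 * scale_factor p k (n - 1)" using scale_factor_add[OF p0,
      of k 1 "n - 1"] n by simp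
  have npos: "scale_factor p k m > 0" for m by (rule scale_factor_pos[OF p0])
  have scale_factor1: "scale_factor p k 1 \<ge> 1" unfolding scale_factor_def using p crit_ge_2[OF k] by (intro
      ge_one_powr_ge_zero) auto
  have scale_factor_le: "scale_factor p k (n - m) \<le> scale_factor p k n" for m
  proof -
    have "real (n - m) * (real (crit k) / 2 - 1) \<le> real n * (real (crit k) / 2 - 1)"
      using crit_ge_2[OF k] by (intro mult_right_mono) auto
    then show ?thesis unfolding scale_factor_def using p by (intro powr_mono) auto
  qed
  have card_I: "real (card ?I) \<le> r" using card_residue_parts[of "p ^ 1" S] p0 S by (simp add: r_def)
  have fin_I: "finite ?I" using S by (rule finite_residue_parts)
  have finA: "finite A" if "A \<in> ?I" for A using residue_parts_subset[OF that] S by (rule finite_subset)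
  have E0: "E \<ge> 0" unfolding E_def by (rule energy_nonneg)
  have narrow: "(\<Sum>A\<in>?I. moment \<Phi> a ?P A) \<le> D * scale_factor p k (n - 1) * E"
  proof -
    have "(\<Sum>A\<in>?I. moment \<Phi> a ?P A) \<le> (\<Sum>A\<in>?I. D * scale_factor p k (n - 1) * energy p n \<Phi> a ?P A)"
    proof (rule sum_mono)
      fix A assume A: "A \<in> ?I"
      then obtain x where "x \<in> A" using residue_parts_nonempty by blast
      then have "\<forall>y\<in>A. [y = x] (mod p ^ 1)" using residue_parts_cong[OF A] by blast
      then show "moment \<Phi> a ?P A \<le> D * scale_factor p k (n - 1) * energy p n \<Phi> a ?P A"
        by (intro decouples_class[OF decouples p0 nondegenerate M n finA[OF A]])
    qed
    also have "\<dots> = D * scale_factor p k (n - 1) * E"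
      unfolding sum_distrib_left[symmetric] energy_residue_parts[OF S n] E_def ..
    finally show ?thesis .
  qed
  let ?G = "r powr (real u * (real ?P + 1)) * B"
  have broad: "avg \<Phi> (\<lambda>\<chi>. cmod (exp_sum a A \<chi>) ^ ?c * cmod (exp_sum a A' \<chi>) ^ ?d) \<le> ?G * (scale_factor p k n * E + \<delta>)"
    if A: "A \<in> ?I" "A' \<in> ?I" "A \<noteq> A'" and \<delta>: "\<delta> > 0" for A A' \<delta>
  proof -
    \<comment> \<open>One positive bound serves as both U and V; the term \<open>\<delta>\<close>
      keeps it positive when the energy is 0 and is sent to 0 at the end.\<close>
    define W where "W = scale_factor p k n * E + \<delta>"
    have W: "W > 0" using E0 npos[of n] \<delta> by (simp add: W_def add_nonneg_pos)
    obtain x where x: "x \<in> A" using residue_parts_nonempty[OF A(1)] by blast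
    have "x \<in> S" using x residue_parts_subset[OF A(1)] by blast
    have bound: "scale_factor p k (n - m) * energy p n \<Phi> a ?P B \<le> W" if "energy p n \<Phi> a ?P B \<le> E" for m B
    proof -
      have "scale_factor p k (n - m) * energy p n \<Phi> a ?P B \<le> scale_factor p k n * E"
        using that npos[of n] by (intro mult_mono scale_factor_le) (auto simp: energy_nonneg)
      then show ?thesis using \<delta> by (simp add: W_def)
    qed
    have part: "avg \<Phi> (\<lambda>\<chi>. cmod (exp_sum a A \<chi>) ^ ?c * cmod (exp_sum a Q \<chi>) ^ ?d) \<le> B * W" if Q: "Q \<in>
        residue_parts (p ^ u) A'" for Q
    proof -
      obtain y where y: "y \<in> Q" using residue_parts_nonempty[OF Q] by blast
      have yA: "y \<in> A'" using y residue_parts_subset[OF Q] by blast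
      have nc: "\<not> [x = y] (mod p)"
      proof
        assume "[x = y] (mod p)"
        then have "y \<in> {z \<in> S. [z = x] (mod p ^ 1)}" using yA residue_parts_subset[OF A(2)] by (auto intro: cong_sym)
        then have "y \<in> A" using residue_parts_eqI[OF A(1) x] by simp
        then show False using residue_parts_disjoint[OF A] yA by blast
      qed
      have "avg \<Phi> (\<lambda>\<chi>. cmod (exp_sum a A \<chi>) ^ ?c * cmod (exp_sum a Q \<chi>) ^ ?d)
          \<le> B * W powr (real ?c / real ?P) * W powr (1 - real ?c / real ?P)"
      proof (rule bilinear_boundD[OF bilinear_bound nondegenerate M finA[OF A(1)] _ _ _ nc W W])
        show "finite Q" using residue_parts_subset[OF Q] finA[OF A(2)] by (rule finite_subset)
        show "\<forall>z\<in>A. [z = x] (mod p ^ 1)" using residue_parts_cong[OF A(1) _ x] by blast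
        show "\<forall>z\<in>Q. [z = y] (mod p ^ u)" using residue_parts_cong[OF Q _ y] by blast
        have "energy p n \<Phi> a ?P A \<le> E" unfolding E_def by (rule energy_part_le[OF A(1) S n])
        then show "scale_factor p k (n - 1) * energy p n \<Phi> a ?P A \<le> W" by (rule bound)
        have "energy p n \<Phi> a ?P Q \<le> energy p n \<Phi> a ?P A'" by (rule energy_part_le[OF Q finA[OF A(2)] u])
        also have "\<dots> \<le> E" unfolding E_def by (rule energy_part_le[OF A(2) S n])
        finally show "scale_factor p k (n - u) * energy p n \<Phi> a ?P Q \<le> W" by (rule bound)
      qed
      also have "\<dots> = B * W" using W by (simp add: mult.assoc flip: powr_add)
      finally show ?thesis .
    qed
    have cu: "real (card (residue_parts (p ^ u) A')) \<le> r ^ u"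
      using card_residue_parts[of "p ^ u" A'] p0 finA[OF A(2)] by (simp add: r_def)
    \<comment> \<open>The crude cut: at most r^u parts, each bounded by B W, with a further factor
      r^(u d) from the power of the sum; together at most r^(u (crit k + 1)).\<close>
    have "avg \<Phi> (\<lambda>\<chi>. cmod (exp_sum a A \<chi>) ^ ?c * cmod (exp_sum a A' \<chi>) ^ ?d)
        \<le> avg \<Phi> (\<lambda>\<chi>. (r ^ u) ^ ?d * (\<Sum>Q\<in>residue_parts (p ^ u) A'. cmod (exp_sum a A \<chi>) ^ ?c * cmod (exp_sum a Q
            \<chi>) ^ ?d))"
    proof (rule avg_mono)
      fix \<chi>
      have "cmod (exp_sum a A' \<chi>) ^ ?d \<le> (r ^ u) ^ ?d * (\<Sum>Q\<in>residue_parts (p ^ u) A'. cmod (exp_sum a Q \<chi>) ^ ?d)"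
        unfolding exp_sum_residue_parts[OF finA[OF A(2)], of a \<chi> "p ^ u"]
        by (intro norm_sum_power_le finite_residue_parts finA[OF A(2)] cu cd(2))
      then have "cmod (exp_sum a A \<chi>) ^ ?c * cmod (exp_sum a A' \<chi>) ^ ?d
         \<le> cmod (exp_sum a A \<chi>) ^ ?c * ((r ^ u) ^ ?d * (\<Sum>Q\<in>residue_parts (p ^ u) A'. cmod (exp_sum a Q \<chi>) ^ ?d))"
        by (rule mult_left_mono) simp
      then show "cmod (exp_sum a A \<chi>) ^ ?c * cmod (exp_sum a A' \<chi>) ^ ?d
         \<le> (r ^ u) ^ ?d * (\<Sum>Q\<in>residue_parts (p ^ u) A'. cmod (exp_sum a A \<chi>) ^ ?c * cmod (exp_sum a Q \<chi>) ^ ?d)"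
        by (simp only: sum_distrib_left mult.left_commute)
    qed
    also have "\<dots> = (r ^ u) ^ ?d * (\<Sum>Q\<in>residue_parts (p ^ u) A'. avg \<Phi> (\<lambda>\<chi>. cmod (exp_sum a A \<chi>) ^ ?c * cmod
        (exp_sum a Q \<chi>) ^ ?d))"
      by (simp only: avg_mult avg_sum)
    also have "\<dots> \<le> (r ^ u) ^ ?d * (\<Sum>Q\<in>residue_parts (p ^ u) A'. B * W)"
      using r by (intro mult_left_mono sum_mono part) auto
    also have "\<dots> = (r ^ u) ^ ?d * (real (card (residue_parts (p ^ u) A')) * (B * W))" by simp
    also have "\<dots> \<le> (r ^ u) ^ ?P * (r ^ u * (B * W))"
      using cu r B W by (intro mult_mono power_increasing one_le_power) auto
    also have "\<dots> = (r ^ (u * ?P + u)) * B * W" by (simp add: power_add power_mult)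
    also have "r ^ (u * ?P + u) = r powr (real u * (real ?P + 1))"
      using r by (simp add: powr_realpow[symmetric] distrib_left)
    finally show ?thesis by (simp add: W_def)
  qed
  have "moment \<Phi> a ?P S \<le> (2 ^ ?P * D / scale_factor p k 1 + (2 * r) ^ ?P * r ^ 2 * ?G) * scale_factor p k n * E
      + ((2 * r) ^ ?P * (r ^ 2 * ?G)) * \<delta>"
    if \<delta>: "\<delta> > 0" for \<delta>
  proof -
    let ?W = "scale_factor p k n * E + \<delta>"
    have W0: "?W \<ge> 0" using E0 npos[of n] \<delta> by simp
    have G0: "?G \<ge> 0" using B by simp
    have "moment \<Phi> a ?P S \<le> avg \<Phi> (\<lambda>\<chi>. 2 ^ ?P * (\<Sum>A\<in>?I. cmod (exp_sum a A \<chi>) ^ ?P)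
        + (2 * r) ^ ?P * (\<Sum>A\<in>?I. \<Sum>A'\<in>?I - {A}. cmod (exp_sum a A \<chi>) ^ ?c * cmod (exp_sum a A' \<chi>) ^ ?d))"
      unfolding moment_def
    proof (rule avg_mono)
      fix \<chi>
      show "cmod (exp_sum a S \<chi>) ^ ?P \<le> 2 ^ ?P * (\<Sum>A\<in>?I. cmod (exp_sum a A \<chi>) ^ ?P)
        + (2 * r) ^ ?P * (\<Sum>A\<in>?I. \<Sum>A'\<in>?I - {A}. cmod (exp_sum a A \<chi>) ^ ?c * cmod (exp_sum a A' \<chi>) ^ ?d)"
        unfolding exp_sum_residue_parts[OF S, of a \<chi> "p ^ 1"] by (rule broad_narrow[OF fin_I card_I cd(1,3)])
    qed
    also have "\<dots> = 2 ^ ?P * (\<Sum>A\<in>?I. moment \<Phi> a ?P A) + (2 * r) ^ ?P *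
        (\<Sum>A\<in>?I. \<Sum>A'\<in>?I - {A}. avg \<Phi> (\<lambda>\<chi>. cmod (exp_sum a A \<chi>) ^ ?c * cmod (exp_sum a A' \<chi>) ^ ?d))"
      by (simp only: avg_add avg_mult avg_sum moment_def)
    also have "\<dots> \<le> 2 ^ ?P * (D * scale_factor p k (n - 1) * E) + (2 * r) ^ ?P * (r ^ 2 * (?G * ?W))"
    proof (intro add_mono mult_left_mono narrow)
      have "(\<Sum>A\<in>?I. \<Sum>A'\<in>?I - {A}. avg \<Phi> (\<lambda>\<chi>. cmod (exp_sum a A \<chi>) ^ ?c * cmod (exp_sum a A' \<chi>) ^ ?d))
          \<le> (\<Sum>A\<in>?I. \<Sum>A'\<in>?I - {A}. ?G * ?W)"
        by (intro sum_mono broad \<delta>) auto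
      also have "\<dots> \<le> (\<Sum>A\<in>?I. r * (?G * ?W))"
      proof (rule sum_mono)
        fix A
        have "card (?I - {A}) \<le> card ?I" using fin_I by (intro card_mono) auto
        then have "real (card (?I - {A})) \<le> r" using card_I by linarith
        then have "real (card (?I - {A})) * (?G * ?W) \<le> r * (?G * ?W)"
          by (rule mult_right_mono) (use G0 W0 in \<open>rule mult_nonneg_nonneg\<close>)
        then show "(\<Sum>A'\<in>?I - {A}. ?G * ?W) \<le> r * (?G * ?W)" by simp
      qed
      also have "\<dots> = real (card ?I) * (r * (?G * ?W))" by simp
      also have "\<dots> \<le> r * (r * (?G * ?W))"
        using card_I r G0 W0 by (intro mult_right_mono mult_nonneg_nonneg[of r] mult_nonneg_nonneg[of ?G]) auto
      finally show "(\<Sum>A\<in>?I. \<Sum>A'\<in>?I - {A}. avg \<Phi> (\<lambda>\<chi>. cmod (exp_sum a A \<chi>) ^ ?c * cmod (exp_sum a A' \<chi>) ^ ?d))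
          \<le> r ^ 2 * (?G * ?W)" by (simp only: power2_eq_square mult.assoc)
    qed (use r in auto)
    also have "D * scale_factor p k (n - 1) * E = D / scale_factor p k 1 * (scale_factor p k n * E)"
      using npos[of 1] by (simp add: nfs)
    finally show ?thesis by (simp add: algebra_simps)
  qed
  then have "moment \<Phi> a ?P S \<le> (2 ^ ?P * D / scale_factor p k 1 + (2 * r) ^ ?P * r ^ 2 * ?G) * scale_factor p k n * E"
  proof (rule le_if_all_eps[rotated])
    show "0 \<le> (2 * r) ^ ?P * (r ^ 2 * ?G)" using r B by (intro mult_nonneg_nonneg) auto
  qed
  then show "moment \<Phi> a ?P S \<le> (2 ^ ?P * D / scale_factor p k 1 + (2 * r) ^ ?P * r ^ 2 * r powr (real u * (real
      ?P + 1)) * B)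
      * scale_factor p k n * energy p n \<Phi> a ?P S"
    by (simp only: E_def mult.assoc)
qed

lemma decoupling_exp_mono:
  assumes "decoupling_exp p k \<eta>" "\<eta> \<le> \<eta>'" "p > 1"
  shows "decoupling_exp p k \<eta>'"
proof -
  obtain K where K: "K > 0" "\<And>n. decouples p k n (K * real_of_int p powr (\<eta> * real n))"
    using assms(1) unfolding decoupling_exp_def by blast
  have "decouples p k n (K * real_of_int p powr (\<eta>' * real n))" for n
    by (rule decouples_mono[OF K(2)]) (use assms K in \<open>auto intro!: mult_left_mono powr_mono mult_right_mono\<close>)
  then show ?thesis using K(1) unfolding decoupling_exp_def by blast
qed

text \<open>The origin of 16: 16^(P/2 - 1) = 2^(2P - 4) is at least 2^(P + 1) once P >= 5, and P =
  crit k >= 6.\<close>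

lemma narrow_factor:
  assumes p: "p \<ge> 16" and k: "k \<ge> 2"
  shows "2 ^ crit k / scale_factor p k 1 \<le> 1 / 2"
proof -
  have P: "6 \<le> crit k" using crit_mono[OF k] by (simp add: crit_def)
  have "2 * 2 ^ crit k = (2::real) powr (real (crit k) + 1)"
    by (simp add: powr_add powr_realpow)
  also have "\<dots> \<le> 2 powr (4 * (real (crit k) / 2 - 1))"
    using P by (intro powr_mono) auto
  also have "\<dots> = (2 powr 4) powr (real (crit k) / 2 - 1)" by (simp only: powr_powr)
  also have "(2::real) powr 4 = 16" by simp
  also have "16 powr (real (crit k) / 2 - 1) \<le> scale_factor p k 1"
    unfolding scale_factor_def using p P by (simp add: powr_mono2)
  finally show ?thesis using scale_factor_pos[of p k 1] p by (simp add: field_simps)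
qed

text \<open>The recursion D(n) <= D(n-1)/2 + L r^(\<eta>' n) is solved by a multiple of r^(\<eta>'
  n), with \<open>\<eta>'\<close> smaller by about 1/k^(t+1) than the exponent put in.\<close>

lemma decoupling_exp_improve:
  assumes p: "prime p" "int k < p" "16 \<le> p" and k: "k \<ge> 2" and \<eta>: "\<eta> \<ge> 0" "decoupling_exp p k \<eta>"
    and \<epsilon>: "\<epsilon> \<ge> 0" "\<And>l. 1 \<le> l \<Longrightarrow> l < k \<Longrightarrow> decoupling_exp p l \<epsilon>"
    and l: "1 \<le> l" "l < k" and gain: "real (crit k) + 2 \<le> gain k \<eta> t l"
    and \<eta>': "\<eta>' \<ge> 0" "\<eta> + real t * \<epsilon> - 1 / real (k ^ Suc t) \<le> \<eta>'"
  shows "decoupling_exp p k \<eta>'"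
proof -
  define r where "r = real_of_int p"
  define R where "R = k ^ Suc t"
  define n1 where "n1 = R * start_scale k t"
  have r: "r \<ge> 16" "r > 1" using p by (simp_all add: r_def)
  have p1: "p > 1" using p by simp
  have R: "R \<ge> 1" using k by (simp add: R_def)
  have thr2: "2 \<le> start_scale k t" using start_scale_ge[of k t] k by simp
  obtain K where K: "K > 0" "\<And>a b n. 1 \<le> a \<Longrightarrow> start_scale k t \<le> b \<Longrightarrow> l * a \<le> (k - l + 1) * b \<Longrightarrow> R * b \<le> n \<Longrightarrow>
    bilinear_bound p k l a b n (K * r powr ((\<eta> + real t * \<epsilon>) * real n - gain k \<eta> t l * real b))"
    using bilinear_bound_iterate[OF p(1,2) k \<eta> \<epsilon> l(2), of t] unfolding R_def r_def by blast
  define L where "L = (2 * r) ^ crit k * r ^ 2 * (K * r)"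
  have L: "L > 0" using r K by (simp add: L_def)
  have step: "decouples p k n (D / 2 + L * r powr (\<eta>' * real n))"
    if n: "n1 \<le> n" "1 \<le> n" and D: "decouples p k (n - 1) D" "D \<ge> 0" for n D
  proof -
    \<comment> \<open>The largest u for which the t rounds stay within n scales.\<close>
    define u where "u = n div R"
    have Ru: "R * u \<le> n" by (simp add: u_def)
    have nu: "n < R * u + R" using dividend_less_times_div[of R n] R by (simp add: u_def)
    have ut: "start_scale k t \<le> u"
      using n(1) R by (simp add: u_def n1_def less_eq_div_iff_mult_less_eq mult.commute)
    have "u \<le> R * u" using R by simp
    also note Ru
    finally have un: "u \<le> n" .
    let ?B = "K * r powr ((\<eta> + real t * \<epsilon>) * real n - gain k \<eta> t l * real u)"
    have "l * 1 \<le> 1 * u" using l(2) start_scale_ge[of k t] ut by simp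
    also have "1 * u \<le> (k - l + 1) * u" by (rule mult_le_mono1) simp
    finally have B: "bilinear_bound p k l 1 u n ?B" by (intro K(2) ut Ru) auto
    have d1: "decouples p k n (2 ^ crit k * D / scale_factor p k 1 + (2 * r) ^ crit k * r ^ 2 * r powr (real u *
        (real (crit k) + 1)) * ?B)"
      unfolding r_def using K(1) by (intro decouples_step[OF p1 _ l un n(2) _ B[unfolded r_def] D(1)]) (use k in auto)
    have d2: "2 ^ crit k * D / scale_factor p k 1 \<le> D / 2"
      using mult_right_mono[OF narrow_factor[OF p(3) k] D(2)] by simp
    \<comment> \<open>The cut costs (crit k + 1) u and the gain is at least (crit k + 2) u, so u >=
      n/R - 1 is saved. The lost 1 is the last factor r in \<open>L\<close>.\<close>
    have d3: "(2 * r) ^ crit k * r ^ 2 * r powr (real u * (real (crit k) + 1)) * ?B \<le> L * r powr (\<eta>' * real n)"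
    proof -
      have "real n \<le> real R * (real u + 1)" using nu by (simp add: distrib_left flip: of_nat_mult of_nat_add)
      then have "real n / real R \<le> real u + 1" using R by (simp add: field_simps)
      moreover have "(\<eta> + real t * \<epsilon> - 1 / real R) * real n \<le> \<eta>' * real n"
        using \<eta>'(2) by (intro mult_right_mono) (auto simp: R_def)
      moreover have "(real (crit k) + 2) * real u \<le> gain k \<eta> t l * real u"
        using gain by (intro mult_right_mono) auto
      ultimately have "real u * (real (crit k) + 1) + ((\<eta> + real t * \<epsilon>) * real n - gain k \<eta> t l * real u) \<le> \<eta>' *
          real n + 1"
        by (simp add: algebra_simps)
      then have "r powr (real u * (real (crit k) + 1) + ((\<eta> + real t * \<epsilon>) * real n - gain k \<eta> t l * real u)) \<le> r
          powr (\<eta>' * real n + 1)"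
        using r by (intro powr_mono) auto
      then have "((2 * r) ^ crit k * r ^ 2 * K) * (r powr (real u * (real (crit k) + 1)) * r powr ((\<eta> + real t *
          \<epsilon>) * real n - gain k \<eta> t l * real u))
          \<le> ((2 * r) ^ crit k * r ^ 2 * K) * (r powr (\<eta>' * real n) * r)"
        using r K(1) by (intro mult_left_mono) (auto simp: powr_add)
      then show ?thesis by (simp only: L_def ac_simps)
    qed
    show ?thesis by (rule decouples_mono[OF d1 add_mono[OF d2 d3]]) (use p1 in simp)
  qed
  \<comment> \<open>The term 2 L makes the induction close, as half of K' is inherited and L is
    added. The other term covers n < n1, where u would be too small, by the trivial bound.\<close>
  define K' where "K' = 2 * L + r powr (real (crit k) * real n1)"
  have K': "K' > 0" using L by (simp add: K'_def add_pos_nonneg)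
  have "decouples p k n (K' * r powr (\<eta>' * real n))" for n
  proof (induction n)
    case 0
    have "decouples p k 0 (r powr (real (crit k) * real 0))"
      unfolding r_def using p1 k by (intro decouples_trivial) auto
    moreover have "r powr (real (crit k) * real 0) \<le> K' * r powr (\<eta>' * real 0)"
      using L r by (simp add: K'_def ge_one_powr_ge_zero add_increasing)
    ultimately show ?case using p1 by (elim decouples_mono) auto
  next
    case (Suc n)
    show ?case
    proof (cases "n1 \<le> Suc n")
      case True
      have "decouples p k (Suc n) ((K' * r powr (\<eta>' * real n)) / 2 + L * r powr (\<eta>' * real (Suc n)))"
        using Suc.IH K' by (intro step True) auto
      moreover have "K' * r powr (\<eta>' * real n) \<le> K' * r powr (\<eta>' * real (Suc n))"
        using K' r \<eta>'(1) by (intro mult_left_mono powr_mono) auto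
      moreover have "2 * L * r powr (\<eta>' * real (Suc n)) \<le> K' * r powr (\<eta>' * real (Suc n))"
        by (intro mult_right_mono) (auto simp: K'_def)
      ultimately show ?thesis using p1 by (elim decouples_mono) auto
    next
      case False
      have "decouples p k (Suc n) (r powr (real (crit k) * real (Suc n)))"
        unfolding r_def using p1 k by (intro decouples_trivial) auto
      moreover have "r powr (real (crit k) * real (Suc n)) \<le> K' * r powr (\<eta>' * real (Suc n))"
      proof -
        have "r powr (real (crit k) * real (Suc n)) \<le> r powr (real (crit k) * real n1)"
          using False r by (intro powr_mono mult_left_mono) auto
        also have "\<dots> \<le> K' * 1" using L by (simp add: K'_def)
        also have "\<dots> \<le> K' * r powr (\<eta>' * real (Suc n))"
          using K' r \<eta>'(1) by (intro mult_left_mono ge_one_powr_ge_zero) auto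
        finally show ?thesis .
      qed
      ultimately show ?thesis using p1 by (elim decouples_mono) auto
    qed
  qed
  then show ?thesis unfolding decoupling_exp_def r_def[symmetric] using K' by blast
qed

text \<open>For k >= 2 the infimum h of the admissible exponents must be 0; otherwise an exponent
  close to h could be improved to one below h.\<close>

theorem decoupling:
  assumes p: "prime p" "16 \<le> p"
  shows "int k < p \<Longrightarrow> 1 \<le> k \<Longrightarrow> \<epsilon> > 0 \<Longrightarrow> decoupling_exp p k \<epsilon>"
proof (induction k arbitrary: \<epsilon> rule: less_induct)
  case (less k)
  have p1: "p > 1" using p by simp
  show ?case
  proof (cases "k = 1")
    case True
    have "decouples p 1 n (1 * real_of_int p powr (\<epsilon> * real n))" for n
      by (rule decouples_mono[OF decouples_1]) (use p1 less.prems in \<open>auto intro!: ge_one_powr_ge_zero\<close>)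
    then show ?thesis unfolding decoupling_exp_def True by (metis zero_less_one)
  next
    case False
    then have k: "k \<ge> 2" using less.prems by simp
    define H where "H = {\<eta>. \<eta> \<ge> 0 \<and> decoupling_exp p k \<eta>}"
    define h where "h = Inf H"
    have "decoupling_exp p k (real (crit k))"
      unfolding decoupling_exp_def using decouples_trivial[of p k] p1 less.prems by (intro exI[of _ 1]) auto
    then have ne: "H \<noteq> {}" unfolding H_def by force
    have bdd: "bdd_below H" by (auto simp: H_def)
    have h0: "h \<ge> 0" unfolding h_def using ne by (intro cInf_greatest) (auto simp: H_def)
    have "h = 0"
    proof (rule ccontr)
      assume "h \<noteq> 0"
      then have h: "h > 0" using h0 by simp
      \<comment> \<open>The number of rounds depends only on h, a lower bound for every admissible
        exponent. Hence the improvement 1/k^(t+1) is fixed before \<open>\<eta>\<close> is chosen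
        close to h.\<close>
      obtain t :: nat where "(real (crit k) + 2) * real k / h \<le> real t" using real_arch_simple by blast
      then have t: "(real (crit k) + 2) * real k \<le> real t * h" using h by (simp add: field_simps)
      \<comment> \<open>A quarter of the improvement: one x for \<open>\<eta>\<close> above h and
        one for the lower degree losses leave an exponent below h - 2x.\<close>
      define x where "x = 1 / (4 * real (k ^ Suc t))"
      have x: "x > 0" using k by (simp add: x_def)
      have "Inf H < h + x" using x by (simp add: h_def)
      then obtain \<eta> where \<eta>: "\<eta> \<in> H" "\<eta> < h + x" using cInf_lessD[OF ne] by blast
      then have \<eta>0: "\<eta> \<ge> 0" "decoupling_exp p k \<eta>" by (auto simp: H_def)
      have h\<eta>: "h \<le> \<eta>" unfolding h_def by (rule cInf_lower[OF \<eta>(1) bdd])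
      define \<epsilon>' where "\<epsilon>' = x / (real t + 1)"
      have \<epsilon>': "\<epsilon>' > 0" using x by (simp add: \<epsilon>'_def)
      have t\<epsilon>: "real t * \<epsilon>' \<le> x" using x by (simp add: \<epsilon>'_def field_simps)
      obtain l where l: "1 \<le> l" "l < k" "real t * \<eta> / real k \<le> gain k \<eta> t l"
        by (rule ex_large_gain[OF k \<eta>0(1)])
      have "(real (crit k) + 2) * real k \<le> real t * \<eta>"
        using t mult_left_mono[OF h\<eta>, of "real t"] by simp
      then have "real (crit k) + 2 \<le> real t * \<eta> / real k" using k by (simp add: field_simps)
      then have gain: "real (crit k) + 2 \<le> gain k \<eta> t l" using l(3) by simp
      define \<eta>' where "\<eta>' = max 0 (h - x)"
      have "decoupling_exp p k \<eta>'"
      proof (rule decoupling_exp_improve[OF p(1) less.prems(1) p(2) k \<eta>0 less_imp_le[OF \<epsilon>'] _ l(1,2) gain])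
        show "decoupling_exp p l \<epsilon>'" if "1 \<le> l" "l < k" for l
          using less.IH[OF that(2) _ that(1) \<epsilon>'] that less.prems(1) by simp
        show "\<eta>' \<ge> 0" by (simp add: \<eta>'_def)
        have "1 / real (k ^ Suc t) = 4 * x" by (simp add: x_def)
        then show "\<eta> + real t * \<epsilon>' - 1 / real (k ^ Suc t) \<le> \<eta>'"
          using \<eta>(2) t\<epsilon> x by (simp add: \<eta>'_def)
      qed
      then have "\<eta>' \<in> H" by (simp add: H_def \<eta>'_def)
      then have "h \<le> \<eta>'" unfolding h_def by (rule cInf_lower[OF _ bdd])
      then show False using h x by (simp add: \<eta>'_def)
    qed
    then have "Inf H < \<epsilon>" using less.prems by (simp add: h_def)
    then obtain \<eta> where \<eta>: "\<eta> \<in> H" "\<eta> < \<epsilon>" using cInf_lessD[OF ne] by blast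
    then show ?thesis using decoupling_exp_mono[of p k \<eta> \<epsilon>] p1 by (auto simp: H_def)
  qed
qed

section \<open>Vinogradov systems\<close>

definition poly_phase :: "int \<Rightarrow> nat \<Rightarrow> (nat \<Rightarrow> int) \<Rightarrow> int \<Rightarrow> complex" where
  "poly_phase q k \<alpha> x = ee q (\<Sum>j=1..k. \<alpha> j * x ^ j)"

definition weyl_phases :: "int \<Rightarrow> nat \<Rightarrow> (int \<Rightarrow> complex) set" where
  "weyl_phases q k = range (poly_phase q k)"

lemma ee_cong:
  assumes "q > 0" "q dvd s - t"
  shows "ee q s = ee q t"
proof -
  have "ee q s = ee q (s - t) * ee q t" by (simp flip: ee_add)
  then show ?thesis using assms by (simp add: ee_eq_1_iff)
qed

lemma phase_group_weyl:
  assumes q: "q > 0"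
  shows "phase_group (weyl_phases q k)"
proof (rule phase_groupI)
  have "weyl_phases q k \<subseteq> poly_phase q k ` ({1..k} \<rightarrow>\<^sub>E {0..<q})"
  proof
    fix \<chi> assume "\<chi> \<in> weyl_phases q k"
    then obtain \<alpha> where \<chi>: "\<chi> = poly_phase q k \<alpha>" unfolding weyl_phases_def by blast
    let ?\<beta> = "\<lambda>j\<in>{1..k}. \<alpha> j mod q"
    have "poly_phase q k \<alpha> x = poly_phase q k ?\<beta> x" for x
      unfolding poly_phase_def
    proof (rule ee_cong[OF q])
      have "(\<Sum>j=1..k. \<alpha> j * x ^ j) - (\<Sum>j=1..k. ?\<beta> j * x ^ j) = (\<Sum>j=1..k. (\<alpha> j - \<alpha> j mod q) * x ^ j)"
        by (simp add: sum_subtractf[symmetric] left_diff_distrib)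
      moreover have "q dvd (\<Sum>j=1..k. (\<alpha> j - \<alpha> j mod q) * x ^ j)"
        by (intro dvd_sum dvd_mult2) (simp add: minus_mod_eq_mult_div)
      ultimately show "q dvd (\<Sum>j=1..k. \<alpha> j * x ^ j) - (\<Sum>j=1..k. ?\<beta> j * x ^ j)" by simp
    qed
    then have "\<chi> = poly_phase q k ?\<beta>" unfolding \<chi> by (rule ext)
    moreover have "?\<beta> \<in> {1..k} \<rightarrow>\<^sub>E {0..<q}" using q by auto
    ultimately show "\<chi> \<in> poly_phase q k ` ({1..k} \<rightarrow>\<^sub>E {0..<q})" by (rule image_eqI)
  qed
  then show "finite (weyl_phases q k)" by (rule finite_subset) (intro finite_imageI finite_PiE; simp)
  have "(\<lambda>_. 1) = poly_phase q k (\<lambda>_. 0)" by (simp add: poly_phase_def fun_eq_iff)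
  then show "(\<lambda>_. 1) \<in> weyl_phases q k" unfolding weyl_phases_def by (metis rangeI)
next
  fix \<chi> \<psi> assume "\<chi> \<in> weyl_phases q k" "\<psi> \<in> weyl_phases q k"
  then obtain \<alpha> \<beta> where "\<chi> = poly_phase q k \<alpha>" "\<psi> = poly_phase q k \<beta>"
    unfolding weyl_phases_def by blast
  then have "(\<lambda>x. \<chi> x * \<psi> x) = poly_phase q k (\<lambda>j. \<alpha> j + \<beta> j)"
    by (simp add: fun_eq_iff poly_phase_def ee_add[symmetric] sum.distrib[symmetric] distrib_right)
  then show "(\<lambda>x. \<chi> x * \<psi> x) \<in> weyl_phases q k"
    unfolding weyl_phases_def by (metis rangeI)
qed (auto simp: weyl_phases_def poly_phase_def)

lemma nondegenerate_weyl:
  assumes p: "p > 0"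
  shows "nondegenerate p k M (weyl_phases (p ^ M) k)"
proof -
  have "monom 1 j + smult p 0 \<in> phases (weyl_phases (p ^ M) k) (p ^ M)" if j: "j \<in> {1..k}" for j
  proof -
    let ?\<alpha> = "\<lambda>i. if i = j then 1 else (0::int)"
    have "(\<Sum>i=1..k. ?\<alpha> i * x ^ i) = x ^ j" for x
    proof -
      have "(\<Sum>i=1..k. ?\<alpha> i * x ^ i) = (\<Sum>i=1..k. if i = j then x ^ i else 0)"
        by (intro sum.cong) auto
      then show ?thesis using j by simp
    qed
    then have "\<forall>x. poly_phase (p ^ M) k ?\<alpha> x = 1 * ee (p ^ M) (poly (monom 1 j + smult p 0) x)"
      by (simp add: poly_phase_def poly_monom)
    moreover have "poly_phase (p ^ M) k ?\<alpha> \<in> weyl_phases (p ^ M) k" by (simp add: weyl_phases_def)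
    ultimately show ?thesis unfolding phases_def by blast
  qed
  moreover have "phase_group (weyl_phases (p ^ M) k)" using p by (intro phase_group_weyl) simp
  ultimately show ?thesis unfolding nondegenerate_def by blast
qed

text \<open>The 2s-th power expands into characters of the group indexed by pairs of tuples; a
  character averages to 1 if it is trivial and to 0 otherwise.\<close>

lemma moment_eq_card:
  fixes s :: nat
  assumes \<Phi>: "phase_group \<Phi>" and S: "finite S"
  defines "X \<equiv> {1..s} \<rightarrow>\<^sub>E S"
  shows "moment \<Phi> (\<lambda>_. 1) (2 * s) S
    = real (card {(x, y). x \<in> X \<and> y \<in> X \<and> (\<forall>\<chi>\<in>\<Phi>. (\<Prod>i=1..s. \<chi> (x i)) * cnj (\<Prod>i=1..s. \<chi> (y i)) = 1)})"
    (is "_ = real (card ?Sol)")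
proof -
  define h where "h z \<chi> = (\<Prod>i=1..s. \<chi> (fst z i)) * cnj (\<Prod>i=1..s. \<chi> (snd z i))"
    for z :: "(nat \<Rightarrow> int) \<times> (nat \<Rightarrow> int)" and \<chi> :: "int \<Rightarrow> complex"
  have X: "finite X" unfolding X_def using S by (intro finite_PiE) auto
  have sol: "?Sol = {z \<in> X \<times> X. \<forall>\<chi>\<in>\<Phi>. h z \<chi> = 1}" by (auto simp: h_def)
  have avg_h: "avg \<Phi> (h z) = (if \<forall>\<chi>\<in>\<Phi>. h z \<chi> = 1 then 1 else 0)" for z
  proof (cases "\<forall>\<chi>\<in>\<Phi>. h z \<chi> = 1")
    case True
    then have "avg \<Phi> (h z) = avg \<Phi> (\<lambda>_. 1)" by (intro avg_cong) blast
    then show ?thesis using True avg_const[OF phase_group_finite[OF \<Phi>] phase_group_nonempty[OF \<Phi>]] by simp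
  next
    case False
    then obtain \<psi> where \<psi>: "\<psi> \<in> \<Phi>" "h z \<psi> \<noteq> 1" by blast
    have "avg \<Phi> (h z) = 0"
      by (rule avg_character[where h = "h z", OF \<Phi> _ \<psi>]) (simp add: h_def prod.distrib)
    then show ?thesis using False by simp
  qed
  have "complex_of_real (moment \<Phi> (\<lambda>_. 1) (2 * s) S) = avg \<Phi> (\<lambda>\<chi>. complex_of_real (cmod (\<Sum>x\<in>S. \<chi> x) ^ (2 * s)))"
    by (simp add: moment_def avg_def exp_sum_def)
  also have "\<dots> = avg \<Phi> (\<lambda>\<chi>. \<Sum>z\<in>X \<times> X. h z \<chi>)"
  proof (rule avg_cong)
    fix \<chi> :: "int \<Rightarrow> complex"
    have pw: "(\<Sum>x\<in>S. \<chi> x) ^ s = (\<Sum>g\<in>X. \<Prod>i=1..s. \<chi> (g i))"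
      using prod_sum_PiE[of "{1..s}" "\<lambda>_. S" "\<lambda>_. \<chi>"] S by (simp add: X_def)
    have "complex_of_real (cmod (\<Sum>x\<in>S. \<chi> x) ^ (2 * s)) = (complex_of_real ((cmod (\<Sum>x\<in>S. \<chi> x))\<^sup>2)) ^ s"
      by (simp add: power_mult)
    also have "\<dots> = (\<Sum>x\<in>S. \<chi> x) ^ s * cnj ((\<Sum>x\<in>S. \<chi> x) ^ s)"
      unfolding complex_norm_square by (simp add: power_mult_distrib)
    also have "\<dots> = (\<Sum>x\<in>X. \<Sum>y\<in>X. h (x, y) \<chi>)"
      unfolding pw by (simp add: sum_product h_def)
    also have "\<dots> = (\<Sum>z\<in>X \<times> X. h z \<chi>)" by (simp add: sum.cartesian_product)
    finally show "complex_of_real (cmod (\<Sum>x\<in>S. \<chi> x) ^ (2 * s)) = (\<Sum>z\<in>X \<times> X. h z \<chi>)" .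
  qed
  also have "\<dots> = (\<Sum>z\<in>X \<times> X. avg \<Phi> (h z))" by (rule avg_sum)
  also have "\<dots> = (\<Sum>z\<in>{z \<in> X \<times> X. \<forall>\<chi>\<in>\<Phi>. h z \<chi> = 1}. 1)"
    unfolding avg_h using X by (intro sum.inter_filter[symmetric]) simp
  also have "\<dots> = complex_of_real (real (card ?Sol))" unfolding sol by simp
  finally show ?thesis by (simp only: of_real_eq_iff)
qed

text \<open>An integral solution solves the system modulo every q, and the moment counts at least
  those solutions.\<close>

lemma vinogradov_J_le_moment:
  assumes q: "q > 0"
  shows "real (vinogradov_J s k X) \<le> moment (weyl_phases q k) (\<lambda>_. 1) (2 * s) {z. 1 \<le> z \<and> real_of_int z \<le> X}"
proof -
  let ?S = "{z. 1 \<le> z \<and> real_of_int z \<le> X}"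
  let ?Sol = "{(x, y). x \<in> {1..s} \<rightarrow>\<^sub>E ?S \<and> y \<in> {1..s} \<rightarrow>\<^sub>E ?S \<and>
    (\<forall>\<chi>\<in>weyl_phases q k. (\<Prod>i=1..s. \<chi> (x i)) * cnj (\<Prod>i=1..s. \<chi> (y i)) = 1)}"
  have "?S \<subseteq> {1..\<lfloor>X\<rfloor>}" by (auto simp: le_floor_iff)
  then have S: "finite ?S" by (rule finite_subset) simp
  have "vinogradov_solutions s k X \<subseteq> ?Sol"
  proof (rule subrelI)
    fix x y assume xy: "(x, y) \<in> vinogradov_solutions s k X"
    then have sys: "(\<Sum>i=1..s. x i ^ j - y i ^ j) = 0" if "j \<in> {1..k}" for j
      using that unfolding vinogradov_solutions_def by blast
    have "(\<Prod>i=1..s. \<chi> (x i)) * cnj (\<Prod>i=1..s. \<chi> (y i)) = 1" if weyl: "\<chi> \<in> weyl_phases q k" for \<chi>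
    proof -
      obtain \<alpha> where \<chi>: "\<chi> = poly_phase q k \<alpha>"
        using weyl unfolding weyl_phases_def by blast
      have prod: "(\<Prod>i\<in>I. ee q (f i)) = ee q (\<Sum>i\<in>I. f i)" for I :: "nat set" and f
        by (induction I rule: infinite_finite_induct) (simp_all add: ee_add)
      have "(\<Sum>i=1..s. \<Sum>j=1..k. \<alpha> j * x i ^ j) - (\<Sum>i=1..s. \<Sum>j=1..k. \<alpha> j * y i ^ j)
          = (\<Sum>i=1..s. \<Sum>j=1..k. \<alpha> j * (x i ^ j - y i ^ j))"
        by (simp add: sum_subtractf[symmetric] right_diff_distrib)
      also have "\<dots> = (\<Sum>j=1..k. \<alpha> j * (\<Sum>i=1..s. x i ^ j - y i ^ j))"
        by (subst sum.swap) (simp add: sum_distrib_left)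
      also have "\<dots> = 0" by (intro sum.neutral ballI) (simp only: sys mult_zero_right)
      finally have "(\<Sum>i=1..s. \<Sum>j=1..k. \<alpha> j * x i ^ j) = (\<Sum>i=1..s. \<Sum>j=1..k. \<alpha> j * y i ^ j)" by simp
      then show ?thesis unfolding \<chi> poly_phase_def prod by (simp add: cnj_ee flip: ee_add)
    qed
    then show "(x, y) \<in> ?Sol" using xy unfolding vinogradov_solutions_def by blast
  qed
  moreover have "finite ?Sol"
  proof (rule finite_subset)
    show "?Sol \<subseteq> ({1..s} \<rightarrow>\<^sub>E ?S) \<times> ({1..s} \<rightarrow>\<^sub>E ?S)" by blast
  qed (intro finite_cartesian_product finite_PiE S; simp)
  ultimately have "card (vinogradov_solutions s k X) \<le> card ?Sol" by (intro card_mono)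
  then show ?thesis
    unfolding vinogradov_J_def moment_eq_card[OF phase_group_weyl[OF q] S] by (rule of_nat_mono)
qed

lemma mean_value_critical:
  assumes k: "k \<ge> 1" and \<epsilon>: "\<epsilon> > 0"
  obtains K where "K > 0"
    "\<And>X. X \<ge> 1 \<Longrightarrow> \<exists>q>0. moment (weyl_phases q k) (\<lambda>_. 1) (crit k) {z. 1 \<le> z \<and> real_of_int z \<le> X} \<le> K * X powr
        (real (crit k) / 2 + \<epsilon>)"
proof -
  obtain p' :: nat where p': "prime p'" "p' > max k 16" using bigger_prime by blast
  define p where "p = int p'"
  have p: "prime p" "int k < p" "16 \<le> p" using p' by (auto simp: p_def)
  have p0: "p > 0" using p by simp
  define r where "r = real_of_int p"
  have r: "r > 1" using p by (simp add: r_def)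
  obtain K where K: "K > 0" "\<And>n. decouples p k n (K * r powr (\<epsilon> * real n))"
    using decoupling[OF p(1,3,2) k \<epsilon>] unfolding decoupling_exp_def r_def by blast
  define e where "e = \<epsilon> + (real (crit k) / 2 - 1)"
  have e: "e \<ge> 0" using \<epsilon> crit_ge_2[OF k] by (simp add: e_def)
  have "\<exists>q>0. moment (weyl_phases q k) (\<lambda>_. 1) (crit k) {z. 1 \<le> z \<and> real_of_int z \<le> X} \<le> (K * r powr e) * X powr
      (real (crit k) / 2 + \<epsilon>)"
    if X: "X \<ge> 1" for X
  proof -
    let ?S = "{z. 1 \<le> z \<and> real_of_int z \<le> X}"
    have S_sub: "?S \<subseteq> {1..\<lfloor>X\<rfloor>}" by (auto simp: le_floor_iff)
    then have S: "finite ?S" by (rule finite_subset) simp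
    have "card ?S \<le> card {1..\<lfloor>X\<rfloor>}" using S_sub by (intro card_mono) auto
    then have card_S: "real (card ?S) \<le> X" using X by simp linarith
    \<comment> \<open>The least n makes p^n exceed X by at most a factor p, which is a constant; it
      separates all points of the interval.\<close>
    define n where "n = (LEAST n. X < r ^ n)"
    have n: "X < r ^ n"
      unfolding n_def using real_arch_pow[OF r, of X] by (rule LeastI_ex)
    have rn: "r ^ n \<le> r * X"
    proof (cases n)
      case (Suc n')
      have "\<not> X < r ^ n'" using not_less_Least[of n' "\<lambda>n. X < r ^ n"] Suc by (simp add: n_def)
      then show ?thesis using Suc r by simp
    qed (use n X in simp)
    let ?\<Phi> = "weyl_phases (p ^ (k * n)) k"
    note \<Phi> = phase_group_weyl[of "p ^ (k * n)" k]
    \<comment> \<open>Every part is a single point with coefficient 1 and so has moment 1; the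
      energy merely counts points.\<close>
    have "energy p n ?\<Phi> (\<lambda>_. 1) (crit k) ?S = (\<Sum>A\<in>residue_parts (p ^ n) ?S. 1)"
      unfolding energy_def
    proof (rule sum.cong[OF refl])
      fix A assume A: "A \<in> residue_parts (p ^ n) ?S"
      obtain x where x: "x \<in> A" using residue_parts_nonempty[OF A] by blast
      have "y = x" if y: "y \<in> A" for y
      proof -
        have "[y = x] (mod p ^ n)" by (rule residue_parts_cong[OF A y x])
        then have "y mod p ^ n = x mod p ^ n" by (simp add: cong_def)
        moreover have "0 \<le> z \<and> z < p ^ n" if "z \<in> A" for z
        proof -
          have z: "1 \<le> z" "real_of_int z \<le> X" using residue_parts_subset[OF A] that by auto
          then have "real_of_int z < r ^ n" using n by linarith
          then have "real_of_int z < real_of_int (p ^ n)" by (simp only: r_def of_int_power)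
          then have "z < p ^ n" by (simp only: of_int_less_iff)
          then show ?thesis using z by simp
        qed
        ultimately show ?thesis using x y by (metis mod_pos_pos_trivial)
      qed
      then have "A = {x}" using x by blast
      then have "moment ?\<Phi> (\<lambda>_. 1) (crit k) A = avg ?\<Phi> (\<lambda>\<chi>. 1)"
        unfolding moment_def using phase_group_norm[OF \<Phi>] p0 by (intro avg_cong) (simp add: exp_sum_def)
      then show "moment ?\<Phi> (\<lambda>_. 1) (crit k) A = 1"
        using avg_const[OF phase_group_finite[OF \<Phi>] phase_group_nonempty[OF \<Phi>], where c = "1::real"] p0 by simp
    qed
    also have "\<dots> = real (card (residue_parts (p ^ n) ?S))" by simp
    also have "\<dots> \<le> real (card ?S)" unfolding residue_parts_def using S by (intro of_nat_mono card_image_le)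
    also have "\<dots> \<le> X" by (rule card_S)
    finally have energy: "energy p n ?\<Phi> (\<lambda>_. 1) (crit k) ?S \<le> X" .
    have "moment ?\<Phi> (\<lambda>_. 1) (crit k) ?S \<le> K * r powr (\<epsilon> * real n) * scale_factor p k n * energy p n ?\<Phi> (\<lambda>_. 1)
        (crit k) ?S"
      by (rule decouplesD[OF K(2) nondegenerate_weyl[OF p0] _ S]) simp
    also have "\<dots> \<le> K * r powr (\<epsilon> * real n) * scale_factor p k n * X"
      using K(1) scale_factor_pos[OF p0, of k n] energy by (intro mult_left_mono) auto
    also have "K * r powr (\<epsilon> * real n) * scale_factor p k n = K * (r ^ n) powr e"
      using r by (simp add: scale_factor_def r_def[symmetric] e_def powr_realpow[symmetric] powr_powr
          powr_add[symmetric] algebra_simps)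
    also have "K * (r ^ n) powr e * X \<le> K * (r * X) powr e * X"
      using K(1) rn e r X by (intro mult_right_mono mult_left_mono powr_mono2) auto
    also have "\<dots> = (K * r powr e) * (X powr e * X powr 1)" using r X by (simp add: powr_mult)
    also have "X powr e * X powr 1 = X powr (e + 1)" by (simp only: powr_add)
    also have "e + 1 = real (crit k) / 2 + \<epsilon>" by (simp add: e_def)
    finally show ?thesis using p0 by (intro exI[of _ "p ^ (k * n)"]) simp
  qed
  then show ?thesis using that[of "K * r powr e"] K(1) r by simp
qed

text \<open>Only the critical moment is known. Smaller s follow by comparing powers of the
  normalised square of the sum, larger s from the trivial bound X for the additional
  factors.\<close>

theorem vinogradov_mean_value:
  assumes k: "k \<ge> 1" and \<epsilon>: "\<epsilon> > 0"
  obtains C where "C > 0"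
    "\<And>X. X \<ge> 1 \<Longrightarrow> real (vinogradov_J s k X)
      \<le> C * (X powr (real s + \<epsilon>) + X powr (2 * real s - real k * (real k + 1) / 2 + \<epsilon>))"
proof -
  obtain K where K: "K > 0"
    "\<And>X. X \<ge> 1 \<Longrightarrow> \<exists>q>0. moment (weyl_phases q k) (\<lambda>_. 1) (crit k) {z. 1 \<le> z \<and> real_of_int z \<le> X} \<le> K * X powr
        (real (crit k) / 2 + \<epsilon>)"
    using mean_value_critical[OF k \<epsilon>] by blast
  define s0 where "s0 = crit k div 2"
  have s0: "crit k = 2 * s0" by (simp add: s0_def crit_def)
  have s0': "real s0 = real k * (real k + 1) / 2"
  proof -
    have "real (crit k) = 2 * real s0" by (simp add: s0)
    then show ?thesis by (simp add: crit_def distrib_left)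
  qed
  have "real (vinogradov_J s k X) \<le> (1 + K) * (X powr (real s + \<epsilon>) + X powr (2 * real s - real k * (real k + 1)
      / 2 + \<epsilon>))"
    if X: "X \<ge> 1" for X
  proof -
    let ?S = "{z. 1 \<le> z \<and> real_of_int z \<le> X}"
    have S_sub: "?S \<subseteq> {1..\<lfloor>X\<rfloor>}" by (auto simp: le_floor_iff)
    then have S: "finite ?S" by (rule finite_subset) simp
    have "card ?S \<le> card {1..\<lfloor>X\<rfloor>}" using S_sub by (intro card_mono) auto
    then have card_S: "real (card ?S) \<le> X" using X by simp linarith
    obtain q where q: "q > 0" "moment (weyl_phases q k) (\<lambda>_. 1) (2 * s0) ?S \<le> K * X powr (real s0 + \<epsilon>)"
      using K(2)[OF X] unfolding s0 by auto
    let ?\<Phi> = "weyl_phases q k"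
    let ?f = "\<lambda>\<chi>. cmod (exp_sum (\<lambda>_. 1) ?S \<chi>)"
    note \<Phi> = phase_group_weyl[OF q(1), of k]
    have J: "real (vinogradov_J s k X) \<le> avg ?\<Phi> (\<lambda>\<chi>. ?f \<chi> ^ (2 * s))"
      using vinogradov_J_le_moment[OF q(1)] unfolding moment_def .
    have m: "avg ?\<Phi> (\<lambda>\<chi>. ?f \<chi> ^ (2 * s0)) \<le> K * X powr (real s0 + \<epsilon>)"
      using q(2) unfolding moment_def .
    show ?thesis
    proof (cases "s \<le> s0")
      case True
      have "?f \<chi> ^ (2 * s) \<le> X ^ s * 1 + X ^ s / X ^ s0 * ?f \<chi> ^ (2 * s0)" for \<chi>
      proof -
        \<comment> \<open>Normalised by square root cancellation, so that t^s <= 1 + t^s0 yields a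
          main term X^s and a multiple of the critical moment of the same order up to
          \<open>\<epsilon>\<close>.\<close>
        define t where "t = (?f \<chi>)\<^sup>2 / X"
        have t0: "t \<ge> 0" using X by (simp add: t_def)
        have ft: "?f \<chi> ^ (2 * i) = X ^ i * t ^ i" for i
          using X by (simp add: t_def power_mult power_mult_distrib[symmetric])
        have "t ^ s \<le> 1 + t ^ s0"
        proof (cases "t \<le> 1")
          case True
          then have "t ^ s \<le> 1" using t0 by (simp add: power_le_one)
          then show ?thesis using t0 by (simp add: add_increasing2)
        next
          case False
          then have "t ^ s \<le> t ^ s0" using \<open>s \<le> s0\<close> by (intro power_increasing) auto
          then show ?thesis by simp
        qed
        then have "X ^ s * t ^ s \<le> X ^ s * (1 + t ^ s0)" using X by (intro mult_left_mono) auto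
        then show ?thesis unfolding ft using X by (simp add: distrib_left)
      qed
      then have "avg ?\<Phi> (\<lambda>\<chi>. ?f \<chi> ^ (2 * s)) \<le> avg ?\<Phi> (\<lambda>\<chi>. X ^ s * 1 + X ^ s / X ^ s0 * ?f \<chi> ^ (2 * s0))"
        by (intro avg_mono)
      also have "\<dots> = X ^ s * 1 + X ^ s / X ^ s0 * avg ?\<Phi> (\<lambda>\<chi>. ?f \<chi> ^ (2 * s0))"
        by (simp only: avg_add avg_mult avg_const[OF phase_group_finite[OF \<Phi>] phase_group_nonempty[OF \<Phi>]])
      also have "\<dots> \<le> X ^ s * 1 + X ^ s / X ^ s0 * (K * X powr (real s0 + \<epsilon>))"
        using X m by (intro add_left_mono mult_left_mono) auto
      also have "\<dots> = X powr (real s) + K * X powr (real s + \<epsilon>)"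
        using X by (simp add: powr_add powr_realpow[symmetric])
      also have "\<dots> \<le> X powr (real s + \<epsilon>) + K * X powr (real s + \<epsilon>)"
        using X \<epsilon> by (intro add_right_mono powr_mono) auto
      also have "\<dots> \<le> (1 + K) * (X powr (real s + \<epsilon>) + X powr (2 * real s - real k * (real k + 1) / 2 + \<epsilon>))"
        using K(1) by (simp add: algebra_simps add_increasing2)
      finally show ?thesis using J by simp
    next
      case False
      have "?f \<chi> ^ (2 * s) \<le> X ^ (2 * (s - s0)) * ?f \<chi> ^ (2 * s0)" if \<chi>: "\<chi> \<in> ?\<Phi>" for \<chi>
      proof -
        have "?f \<chi> \<le> (\<Sum>x\<in>?S. cmod (1 * \<chi> x))" unfolding exp_sum_def by (rule norm_sum)
        also have "\<dots> = real (card ?S)" using phase_group_norm[OF \<Phi> \<chi>] by simp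
        finally have "?f \<chi> \<le> X" using card_S by simp
        then have "?f \<chi> ^ (2 * (s - s0)) * ?f \<chi> ^ (2 * s0) \<le> X ^ (2 * (s - s0)) * ?f \<chi> ^ (2 * s0)"
          by (intro mult_right_mono power_mono) auto
        moreover have "?f \<chi> ^ (2 * s) = ?f \<chi> ^ (2 * (s - s0)) * ?f \<chi> ^ (2 * s0)"
          unfolding power_add[symmetric] using False by (intro arg_cong[where f = "\<lambda>i. ?f \<chi> ^ i"]) simp
        ultimately show ?thesis by (simp only:)
      qed
      then have "avg ?\<Phi> (\<lambda>\<chi>. ?f \<chi> ^ (2 * s)) \<le> avg ?\<Phi> (\<lambda>\<chi>. X ^ (2 * (s - s0)) * ?f \<chi> ^ (2 * s0))"
        by (rule avg_mono)
      also have "\<dots> = X ^ (2 * (s - s0)) * avg ?\<Phi> (\<lambda>\<chi>. ?f \<chi> ^ (2 * s0))" by (rule avg_mult)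
      also have "\<dots> \<le> X ^ (2 * (s - s0)) * (K * X powr (real s0 + \<epsilon>))"
        using X m by (intro mult_left_mono) auto
      also have "X ^ (2 * (s - s0)) = X powr (real (2 * (s - s0)))" using X by (intro powr_realpow[symmetric]) simp
      also have "X powr (real (2 * (s - s0))) * (K * X powr (real s0 + \<epsilon>)) = K * X powr (real (2 * (s - s0)) +
          (real s0 + \<epsilon>))"
        by (simp only: powr_add mult.left_commute)
      also have "real (2 * (s - s0)) + (real s0 + \<epsilon>) = 2 * real s - real k * (real k + 1) / 2 + \<epsilon>"
        using False unfolding s0'[symmetric] by (simp add: of_nat_diff)
      also have "K * X powr (2 * real s - real k * (real k + 1) / 2 + \<epsilon>)
          \<le> (1 + K) * (X powr (real s + \<epsilon>) + X powr (2 * real s - real k * (real k + 1) / 2 + \<epsilon>))"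
        using K(1) by (intro mult_mono) auto
      finally show ?thesis using J by simp
    qed
  qed
  then show ?thesis using that[of "1 + K"] K(1) by simp
qed

text \<open>The condition on d says that the exponent is at least s + \<epsilon>, so both terms of
  the mean value are dominated. The constant is chosen before d, so that one C serves all m.\<close>

lemma vinogradov_bound:
  assumes k: "k \<ge> 1" and \<epsilon>: "\<epsilon> > 0"
  shows "\<exists>C. \<forall>d. 0 \<le> d \<and> real k * (real k + 1) / 2 \<le> real s + d \<longrightarrow>
    (\<forall>X\<ge>1. real (vinogradov_J s k X) \<le> C * X powr (2 * real s - real k * (real k + 1) / 2 + d + \<epsilon>))"
proof -
  obtain C where C: "C > 0" "\<And>X. X \<ge> 1 \<Longrightarrow> real (vinogradov_J s k X)
      \<le> C * (X powr (real s + \<epsilon>) + X powr (2 * real s - real k * (real k + 1) / 2 + \<epsilon>))"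
    using vinogradov_mean_value[OF k \<epsilon>, of s] by blast
  have "real (vinogradov_J s k X) \<le> (C * 2) * X powr (2 * real s - real k * (real k + 1) / 2 + d + \<epsilon>)"
    if d: "0 \<le> d" "real k * (real k + 1) / 2 \<le> real s + d" and X: "X \<ge> 1" for d X
  proof -
    let ?E = "X powr (2 * real s - real k * (real k + 1) / 2 + d + \<epsilon>)"
    have "X powr (real s + \<epsilon>) \<le> ?E" "X powr (2 * real s - real k * (real k + 1) / 2 + \<epsilon>) \<le> ?E"
      using d X by (auto intro!: powr_mono)
    then have "C * (X powr (real s + \<epsilon>) + X powr (2 * real s - real k * (real k + 1) / 2 + \<epsilon>)) \<le> C * (2 * ?E)"
      using C(1) by (intro mult_left_mono) auto
    then show ?thesis using C(2)[OF X] by simp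
  qed
  then show ?thesis by blast
qed

text \<open>In (ii) the case k = 1, m = 0, s = 0 has one solution, while X^(-1 + \<epsilon>) tends
  to 0 for \<epsilon> < 1; this is what \<open>s \<ge> 1\<close> excludes. For k = 1 the quotient is
  0/0, which is 0.\<close>

theorem theorem1p2:
  fixes k :: nat
  assumes "k \<ge> 1"
  shows
    "(\<forall>s::nat. \<forall>\<epsilon>::real. \<epsilon> > 0 \<longrightarrow>
        (\<exists>C::real. \<forall>m::nat. 2 * m \<le> k \<and> s \<ge> (k - m)\<^sup>2 + (k - m) \<longrightarrow>
           (\<forall>X::real. X \<ge> 1 \<longrightarrow>
              real (vinogradov_J s k X) \<le>
                C * X powr (2 * real s - real k * (real k + 1) / 2 + (real m)\<^sup>2 + \<epsilon>))))
     \<and>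
     (\<forall>s::nat. \<forall>\<epsilon>::real. s \<ge> 1 \<and> \<epsilon> > 0 \<longrightarrow>
        (\<exists>C::real. \<forall>m::nat. 2 * m + 1 \<le> k \<and> s \<ge> (k - m)\<^sup>2 - 1 \<longrightarrow>
           (\<forall>X::real. X \<ge> 1 \<longrightarrow>
              real (vinogradov_J s k X) \<le>
                C * X powr (2 * real s - real k * (real k + 1) / 2
                   + ((real m)\<^sup>2 + real m + real m / (real k - real m - 1)) + \<epsilon>))))"
proof (intro conjI allI impI)
  fix s :: nat and \<epsilon> :: real assume \<epsilon>: "\<epsilon> > 0"
  obtain C where C: "\<And>d X. 0 \<le> d \<and> real k * (real k + 1) / 2 \<le> real s + d \<Longrightarrow> X \<ge> 1 \<Longrightarrow>
      real (vinogradov_J s k X) \<le> C * X powr (2 * real s - real k * (real k + 1) / 2 + d + \<epsilon>)"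
    using vinogradov_bound[OF assms \<epsilon>, of s] by blast
  have d: "0 \<le> (real m)\<^sup>2 \<and> real k * (real k + 1) / 2 \<le> real s + (real m)\<^sup>2" if m: "2 * m \<le> k \<and> s \<ge> (k - m)\<^sup>2 +
      (k - m)" for m
  proof -
    obtain n where k: "k = 2 * m + n" using m le_Suc_ex by blast
    have "(m + n)\<^sup>2 + (m + n) \<le> s" using m by (simp add: k)
    then have "real ((m + n)\<^sup>2 + (m + n)) \<le> real s" by (rule of_nat_mono)
    then have s: "(real m + real n)\<^sup>2 + (real m + real n) \<le> real s" by simp
    \<comment> \<open>With n = k - 2m the required inequality has the slack n(n+1)/2.\<close>
    have "real k * (real k + 1) / 2 = (real m + real n)\<^sup>2 + (real m + real n) + (real m)\<^sup>2 - real n * (real n +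
        1) / 2"
      by (simp add: k power2_eq_square field_simps)
    moreover have "0 \<le> real n * (real n + 1) / 2" by simp
    ultimately have "real k * (real k + 1) / 2 \<le> real s + (real m)\<^sup>2" using s by linarith
    then show ?thesis by simp
  qed
  show "\<exists>C. \<forall>m. 2 * m \<le> k \<and> s \<ge> (k - m)\<^sup>2 + (k - m) \<longrightarrow> (\<forall>X. X \<ge> 1 \<longrightarrow>
      real (vinogradov_J s k X) \<le> C * X powr (2 * real s - real k * (real k + 1) / 2 + (real m)\<^sup>2 + \<epsilon>))"
    by (intro exI[of _ C] allI impI C d)
next
  fix s :: nat and \<epsilon> :: real assume s1: "s \<ge> 1 \<and> \<epsilon> > 0"
  then have \<epsilon>: "\<epsilon> > 0" ..
  let ?d = "\<lambda>m. (real m)\<^sup>2 + real m + real m / (real k - real m - 1)"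
  obtain C where C: "\<And>d X. 0 \<le> d \<and> real k * (real k + 1) / 2 \<le> real s + d \<Longrightarrow> X \<ge> 1 \<Longrightarrow>
      real (vinogradov_J s k X) \<le> C * X powr (2 * real s - real k * (real k + 1) / 2 + d + \<epsilon>)"
    using vinogradov_bound[OF assms \<epsilon>, of s] by blast
  have d: "0 \<le> ?d m \<and> real k * (real k + 1) / 2 \<le> real s + ?d m" if m: "2 * m + 1 \<le> k \<and> s \<ge> (k - m)\<^sup>2 - 1" for m
  proof -
    obtain n where k: "k = 2 * m + 1 + n" using m le_Suc_ex by blast
    have denom: "real k - real m - 1 = real m + real n" by (simp add: k)
    have "(m + 1 + n)\<^sup>2 - 1 \<le> s" using m by (simp add: k)
    then have "(m + 1 + n)\<^sup>2 \<le> s + 1" by simp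
    then have "real ((m + 1 + n)\<^sup>2) \<le> real (s + 1)" by (rule of_nat_mono)
    then have s: "(real m + 1 + real n)\<^sup>2 \<le> real s + 1" by (simp only: of_nat_power of_nat_add of_nat_1)
    \<comment> \<open>The 1 missing from s >= (k - m)^2 - 1 is recovered from the slack n(n+1)/2 if
      n >= 1, and from the quotient, which is then m/m, if n = 0.\<close>
    have key: "1 \<le> real n * (real n + 1) / 2 + real m / (real m + real n)" if "m + n > 0"
    proof (cases "n = 0")
      case True
      then show ?thesis using that by simp
    next
      case False
      then have "1 \<le> real n" by simp
      then have "1 * 2 \<le> real n * (real n + 1)" by (intro mult_mono) auto
      then show ?thesis by (simp add: add_increasing2)
    qed
    have "real k * (real k + 1) / 2 \<le> real s + ?d m"
    proof (cases "m + n > 0")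
      case True
      have "real k * (real k + 1) / 2 = (real m + 1 + real n)\<^sup>2 + (real m)\<^sup>2 + real m - real n * (real n + 1) / 2"
        by (simp add: k power2_eq_square field_simps)
      then show ?thesis unfolding denom using s key[OF True] by linarith
    next
      case False
      \<comment> \<open>Here k = 1 and m = 0, so the inequality reads 1 <= s.\<close>
      then show ?thesis using s1 by (simp add: k)
    qed
    moreover have "0 \<le> ?d m" unfolding denom by simp
    ultimately show ?thesis by simp
  qed
  show "\<exists>C. \<forall>m. 2 * m + 1 \<le> k \<and> s \<ge> (k - m)\<^sup>2 - 1 \<longrightarrow> (\<forall>X. X \<ge> 1 \<longrightarrow>
      real (vinogradov_J s k X) \<le> C * X powr (2 * real s - real k * (real k + 1) / 2 + ?d m + \<epsilon>))"
    by (intro exI[of _ C] allI impI C d)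
qed

end
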